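(* Let $E$ be a graph, $w\in\mathrm{reg}(E)$, $s_E^{-1}(w)=\{e_1,\ldots,e_n\}$ (distinct edges), and let $E_{\widehat O}$ be the maximal out-split of $E$ at $w$ with respect to the partition $\epsilon_i=\{e_i\}$, $i=1,\ldots,n$. Let $f\colon E_{\widehat O}\to E$ be the multi-out-split homomorphism and $f^*\colon C^*(E)\to C^*(E_{\widehat O})$ the contravariantly induced $*$-isomorphism. Then the maps $\varphi^0\colon E_{\widehat O}^0\to S(E)$ and $\varphi^1\colon E_{\widehat O}^1\to S(E)$ given by $$\varphi^0(v^i)=\begin{cases}(v,v)& v^i\notin\{w^1,\ldots,w^n\}\\ (e_i,e_i)& v^i=w^i\end{cases},\qquad \varphi^1(e^i)=\begin{cases}(e,t_E(e))& t_{E_{\widehat O}}(e^i)\notin\{w^1,\ldots,w^n\}\\ (ee_i,e_i)& t_{E_{\widehat O}}(e^i)=w^i\end{cases}$$ determine a regular extended path homomorphism $\varphi\colon S(E_{\widehat O})\to S(E)$ that covariantly induces the inverse of $f^*$, that is, $\varphi_*=(f^* )^{-1}\colon C^*(E_{\widehat O})\to C^*(E)$.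
   Context: A graph $E=(E^0,E^1,s_E,t_E)$ consists of arbitrary sets of vertices and edges with source and target maps $s_E,t_E\colon E^1\to E^0$. A vertex $v$ is regular if $s_E^{-1}(v)$ is finite and nonempty; $\mathrm{reg}(E)$ is the set of regular vertices. $\mathrm{FP}(E)$ is the set of finite paths (vertices, of length $0$, and sequences $e_1\ldots e_n$ of edges with $t_E(e_i)=s_E(e_{i+1})$); vertices act as units for concatenation. Maximal out-split at $w\in\mathrm{reg}(E)$ with $s_E^{-1}(w)=\{e_1,\dots,e_n\}$: put $m(w)=n$ and $m(v)=1$ for $v\ne w$. Then $E_{\widehat O}^0=\{v^i\mid v\in E^0,1\le i\le m(v)\}$, $E_{\widehat O}^1=\{e^i\mid e\in E^1,1\le i\le m(t_E(e))\}$, $t_{E_{\widehat O}}(e^i)=t_E(e)^i$, and $s_{E_{\widehat O}}(e^i)=s_E(e)^1$ if $s_E(e)\neq w$, while $s_{E_{\widehat O}}(e_j^i)=w^j$. The multi-out-split homomorphism is the graph homomorphism $f\colon E_{\widehat O}\to E$, $f(v^i)=v$, $f(e^i)=e$. $C^*(E)$ is the universal C*-algebra generated by mutually orthogonal projections $S_v$ ($v\in E^0$) and elements $S_e$ ($e\in E^1$) with $S_e^*S_{e'}=\delta_{e,e'}S_{t_E(e)}$, $S_{s_E(e)}S_e=S_e$, and $S_v=\sum_{e\in s_E^{-1}(v)}S_eS_e^*$ for $v\in\mathrm{reg}(E)$. For a path $\alpha=e_1\ldots e_n$, $S_\alpha=S_{e_1}\cdots S_{e_n}$; put $S_{(\alpha,\beta)}=S_\alpha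 S_\beta^*$ and $S_0=0$. The induced $f^*$ is given by $S_v\mapsto\sum_{i=1}^{m(v)}S_{v^i}$, $S_e\mapsto\sum_{i=1}^{m(t_E(e))}S_{e^i}$, and is known to be a $*$-isomorphism. The graph inverse semigroup is $S(E)=\{(\alpha,\beta)\in \mathrm{FP}(E)^2\mid t_E(\alpha)=t_E(\beta)\}\cup\{0\}$ with $(\alpha,\beta)(\gamma,\delta)=(\alpha\gamma',\delta)$ if $\gamma=\beta\gamma'$, $=(\alpha,\delta\beta')$ if $\beta=\gamma\beta'$, and $=0$ otherwise; $0$ is a zero element. It is an inverse semigroup with $(\alpha,\beta)^*=(\beta,\alpha)$ and natural order $s\le t\iff ss^*t=s$. An extended path homomorphism from $E$ to $F$ is a semigroup homomorphism $\varphi\colon S(E)\to S(F)$ with $\varphi(0)=0$. Maps $\varphi^0\colon E^0\to S(F)$, $\varphi^1\colon E^1\to S(F)$ determine $\varphi$ if $\varphi$ is the (necessarily unique) extended path homomorphism with $\varphi(v,v)=\varphi^0(v)$ and $\varphi(e,t_E(e))=\varphi^1(e)$. $\varphi$ is regular if whenever $u\in\mathrm{reg}(E)$, $0\ne t\in S(F)$ and $t\le\varphi(u,u)$, there exists $e\in s_E^{-1}(u)$ with $t\varphi(e,e)\neq0$. A regular $\varphi$ induces the $*$-homomorphism $\varphi_*\colon C^*(E)\to C^*(F)$, $S_v\mapsto S_{\varphi(v,v)}$, $S_e\mapsto S_{\varphi(e,t_E(e))}$. *)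

theory Defs
  imports
    Complex_Main
    "HOL-Library.FuncSet"
    "HOL-Library.Sublist"
    "HOL-Algebra.Module"
    "Graph_Theory.Arc_Walk"
begin

section \<open>Universal C*-algebras\<close>

text \<open>
  Complex *-algebras are not assumed to be unital; the field \<open>one\<close> inherited from the
  ring record is never used.
\<close>

record 'a star_algebra = "(complex, 'a) module" +
  adj :: "'a \<Rightarrow> 'a"

record 'a normed_star_algebra = "'a star_algebra" +
  nrm :: "'a \<Rightarrow> real"

text \<open>
  The free (non-unital) complex *-algebra on \<open>X\<close>: finitely supported functions on the nonempty
  words in the letters \<open>(x, False)\<close>, standing for the generator \<open>x\<close>, and \<open>(x, True)\<close>, standing
  for its adjoint.
\<close>

definition free_star_algebra :: "'g set \<Rightarrow> (('g \<times> bool) list \<Rightarrow> complex) star_algebra" where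
  "free_star_algebra X =
    \<lparr> carrier = {a. finite {u. a u \<noteq> 0} \<and> (\<forall>u. a u \<noteq> 0 \<longrightarrow> u \<noteq> [] \<and> fst ` set u \<subseteq> X)},
      mult = (\<lambda>a b u. \<Sum>k\<le>length u. a (take k u) * b (drop k u)),
      one = undefined,
      zero = (\<lambda>u. 0),
      add = (\<lambda>a b u. a u + b u),
      smult = (\<lambda>c a u. c * a u),
      adj = (\<lambda>a u. cnj (a (rev (map (\<lambda>(x, s). (x, \<not> s)) u)))) \<rparr>"

definition free_gen :: "'g \<Rightarrow> ('g \<times> bool) list \<Rightarrow> complex" where
  "free_gen x = (\<lambda>u. if u = [(x, False)] then 1 else 0)"

definition cstar_seminorm :: "('a, 'm) star_algebra_scheme \<Rightarrow> ('a \<Rightarrow> real) \<Rightarrow> bool" where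
  "cstar_seminorm A p \<longleftrightarrow>
    (\<forall>a\<in>carrier A. 0 \<le> p a) \<and>
    (\<forall>a\<in>carrier A. \<forall>b\<in>carrier A. p (a \<oplus>\<^bsub>A\<^esub> b) \<le> p a + p b) \<and>
    (\<forall>c. \<forall>a\<in>carrier A. p (c \<odot>\<^bsub>A\<^esub> a) = cmod c * p a) \<and>
    (\<forall>a\<in>carrier A. \<forall>b\<in>carrier A. p (a \<otimes>\<^bsub>A\<^esub> b) \<le> p a * p b) \<and>
    (\<forall>a\<in>carrier A. p (adj A a \<otimes>\<^bsub>A\<^esub> a) = (p a)\<^sup>2)"

text \<open>
  A set \<open>R\<close> of pairs \<open>(a, b)\<close> stands for the relations \<open>a = b\<close>. The C*-seminorms vanishing on
  all \<open>a - b\<close> are exactly the functions \<open>x \<mapsto> \<parallel>\<pi> x\<parallel>\<close> for representations \<open>\<pi>\<close> of the relations in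
  C*-algebras, so the following is the usual universal seminorm. It is finite only if the
  relations bound the norms of the generators, as those of a graph C*-algebra do.
\<close>

definition universal_seminorm ::
    "('a, 'm) star_algebra_scheme \<Rightarrow> ('a \<times> 'a) set \<Rightarrow> 'a \<Rightarrow> real" where
  "universal_seminorm A R x =
    (SUP p\<in>{p. cstar_seminorm A p \<and> (\<forall>(a, b)\<in>R. p (a \<ominus>\<^bsub>A\<^esub> b) = 0)}. p x)"

definition cauchy_seqs :: "('a, 'm) star_algebra_scheme \<Rightarrow> ('a \<Rightarrow> real) \<Rightarrow> (nat \<Rightarrow> 'a) set" where
  "cauchy_seqs A p = {X. range X \<subseteq> carrier A \<and>
    (\<forall>\<epsilon>>0. \<exists>N. \<forall>m\<ge>N. \<forall>n\<ge>N. p (X m \<ominus>\<^bsub>A\<^esub> X n) < \<epsilon>)}"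

definition null_rel ::
    "('a, 'm) star_algebra_scheme \<Rightarrow> ('a \<Rightarrow> real) \<Rightarrow> ((nat \<Rightarrow> 'a) \<times> (nat \<Rightarrow> 'a)) set" where
  "null_rel A p = {(X, Y). X \<in> cauchy_seqs A p \<and> Y \<in> cauchy_seqs A p \<and>
    (\<lambda>n. p (X n \<ominus>\<^bsub>A\<^esub> Y n)) \<longlonglongrightarrow> 0}"

definition seq_class ::
    "('a, 'm) star_algebra_scheme \<Rightarrow> ('a \<Rightarrow> real) \<Rightarrow> (nat \<Rightarrow> 'a) \<Rightarrow> (nat \<Rightarrow> 'a) set" where
  "seq_class A p X = null_rel A p `` {X}"

text \<open>The Hausdorff completion: elements of seminorm \<open>0\<close> are identified with \<open>0\<close>.\<close>

definition star_completion ::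
    "('a, 'm) star_algebra_scheme \<Rightarrow> ('a \<Rightarrow> real) \<Rightarrow> (nat \<Rightarrow> 'a) set normed_star_algebra" where
  "star_completion A p =
    \<lparr> carrier = cauchy_seqs A p // null_rel A p,
      mult = (\<lambda>P Q. \<Union>X\<in>P. \<Union>Y\<in>Q. seq_class A p (\<lambda>n. X n \<otimes>\<^bsub>A\<^esub> Y n)),
      one = undefined,
      zero = seq_class A p (\<lambda>n. \<zero>\<^bsub>A\<^esub>),
      add = (\<lambda>P Q. \<Union>X\<in>P. \<Union>Y\<in>Q. seq_class A p (\<lambda>n. X n \<oplus>\<^bsub>A\<^esub> Y n)),
      smult = (\<lambda>c P. \<Union>X\<in>P. seq_class A p (\<lambda>n. c \<odot>\<^bsub>A\<^esub> X n)),
      adj = (\<lambda>P. \<Union>X\<in>P. seq_class A p (\<lambda>n. adj A (X n))),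
      nrm = (\<lambda>P. lim (\<lambda>n. p ((SOME X. X \<in> P) n))) \<rparr>"

text \<open>
  The last clause is automatic for *-homomorphisms between C*-algebras.
\<close>

definition star_hom ::
    "('a, 'm) normed_star_algebra_scheme \<Rightarrow> ('b, 'n) normed_star_algebra_scheme \<Rightarrow> ('a \<Rightarrow> 'b) \<Rightarrow> bool" where
  "star_hom A B h \<longleftrightarrow>
    h \<in> carrier A \<rightarrow> carrier B \<and>
    (\<forall>x\<in>carrier A. \<forall>y\<in>carrier A. h (x \<oplus>\<^bsub>A\<^esub> y) = h x \<oplus>\<^bsub>B\<^esub> h y) \<and>
    (\<forall>c. \<forall>x\<in>carrier A. h (c \<odot>\<^bsub>A\<^esub> x) = c \<odot>\<^bsub>B\<^esub> h x) \<and>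
    (\<forall>x\<in>carrier A. \<forall>y\<in>carrier A. h (x \<otimes>\<^bsub>A\<^esub> y) = h x \<otimes>\<^bsub>B\<^esub> h y) \<and>
    (\<forall>x\<in>carrier A. h (adj A x) = adj B (h x)) \<and>
    (\<forall>x\<in>carrier A. nrm B (h x) \<le> nrm A x)"


section \<open>Graph C*-algebras\<close>

text \<open>
  Graphs are records of type \<open>pre_digraph\<close> satisfying \<open>wf_digraph\<close>; \<open>tail\<close> is the source map and
  \<open>head\<close> the target map. Sets of vertices and arcs may be infinite.
\<close>

definition reg :: "('v, 'e) pre_digraph \<Rightarrow> 'v set" where
  "reg E = {v \<in> verts E. finite (out_arcs E v) \<and> out_arcs E v \<noteq> {}}"

type_synonym ('v, 'e) free_elem = "(('v + 'e) \<times> bool) list \<Rightarrow> complex"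

definition graph_free :: "('v, 'e) pre_digraph \<Rightarrow> ('v, 'e) free_elem star_algebra" where
  "graph_free E = free_star_algebra (verts E <+> arcs E)"

definition graph_relations ::
    "('v, 'e) pre_digraph \<Rightarrow> (('v, 'e) free_elem \<times> ('v, 'e) free_elem) set" where
  "graph_relations E =
    (let A = graph_free E; P = (\<lambda>v. free_gen (Inl v)); T = (\<lambda>e. free_gen (Inr e)) in
      {(P v \<otimes>\<^bsub>A\<^esub> P v, P v) | v. v \<in> verts E} \<union>
      {(adj A (P v), P v) | v. v \<in> verts E} \<union>
      {(P u \<otimes>\<^bsub>A\<^esub> P v, \<zero>\<^bsub>A\<^esub>) | u v. u \<in> verts E \<and> v \<in> verts E \<and> u \<noteq> v} \<union>
      {(adj A (T e) \<otimes>\<^bsub>A\<^esub> T e', if e = e' then P (head E e) else \<zero>\<^bsub>A\<^esub>)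
        | e e'. e \<in> arcs E \<and> e' \<in> arcs E} \<union>
      {(P (tail E e) \<otimes>\<^bsub>A\<^esub> T e, T e) | e. e \<in> arcs E} \<union>
      {(P v, \<Oplus>\<^bsub>A\<^esub>e\<in>out_arcs E v. T e \<otimes>\<^bsub>A\<^esub> adj A (T e)) | v. v \<in> reg E})"

definition graph_seminorm :: "('v, 'e) pre_digraph \<Rightarrow> ('v, 'e) free_elem \<Rightarrow> real" where
  "graph_seminorm E = universal_seminorm (graph_free E) (graph_relations E)"

type_synonym ('v, 'e) cstar_elem = "(nat \<Rightarrow> ('v, 'e) free_elem) set"

definition graph_cstar :: "('v, 'e) pre_digraph \<Rightarrow> ('v, 'e) cstar_elem normed_star_algebra" where
  "graph_cstar E = star_completion (graph_free E) (graph_seminorm E)"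

definition S_vert :: "('v, 'e) pre_digraph \<Rightarrow> 'v \<Rightarrow> ('v, 'e) cstar_elem" where
  "S_vert E v = seq_class (graph_free E) (graph_seminorm E) (\<lambda>n. free_gen (Inl v))"

definition S_edge :: "('v, 'e) pre_digraph \<Rightarrow> 'e \<Rightarrow> ('v, 'e) cstar_elem" where
  "S_edge E e = seq_class (graph_free E) (graph_seminorm E) (\<lambda>n. free_gen (Inr e))"


section \<open>Graph inverse semigroups\<close>

text \<open>
  A finite path is a pair of its source vertex and its list of edges; the vertex \<open>v\<close>, as a path of
  length \<open>0\<close>, is \<open>(v, [])\<close>.
\<close>

type_synonym ('v, 'e) fpath = "'v \<times> 'e list"

definition finite_paths :: "('v, 'e) pre_digraph \<Rightarrow> ('v, 'e) fpath set" where
  "finite_paths E = {(u, p). \<exists>v. pre_digraph.awalk E u p v}"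

definition path_target :: "('v, 'e) pre_digraph \<Rightarrow> ('v, 'e) fpath \<Rightarrow> 'v" where
  "path_target E \<alpha> = pre_digraph.awlast E (fst \<alpha>) (snd \<alpha>)"

definition vertex_path :: "'v \<Rightarrow> ('v, 'e) fpath" where
  "vertex_path v = (v, [])"

definition edge_path :: "('v, 'e) pre_digraph \<Rightarrow> 'e \<Rightarrow> ('v, 'e) fpath" where
  "edge_path E e = (tail E e, [e])"

definition path_append :: "('v, 'e) fpath \<Rightarrow> 'e list \<Rightarrow> ('v, 'e) fpath" where
  "path_append \<alpha> p = (fst \<alpha>, snd \<alpha> @ p)"

definition path_prefix :: "('v, 'e) fpath \<Rightarrow> ('v, 'e) fpath \<Rightarrow> bool" where
  "path_prefix \<alpha> \<beta> \<longleftrightarrow> fst \<alpha> = fst \<beta> \<and> prefix (snd \<alpha>) (snd \<beta>)"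

datatype ('v, 'e) gis = GZero | GPair "('v, 'e) fpath" "('v, 'e) fpath"

definition graph_inverse_semigroup :: "('v, 'e) pre_digraph \<Rightarrow> ('v, 'e) gis set" where
  "graph_inverse_semigroup E = insert GZero {GPair \<alpha> \<beta> | \<alpha> \<beta>.
     \<alpha> \<in> finite_paths E \<and> \<beta> \<in> finite_paths E \<and> path_target E \<alpha> = path_target E \<beta>}"

fun gis_mult :: "('v, 'e) gis \<Rightarrow> ('v, 'e) gis \<Rightarrow> ('v, 'e) gis" (infixl \<open>\<cdot>\<close> 70) where
  "GPair \<alpha> \<beta> \<cdot> GPair \<gamma> \<delta> =
    (if path_prefix \<beta> \<gamma> then GPair (path_append \<alpha> (drop (length (snd \<beta>)) (snd \<gamma>))) \<delta>
     else if path_prefix \<gamma> \<beta> then GPair \<alpha> (path_append \<delta> (drop (length (snd \<gamma>)) (snd \<beta>)))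
     else GZero)"
| "GZero \<cdot> t = GZero"
| "s \<cdot> GZero = GZero"

fun gis_star :: "('v, 'e) gis \<Rightarrow> ('v, 'e) gis" where
  "gis_star (GPair \<alpha> \<beta>) = GPair \<beta> \<alpha>"
| "gis_star GZero = GZero"

definition gis_le :: "('v, 'e) gis \<Rightarrow> ('v, 'e) gis \<Rightarrow> bool" where
  "gis_le s t \<longleftrightarrow> s \<cdot> gis_star s \<cdot> t = s"

definition gis_vertex :: "'v \<Rightarrow> ('v, 'e) gis" where
  "gis_vertex v = GPair (vertex_path v) (vertex_path v)"

definition extended_path_hom ::
    "('v, 'e) pre_digraph \<Rightarrow> ('w, 'f) pre_digraph \<Rightarrow> (('v, 'e) gis \<Rightarrow> ('w, 'f) gis) \<Rightarrow> bool" where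
  "extended_path_hom E F \<phi> \<longleftrightarrow>
    \<phi> \<in> graph_inverse_semigroup E \<rightarrow> graph_inverse_semigroup F \<and>
    (\<forall>s\<in>graph_inverse_semigroup E. \<forall>t\<in>graph_inverse_semigroup E. \<phi> (s \<cdot> t) = \<phi> s \<cdot> \<phi> t) \<and>
    \<phi> GZero = GZero"

definition extends_generators ::
    "('v, 'e) pre_digraph \<Rightarrow> ('v \<Rightarrow> ('w, 'f) gis) \<Rightarrow> ('e \<Rightarrow> ('w, 'f) gis) \<Rightarrow>
     (('v, 'e) gis \<Rightarrow> ('w, 'f) gis) \<Rightarrow> bool" where
  "extends_generators E \<phi>0 \<phi>1 \<phi> \<longleftrightarrow>
    (\<forall>v\<in>verts E. \<phi> (gis_vertex v) = \<phi>0 v) \<and>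
    (\<forall>e\<in>arcs E. \<phi> (GPair (edge_path E e) (vertex_path (head E e))) = \<phi>1 e)"

definition determine ::
    "('v, 'e) pre_digraph \<Rightarrow> ('w, 'f) pre_digraph \<Rightarrow> ('v \<Rightarrow> ('w, 'f) gis) \<Rightarrow>
     ('e \<Rightarrow> ('w, 'f) gis) \<Rightarrow> (('v, 'e) gis \<Rightarrow> ('w, 'f) gis) \<Rightarrow> bool" where
  "determine E F \<phi>0 \<phi>1 \<phi> \<longleftrightarrow>
    extended_path_hom E F \<phi> \<and> extends_generators E \<phi>0 \<phi>1 \<phi> \<and>
    (\<forall>\<psi>. extended_path_hom E F \<psi> \<and> extends_generators E \<phi>0 \<phi>1 \<psi> \<longrightarrow>
      (\<forall>s\<in>graph_inverse_semigroup E. \<psi> s = \<phi> s))"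

definition regular_eph ::
    "('v, 'e) pre_digraph \<Rightarrow> ('w, 'f) pre_digraph \<Rightarrow> (('v, 'e) gis \<Rightarrow> ('w, 'f) gis) \<Rightarrow> bool" where
  "regular_eph E F \<phi> \<longleftrightarrow>
    (\<forall>u\<in>reg E. \<forall>t\<in>graph_inverse_semigroup F. t \<noteq> GZero \<and> gis_le t (\<phi> (gis_vertex u)) \<longrightarrow>
      (\<exists>e\<in>out_arcs E u. t \<cdot> \<phi> (GPair (edge_path E e) (edge_path E e)) \<noteq> GZero))"


section \<open>Induced homomorphisms\<close>

fun S_edges :: "('v, 'e) pre_digraph \<Rightarrow> 'v \<Rightarrow> 'e list \<Rightarrow> ('v, 'e) cstar_elem" where
  "S_edges E v [] = S_vert E v"
| "S_edges E v [e] = S_edge E e"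
| "S_edges E v (e # e' # p) = S_edge E e \<otimes>\<^bsub>graph_cstar E\<^esub> S_edges E v (e' # p)"

definition S_path :: "('v, 'e) pre_digraph \<Rightarrow> ('v, 'e) fpath \<Rightarrow> ('v, 'e) cstar_elem" where
  "S_path E \<alpha> = S_edges E (fst \<alpha>) (snd \<alpha>)"

fun S_gis :: "('v, 'e) pre_digraph \<Rightarrow> ('v, 'e) gis \<Rightarrow> ('v, 'e) cstar_elem" where
  "S_gis E GZero = \<zero>\<^bsub>graph_cstar E\<^esub>"
| "S_gis E (GPair \<alpha> \<beta>) = S_path E \<alpha> \<otimes>\<^bsub>graph_cstar E\<^esub> adj (graph_cstar E) (S_path E \<beta>)"

text \<open>
  The predicates below say that \<open>h\<close> is the map \<open>\<phi>\<^sub>*\<close> induced by \<open>\<phi>\<close>, and the map \<open>f\<^sup>*\<close> induced by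
  the graph homomorphism \<open>f\<close> with vertex map \<open>fst f\<close> and edge map \<open>snd f\<close>. Values outside the
  domain are fixed to \<open>undefined\<close>, so that uniqueness of \<open>h\<close> is meaningful.
\<close>

definition covariantly_induced ::
    "('v, 'e) pre_digraph \<Rightarrow> ('w, 'f) pre_digraph \<Rightarrow> (('v, 'e) gis \<Rightarrow> ('w, 'f) gis) \<Rightarrow>
     (('v, 'e) cstar_elem \<Rightarrow> ('w, 'f) cstar_elem) \<Rightarrow> bool" where
  "covariantly_induced E F \<phi> h \<longleftrightarrow>
    h \<in> extensional (carrier (graph_cstar E)) \<and>
    star_hom (graph_cstar E) (graph_cstar F) h \<and>
    (\<forall>v\<in>verts E. h (S_vert E v) = S_gis F (\<phi> (gis_vertex v))) \<and>
    (\<forall>e\<in>arcs E. h (S_edge E e) =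
      S_gis F (\<phi> (GPair (edge_path E e) (vertex_path (head E e)))))"

definition contravariantly_induced ::
    "('w, 'f) pre_digraph \<Rightarrow> ('v, 'e) pre_digraph \<Rightarrow> ('w \<Rightarrow> 'v) \<times> ('f \<Rightarrow> 'e) \<Rightarrow>
     (('v, 'e) cstar_elem \<Rightarrow> ('w, 'f) cstar_elem) \<Rightarrow> bool" where
  "contravariantly_induced F E f h \<longleftrightarrow>
    h \<in> extensional (carrier (graph_cstar E)) \<and>
    star_hom (graph_cstar E) (graph_cstar F) h \<and>
    (\<forall>v\<in>verts E. h (S_vert E v) =
      (\<Oplus>\<^bsub>graph_cstar F\<^esub>u\<in>{u \<in> verts F. fst f u = v}. S_vert F u)) \<and>
    (\<forall>e\<in>arcs E. h (S_edge E e) =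
      (\<Oplus>\<^bsub>graph_cstar F\<^esub>x\<in>{x \<in> arcs F. snd f x = e}. S_edge F x))"


section \<open>Maximal out-splits\<close>

definition split_mult :: "'v \<Rightarrow> nat \<Rightarrow> 'v \<Rightarrow> nat" where
  "split_mult w n v = (if v = w then n else 1)"

text \<open>
  The pair \<open>(v, i)\<close> is the vertex \<open>v\<^sup>i\<close> and \<open>(e, i)\<close> is the edge \<open>e\<^sup>i\<close>; the edges leaving \<open>w\<close> are
  \<open>\<epsilon> 1, \<dots>, \<epsilon> n\<close>.
\<close>

definition max_out_split ::
    "('v, 'e) pre_digraph \<Rightarrow> 'v \<Rightarrow> nat \<Rightarrow> (nat \<Rightarrow> 'e) \<Rightarrow> ('v \<times> nat, 'e \<times> nat) pre_digraph" where
  "max_out_split E w n \<epsilon> =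
    \<lparr> verts = {(v, i). v \<in> verts E \<and> 1 \<le> i \<and> i \<le> split_mult w n v},
      arcs = {(e, i). e \<in> arcs E \<and> 1 \<le> i \<and> i \<le> split_mult w n (head E e)},
      tail = (\<lambda>(e, i). if tail E e \<noteq> w then (tail E e, 1) else (w, the_inv_into {1..n} \<epsilon> e)),
      head = (\<lambda>(e, i). (head E e, i)) \<rparr>"

definition multi_out_split_hom :: "('v \<times> nat \<Rightarrow> 'v) \<times> ('e \<times> nat \<Rightarrow> 'e)" where
  "multi_out_split_hom = (\<lambda>(v, i). v, \<lambda>(e, i). e)"

definition split_phi0 ::
    "('v, 'e) pre_digraph \<Rightarrow> 'v \<Rightarrow> nat \<Rightarrow> (nat \<Rightarrow> 'e) \<Rightarrow> 'v \<times> nat \<Rightarrow> ('v, 'e) gis" where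
  "split_phi0 E w n \<epsilon> = (\<lambda>(v, i).
    if (v, i) \<notin> {w} \<times> {1..n} then GPair (vertex_path v) (vertex_path v)
    else GPair (edge_path E (\<epsilon> i)) (edge_path E (\<epsilon> i)))"

definition split_phi1 ::
    "('v, 'e) pre_digraph \<Rightarrow> 'v \<Rightarrow> nat \<Rightarrow> (nat \<Rightarrow> 'e) \<Rightarrow> 'e \<times> nat \<Rightarrow> ('v, 'e) gis" where
  "split_phi1 E w n \<epsilon> = (\<lambda>(e, i).
    if head (max_out_split E w n \<epsilon>) (e, i) \<notin> {w} \<times> {1..n}
    then GPair (edge_path E e) (vertex_path (head E e))
    else GPair (path_append (edge_path E e) [\<epsilon> i]) (edge_path E (\<epsilon> i)))"

end

theory Submission
  imports Defs "HOL-Library.Poly_Mapping"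
begin

text \<open>
  A path in \<open>EO\<close> ending at \<open>w\<^sup>i\<close> can only be continued through a copy of \<open>\<epsilon>\<^sub>i\<close>, so \<open>\<phi>\<close> forgets
  superscripts and appends \<open>\<epsilon>\<^sub>i\<close>; two paths of \<open>EO\<close> are comparable as soon as their images are,
  which is what makes \<open>\<phi>\<close> multiplicative. On algebras, \<open>f\<^sup>*\<close> and \<open>\<phi>\<^sub>*\<close> come from substitutions
  between the free *-algebras on the generators. Each sends generators to a Cuntz-Krieger family of
  the other graph, hence does not increase the universal seminorm and extends to the completions,
  and the two composites fix the generators up to elements of seminorm \<open>0\<close>. A contractive
  *-homomorphism is determined by its values on the generators.
\<close>

section \<open>Products in graph inverse semigroups\<close>

text \<open>In the free algebras the Cuntz-Krieger identities hold only up to elements of seminorm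
  \<open>0\<close>. All computations therefore use an abstract congruence \<open>\<simeq>\<close>,
  and the same lemmas serve the algebras of both graphs. On families, \<open>f\<^sup>*\<close> is
  merging, the sum over superscripts, and \<open>\<phi>\<^sub>*\<close> is splitting, which replaces
  the projection at \<open>w\<close> by the range projections of the edges leaving \<open>w\<close>.
  Regularity of \<open>w\<close> makes the two inverse to each other: the relation at
  \<open>w\<close> writes its projection as the sum of these ranges, and the relation of
  \<open>EO\<close> at \<open>w\<^sup>i\<close>, where only copies of
  \<open>\<epsilon>\<^sub>i\<close> start, recovers the projection there from the merged edge. One
  identity used throughout, \<open>T e * P (head E e) \<simeq> T e\<close>, is not a defining
  relation; it is derived from the C*-identity.\<close>

lemma path_append_simps [simp]:
  "path_append (u, p) q = (u, p @ q)"
  "path_append \<alpha> [] = \<alpha>"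
  "path_append (path_append \<alpha> p) q = path_append \<alpha> (p @ q)"
  "path_append \<alpha> p = path_append \<alpha> q \<longleftrightarrow> p = q"
  "path_append \<alpha> p = \<alpha> \<longleftrightarrow> p = []"
  "\<alpha> = path_append \<alpha> p \<longleftrightarrow> p = []"
  "fst (path_append \<alpha> p) = fst \<alpha>"
  "snd (path_append \<alpha> p) = snd \<alpha> @ p"
  by (auto simp: path_append_def prod_eq_iff)

lemma path_prefix_iff: "path_prefix \<alpha> \<beta> \<longleftrightarrow> (\<exists>r. \<beta> = path_append \<alpha> r)"
  by (auto simp: path_prefix_def path_append_def prefix_def prod_eq_iff)

definition comparable :: "('v, 'e) fpath \<Rightarrow> ('v, 'e) fpath \<Rightarrow> bool" where
  "comparable \<alpha> \<beta> \<longleftrightarrow> path_prefix \<alpha> \<beta> \<or> path_prefix \<beta> \<alpha>"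

lemma gis_mult_append_left:
  "GPair \<alpha> \<beta> \<cdot> GPair (path_append \<beta> r) \<delta> = GPair (path_append \<alpha> r) \<delta>"
  by (auto simp: path_prefix_iff)

lemma gis_mult_append_right:
  "GPair \<alpha> (path_append \<gamma> r) \<cdot> GPair \<gamma> \<delta> = GPair \<alpha> (path_append \<delta> r)"
  by (auto simp: path_prefix_iff)

lemma gis_mult_same: "GPair \<alpha> \<beta> \<cdot> GPair \<beta> \<delta> = GPair \<alpha> \<delta>"
  using gis_mult_append_left[of \<alpha> \<beta> "[]" \<delta>] by simp

lemma gis_mult_eq_GZero_iff: "GPair \<alpha> \<beta> \<cdot> GPair \<gamma> \<delta> = GZero \<longleftrightarrow> \<not> comparable \<beta> \<gamma>"
  by (simp add: comparable_def)

text \<open>Replaces the \<open>drop\<close> terms of the product by an explicit remainder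
  \<open>r\<close>; with this rule the defining equation can leave the simpset.\<close>

lemma gis_mult_cases:
  obtains (left) r where "\<gamma> = path_append \<beta> r" "GPair \<alpha> \<beta> \<cdot> GPair \<gamma> \<delta> = GPair (path_append \<alpha> r) \<delta>"
  | (right) r where "\<beta> = path_append \<gamma> r" "GPair \<alpha> \<beta> \<cdot> GPair \<gamma> \<delta> = GPair \<alpha> (path_append \<delta> r)"
  | (zero) "\<not> comparable \<beta> \<gamma>" "GPair \<alpha> \<beta> \<cdot> GPair \<gamma> \<delta> = GZero"
proof (cases "comparable \<beta> \<gamma>")
  case True
  then show ?thesis
    using that(1,2) by (metis comparable_def path_prefix_iff gis_mult_append_left gis_mult_append_right)
qed (use that(3) gis_mult_eq_GZero_iff in blast)

declare gis_mult.simps(1) [simp del]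

lemma gis_mult_GZero_right [simp]: "s \<cdot> GZero = GZero"
  by (cases s) auto

text \<open>A nonempty remainder arising in \<open>a \<cdot> b\<close> would remain visible in
  \<open>a \<cdot> b \<cdot> a\<close> or in \<open>b \<cdot> a \<cdot> b\<close>, so comparing
  paths leaves only the swapped pair.\<close>

lemma gis_inverse_unique:
  assumes aba: "a \<cdot> b \<cdot> a = a" and bab: "b \<cdot> a \<cdot> b = b"
  shows "b = gis_star a"
proof (cases a)
  case GZero
  with bab show ?thesis by simp
next
  case a: (GPair \<alpha> \<beta>)
  have "b \<noteq> GZero" using aba a by auto
  then obtain \<gamma> \<delta> where b: "b = GPair \<gamma> \<delta>" by (cases b) auto
  show ?thesis
  proof (cases rule: gis_mult_cases[of \<gamma> \<beta> \<alpha> \<delta>])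
    case l: (left r)
    have ab: "a \<cdot> b = GPair (path_append \<alpha> r) \<delta>" using l a b by simp
    show ?thesis
    proof (cases rule: gis_mult_cases[of \<alpha> \<delta> "path_append \<alpha> r" \<beta>])
      case (left s)
      then show ?thesis using aba ab a b l by simp
    next
      case (right s)
      then show ?thesis using aba ab a b l by simp
    qed (use aba ab a in simp)
  next
    case r: (right r)
    have ab: "a \<cdot> b = GPair \<alpha> (path_append \<delta> r)" using r a b by simp
    have \<alpha>: "\<alpha> = path_append \<delta> r"
    proof (cases rule: gis_mult_cases[of \<alpha> "path_append \<delta> r" \<alpha> \<beta>])
      case (left s)
      then show ?thesis using aba ab a by simp
    next
      case (right s)
      then show ?thesis using aba ab a by simp
    qed (use aba ab a in simp)
    \<comment> \<open>In this case the first equation only says that \<open>gis_star a\<close> lies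
      below \<open>b\<close>; the second one excludes a nonempty \<open>r\<close>.\<close>
    have "b \<cdot> a = GPair (path_append \<gamma> r) \<beta>"
      using gis_mult_append_left \<alpha> a b by metis
    then have "b \<cdot> a \<cdot> b = GPair (path_append \<gamma> r) (path_append \<delta> r)"
      using gis_mult_append_right r(1) b by metis
    then show ?thesis using bab b a \<alpha> r(1) by simp
  qed (use aba a b in simp)
qed

lemma path_target_append:
  "path_target E (path_append \<alpha> p) = path_target E (path_target E \<alpha>, p)"
proof -
  have "pre_digraph.awlast E u (xs @ p) = pre_digraph.awlast E (pre_digraph.awlast E u xs) p" for u xs
    by (simp add: pre_digraph.awalk_verts_conv)
  then show ?thesis by (simp add: path_target_def path_append_def)
qed

lemma path_target_Nil [simp]: "path_target E (u, []) = u"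
  and path_target_Cons [simp]: "path_target E (u, e # p) = path_target E (head E e, p)"
  by (auto simp: path_target_def pre_digraph.awalk_verts.simps pre_digraph.awalk_verts_conv)

section \<open>Finite paths and closure of the semigroup under products\<close>

context wf_digraph
begin

lemma finite_paths_Nil [simp]: "(u, []) \<in> finite_paths G \<longleftrightarrow> u \<in> verts G"
  using awalk_Nil_iff by (fastforce simp: finite_paths_def)

lemma finite_paths_Cons [simp]:
  "(u, e # p) \<in> finite_paths G \<longleftrightarrow> e \<in> arcs G \<and> u = tail G e \<and> (head G e, p) \<in> finite_paths G"
  by (auto simp: finite_paths_def awalk_def cas.simps)

lemma path_source_in_verts: "(u, p) \<in> finite_paths G \<Longrightarrow> u \<in> verts G"
  by (cases p) auto

lemma path_target_in_verts: "\<alpha> \<in> finite_paths G \<Longrightarrow> path_target G \<alpha> \<in> verts G"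
proof (cases \<alpha>)
  case (Pair u p)
  show "\<alpha> \<in> finite_paths G \<Longrightarrow> path_target G \<alpha> \<in> verts G"
    unfolding Pair by (induction p arbitrary: u) auto
qed

lemma path_append_in_finite_paths:
  "path_append \<alpha> p \<in> finite_paths G \<longleftrightarrow> \<alpha> \<in> finite_paths G \<and> (path_target G \<alpha>, p) \<in> finite_paths G"
proof (cases \<alpha>)
  case (Pair u q)
  show ?thesis
    unfolding Pair path_append_def
    by (induction q arbitrary: u) (cases p, auto)
qed

lemma GPair_in_gis_iff:
  "GPair \<alpha> \<beta> \<in> graph_inverse_semigroup G \<longleftrightarrow>
    \<alpha> \<in> finite_paths G \<and> \<beta> \<in> finite_paths G \<and> path_target G \<alpha> = path_target G \<beta>"
  and GZero_in_gis [simp]: "GZero \<in> graph_inverse_semigroup G"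
  unfolding graph_inverse_semigroup_def by blast+

lemma gis_mult_closed:
  assumes "s \<in> graph_inverse_semigroup G" "t \<in> graph_inverse_semigroup G"
  shows "s \<cdot> t \<in> graph_inverse_semigroup G"
proof (cases "s = GZero \<or> t = GZero")
  case True
  then show ?thesis by (auto simp: graph_inverse_semigroup_def)
next
  case False
  then obtain \<alpha> \<beta> \<gamma> \<delta> where st: "s = GPair \<alpha> \<beta>" "t = GPair \<gamma> \<delta>"
    by (metis gis.exhaust)
  show ?thesis
    by (cases rule: gis_mult_cases[of \<gamma> \<beta> \<alpha> \<delta>])
      (use assms in \<open>auto simp: st GPair_in_gis_iff path_append_in_finite_paths path_target_append\<close>)
qed

end

text \<open>The images of the adjoint generators are forced because inverses in \<open>S(F)\<close> are unique.\<close>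

lemma extended_path_hom_eqI:
  assumes "wf_digraph E"
    and \<phi>: "extended_path_hom E F \<phi>" and \<psi>: "extended_path_hom E F \<psi>"
    and vertex: "\<And>v. v \<in> verts E \<Longrightarrow> \<psi> (gis_vertex v) = \<phi> (gis_vertex v)"
    and edge: "\<And>e. e \<in> arcs E \<Longrightarrow> \<psi> (GPair (edge_path E e) (vertex_path (head E e))) =
      \<phi> (GPair (edge_path E e) (vertex_path (head E e)))"
    and s: "s \<in> graph_inverse_semigroup E"
  shows "\<psi> s = \<phi> s"
proof -
  interpret wf_digraph E by fact
  let ?S = "graph_inverse_semigroup E"
  have hom: "\<psi> (s \<cdot> t) = \<psi> s \<cdot> \<psi> t" "\<phi> (s \<cdot> t) = \<phi> s \<cdot> \<phi> t" if "s \<in> ?S" "t \<in> ?S" for s t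
    using that \<phi> \<psi> unfolding extended_path_hom_def by blast+
  have in_S: "GPair (u, p) (path_target E (u, p), []) \<in> ?S" "GPair (path_target E (u, p), []) (u, p) \<in> ?S"
    if "(u, p) \<in> finite_paths E" for u p
    using that path_target_in_verts[OF that] by (auto simp: GPair_in_gis_iff)
  have edge_S: "GPair (tail E e, [e]) (head E e, []) \<in> ?S" "GPair (head E e, []) (tail E e, [e]) \<in> ?S"
    if "e \<in> arcs E" for e
    using that by (auto simp: GPair_in_gis_iff)
  have edge': "\<psi> (GPair (tail E e, [e]) (head E e, [])) = \<phi> (GPair (tail E e, [e]) (head E e, []))"
    if "e \<in> arcs E" for e
    using edge[OF that] by (simp add: edge_path_def vertex_path_def)
  have star: "\<psi> (GPair (head E e, []) (tail E e, [e])) = \<phi> (GPair (head E e, []) (tail E e, [e]))"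
    if e: "e \<in> arcs E" for e
  proof -
    let ?a = "GPair (tail E e, [e]) (head E e, [])" and ?b = "GPair (head E e, []) (tail E e, [e])"
    have "\<chi> ?b = gis_star (\<chi> ?a)" if "extended_path_hom E F \<chi>" for \<chi>
    proof (rule gis_inverse_unique)
      have "\<chi> (s \<cdot> t) = \<chi> s \<cdot> \<chi> t" if "s \<in> ?S" "t \<in> ?S" for s t
        using that \<open>extended_path_hom E F \<chi>\<close> unfolding extended_path_hom_def by blast
      then have "\<chi> (?a \<cdot> ?b \<cdot> ?a) = \<chi> ?a \<cdot> \<chi> ?b \<cdot> \<chi> ?a" "\<chi> (?b \<cdot> ?a \<cdot> ?b) = \<chi> ?b \<cdot> \<chi> ?a \<cdot> \<chi> ?b"
        using edge_S[OF e] gis_mult_closed by presburger+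
      then show "\<chi> ?a \<cdot> \<chi> ?b \<cdot> \<chi> ?a = \<chi> ?a" "\<chi> ?b \<cdot> \<chi> ?a \<cdot> \<chi> ?b = \<chi> ?b"
        by (simp_all only: gis_mult_same)
    qed
    then show ?thesis using \<phi> \<psi> edge'[OF e] by metis
  qed
  \<comment> \<open>An element factors through the common target as \<open>(\<alpha>, t)\<close>
    times \<open>(t, \<beta>)\<close>; each factor is built from the generators and their adjoints,
    one edge at a time.\<close>
  have path: "\<psi> (GPair (u, p) (path_target E (u, p), [])) = \<phi> (GPair (u, p) (path_target E (u, p), [])) \<and>
      \<psi> (GPair (path_target E (u, p), []) (u, p)) = \<phi> (GPair (path_target E (u, p), []) (u, p))"
    if "(u, p) \<in> finite_paths E" for u p
    using that
  proof (induction p arbitrary: u)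
    case Nil
    then show ?case using vertex[of u] by (simp add: gis_vertex_def vertex_path_def)
  next
    case (Cons e p)
    then have e: "e \<in> arcs E" "u = tail E e" and p: "(head E e, p) \<in> finite_paths E" by auto
    let ?t = "(path_target E (head E e, p), [])"
    have "GPair (u, e # p) ?t = GPair (u, [e]) (head E e, []) \<cdot> GPair (head E e, p) ?t"
      "GPair ?t (u, e # p) = GPair ?t (head E e, p) \<cdot> GPair (head E e, []) (u, [e])"
      using gis_mult_append_left[of "(u, [e])" "(head E e, [])" p ?t]
        gis_mult_append_right[of ?t "(head E e, [])" p "(u, [e])"]
      by (simp_all add: path_append_def)
    then show ?case
      using Cons.IH[OF p] edge'[OF e(1)] star[OF e(1)] hom[OF edge_S(1)[OF e(1)] in_S(1)[OF p]]
        hom[OF in_S(2)[OF p] edge_S(2)[OF e(1)]] e(2) by simp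
  qed
  show ?thesis
  proof (cases s)
    case GZero
    then show ?thesis using \<phi> \<psi> by (simp add: extended_path_hom_def)
  next
    case (GPair \<alpha> \<beta>)
    obtain u p v q where \<alpha>: "\<alpha> = (u, p)" and \<beta>: "\<beta> = (v, q)" by fastforce
    have t: "path_target E (u, p) = path_target E (v, q)"
      and ab: "(u, p) \<in> finite_paths E" "(v, q) \<in> finite_paths E"
      using s by (auto simp: GPair \<alpha> \<beta> GPair_in_gis_iff)
    have "s = GPair (u, p) (path_target E (u, p), []) \<cdot> GPair (path_target E (v, q), []) (v, q)"
      by (simp only: t gis_mult_same GPair \<alpha> \<beta>)
    then show ?thesis using path[OF ab(1)] path[OF ab(2)] hom[OF in_S(1)[OF ab(1)] in_S(2)[OF ab(2)]] by simp
  qed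
qed

section \<open>The extended path homomorphism of a maximal out-split\<close>

locale out_split = wf_digraph E for E :: "('v, 'e) pre_digraph" +
  fixes w :: 'v and n :: nat and \<epsilon> :: "nat \<Rightarrow> 'e"
  assumes w_reg: "w \<in> reg E"
    and \<epsilon>_bij: "bij_betw \<epsilon> {1..n} (out_arcs E w)"
begin

definition EO :: "('v \<times> nat, 'e \<times> nat) pre_digraph" where
  "EO = max_out_split E w n \<epsilon>"

lemma \<epsilon>_arc:
  assumes "1 \<le> i" "i \<le> n"
  shows "\<epsilon> i \<in> arcs E" "tail E (\<epsilon> i) = w"
  using bij_betw_apply[OF \<epsilon>_bij, of i] assms by (simp_all add: out_arcs_def)

lemma \<epsilon>_eq_iff: "1 \<le> i \<Longrightarrow> i \<le> n \<Longrightarrow> 1 \<le> j \<Longrightarrow> j \<le> n \<Longrightarrow> \<epsilon> i = \<epsilon> j \<longleftrightarrow> i = j"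
  using inj_on_eq_iff[OF bij_betw_imp_inj_on[OF \<epsilon>_bij]] by simp

lemma \<epsilon>_surj:
  assumes "e \<in> arcs E" "tail E e = w"
  obtains i where "1 \<le> i" "i \<le> n" "e = \<epsilon> i"
proof -
  have "e \<in> \<epsilon> ` {1..n}"
    using assms \<epsilon>_bij by (simp add: bij_betw_def out_arcs_def)
  then show ?thesis using that by auto
qed

lemma w_vert: "w \<in> verts E"
  using w_reg by (simp add: reg_def)

lemma n_pos: "1 \<le> n"
proof -
  have "out_arcs E w \<noteq> {}" using w_reg by (simp add: reg_def)
  then have "{1..n} \<noteq> {}" using \<epsilon>_bij by (auto simp: bij_betw_def)
  then show ?thesis by simp
qed

lemma split_mult_pos: "1 \<le> split_mult w n v"
  using n_pos by (simp add: split_mult_def)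

lemma verts_EO: "(v, i) \<in> verts EO \<longleftrightarrow> v \<in> verts E \<and> 1 \<le> i \<and> i \<le> split_mult w n v"
  and arcs_EO: "(e, i) \<in> arcs EO \<longleftrightarrow> e \<in> arcs E \<and> 1 \<le> i \<and> i \<le> split_mult w n (head E e)"
  and head_EO: "head EO (e, i) = (head E e, i)"
  by (simp_all add: EO_def max_out_split_def)

lemma fst_tail_EO: "fst (tail EO x) = tail E (fst x)"
  by (cases x) (simp add: EO_def max_out_split_def)

lemma fst_head_EO: "fst (head EO x) = head E (fst x)"
  by (cases x) (simp add: head_EO)

lemma the_inv_\<epsilon>: "1 \<le> i \<Longrightarrow> i \<le> n \<Longrightarrow> the_inv_into {1..n} \<epsilon> (\<epsilon> i) = i"
  using \<epsilon>_bij by (auto simp: bij_betw_def intro!: the_inv_into_f_f)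

lemma verts_EO_cases:
  assumes "x \<in> verts EO"
  obtains "fst x \<in> verts E" "fst x \<noteq> w" "snd x = 1" | "fst x = w" "1 \<le> snd x" "snd x \<le> n"
  using assms by (cases x) (auto simp: verts_EO split_mult_def split: if_splits)

lemma verts_EO_w:
  assumes "x \<in> verts EO" "fst x = w"
  shows "1 \<le> snd x" "snd x \<le> n"
  using assms by (cases x; simp add: verts_EO split_mult_def)+

text \<open>The source of \<open>e\<^sup>i\<close> depends on \<open>e\<close> alone, and
  \<open>w\<^sup>i\<close> emits only copies of \<open>\<epsilon> i\<close>. Asking only that
  \<open>fst a\<close> be an arc of \<open>E\<close> lets a superscript be chosen after the source
  is known.\<close>

lemma tail_EO_iff:
  assumes "fst a \<in> arcs E" "x \<in> verts EO"
  shows "tail EO a = x \<longleftrightarrow> tail E (fst a) = fst x \<and> (fst x = w \<longrightarrow> fst a = \<epsilon> (snd x))"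
proof (cases "tail E (fst a) = w")
  case True
  then obtain k where "1 \<le> k" "k \<le> n" "fst a = \<epsilon> k" using assms \<epsilon>_surj by blast
  then show ?thesis
    using assms True the_inv_\<epsilon>
    by (cases a; cases x) (auto simp: verts_EO EO_def max_out_split_def split_mult_def \<epsilon>_eq_iff)
next
  case False
  then show ?thesis
    using assms by (cases a; cases x) (auto simp: EO_def max_out_split_def split_mult_def)
qed

lemma arcs_EO_fst: "a \<in> arcs EO \<Longrightarrow> fst a \<in> arcs E"
  by (cases a) (simp add: arcs_EO)

lemma tail_EO_cong:
  assumes "a \<in> arcs EO" "b \<in> arcs EO" "fst a = fst b"
  shows "tail EO a = tail EO b"
  using assms by (cases a; cases b) (auto simp: EO_def max_out_split_def)

lemma tail_EO_in_verts: "x \<in> arcs EO \<Longrightarrow> tail EO x \<in> verts EO"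
proof -
  assume x: "x \<in> arcs EO"
  obtain e i where ei: "x = (e, i)" by fastforce
  with x have e: "e \<in> arcs E" by (simp add: arcs_EO)
  show ?thesis
  proof (cases "tail E e = w")
    case True
    then obtain k where "1 \<le> k" "k \<le> n" "e = \<epsilon> k" using e \<epsilon>_surj by blast
    then show ?thesis
      using True the_inv_\<epsilon> w_vert by (simp add: ei EO_def max_out_split_def split_mult_def)
  qed (use e in \<open>simp add: ei EO_def max_out_split_def split_mult_def\<close>)
qed

lemma wf_EO: "wf_digraph EO"
proof
  fix x assume x: "x \<in> arcs EO"
  then show "tail EO x \<in> verts EO" by (rule tail_EO_in_verts)
  show "head EO x \<in> verts EO"
    using x by (cases x) (auto simp: arcs_EO head_EO verts_EO)
qed

interpretation EO: wf_digraph EO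
  by (rule wf_EO)

section \<open>The map on paths and its multiplicativity\<close>

definition forced :: "'v \<times> nat \<Rightarrow> 'e list" where
  "forced x = (if fst x = w then [\<epsilon> (snd x)] else [])"

definition push_path :: "('v \<times> nat, 'e \<times> nat) fpath \<Rightarrow> ('v, 'e) fpath" where
  "push_path \<alpha> = (fst (fst \<alpha>), map fst (snd \<alpha>) @ forced (path_target EO \<alpha>))"

text \<open>The components of an element of the semigroup share their target, so both receive the
  same appended edge.\<close>

fun push :: "('v \<times> nat, 'e \<times> nat) gis \<Rightarrow> ('v, 'e) gis" where
  "push GZero = GZero"
| "push (GPair \<alpha> \<beta>) = GPair (push_path \<alpha>) (push_path \<beta>)"

lemma map_fst_path:
  assumes "(x, p) \<in> finite_paths EO"
  shows "(fst x, map fst p) \<in> finite_paths E" "path_target E (fst x, map fst p) = fst (path_target EO (x, p))"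
proof -
  have "(fst x, map fst p) \<in> finite_paths E \<and> path_target E (fst x, map fst p) = fst (path_target EO (x, p))"
    using assms
  proof (induction p arbitrary: x)
    case Nil
    then show ?case by (cases x) (simp add: verts_EO)
  next
    case (Cons a p)
    then have a: "a \<in> arcs EO" "x = tail EO a" and p: "(head EO a, p) \<in> finite_paths EO" by auto
    show ?case
      using Cons.IH[OF p] arcs_EO_fst[OF a(1)] by (simp add: a(2) fst_tail_EO fst_head_EO)
  qed
  then show "(fst x, map fst p) \<in> finite_paths E" "path_target E (fst x, map fst p) = fst (path_target EO (x, p))"
    by auto
qed

lemma forced_path:
  assumes "x \<in> verts EO"
  shows "(fst x, forced x) \<in> finite_paths E"
  using assms by (cases x) (auto simp: forced_def verts_EO split_mult_def \<epsilon>_arc)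

text \<open>The second claim expresses the target through \<open>path_target EO \<alpha>\<close>
  alone, so the components of \<open>push s\<close> have a common target whenever those of
  \<open>s\<close> do.\<close>

lemma push_path_closed:
  assumes "\<alpha> \<in> finite_paths EO"
  shows "push_path \<alpha> \<in> finite_paths E"
    and "path_target E (push_path \<alpha>) = path_target E (fst (path_target EO \<alpha>), forced (path_target EO \<alpha>))"
proof -
  obtain x p where \<alpha>: "\<alpha> = (x, p)" by fastforce
  have eq: "push_path \<alpha> = path_append (fst x, map fst p) (forced (path_target EO \<alpha>))"
    by (simp add: push_path_def path_append_def \<alpha>)
  note map = map_fst_path[OF assms[unfolded \<alpha>]]
  show "push_path \<alpha> \<in> finite_paths E"
    unfolding eq path_append_in_finite_paths
    using forced_path[OF EO.path_target_in_verts[OF assms]] map by (simp add: \<alpha>)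
  show "path_target E (push_path \<alpha>) = path_target E (fst (path_target EO \<alpha>), forced (path_target EO \<alpha>))"
    unfolding eq path_target_append by (simp add: map \<alpha>)
qed

text \<open>
  Every path starting at \<open>w\<^sup>i\<close> begins with some \<open>\<epsilon>\<^sub>i\<^sup>j\<close>, so the edge appended by \<open>forced\<close>
  is absorbed when a path is continued.
\<close>

lemma forced_absorbed:
  assumes "(x, q) \<in> finite_paths EO"
  obtains r where "forced x @ r = map fst q @ forced (path_target EO (x, q))"
proof (cases q)
  case Nil
  then show ?thesis using that[of "[]"] by simp
next
  case (Cons a q')
  have "a \<in> arcs EO" "tail EO a = x"
    using assms by (auto simp: Cons)
  then have "fst x = w \<longrightarrow> fst a = \<epsilon> (snd x)"
    using tail_EO_iff[OF arcs_EO_fst tail_EO_in_verts] by metis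
  then show ?thesis
    using that[of "map fst (if fst x = w then q' else q) @ forced (path_target EO (x, q))"]
    by (simp add: Cons forced_def split: if_splits)
qed

text \<open>The point is that \<open>r\<close> depends on \<open>x\<close> and \<open>q\<close> but
  not on \<open>\<alpha>\<close>: in a product the same remainder extends two different paths with
  the same target.\<close>

lemma push_path_append:
  assumes "(x, q) \<in> finite_paths EO"
  obtains r where "\<And>\<alpha>. path_target EO \<alpha> = x \<Longrightarrow> push_path (path_append \<alpha> q) = path_append (push_path \<alpha>) r"
proof -
  obtain r where "forced x @ r = map fst q @ forced (path_target EO (x, q))"
    using forced_absorbed[OF assms] .
  then show ?thesis
    using that[of r] by (simp add: push_path_def path_target_append)
qed

text \<open>The superscript of an edge ending at \<open>w\<close> is the index of the edge that
  follows it, be it the next edge of the path or the appended one, so comparability of images is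
  enough to recover it. The conclusion has to be symmetric: the vertex \<open>w\<^sup>i\<close> and
  an arc \<open>\<epsilon>\<^sub>i\<^sup>1\<close> that does not end at \<open>w\<close> have the
  same image.\<close>

lemma comparable_if_prefix:
  assumes "(x, p) \<in> finite_paths EO" "(y, q) \<in> finite_paths EO" "fst x = fst y"
    and "prefix (map fst p @ forced (path_target EO (x, p))) (map fst q @ forced (path_target EO (y, q)))"
  shows "comparable (x, p) (y, q)"
  using assms
proof (induction p arbitrary: x y q)
  case Nil
  have verts: "x \<in> verts EO" "y \<in> verts EO"
    using Nil.prems EO.path_source_in_verts by blast+
  \<comment> \<open>Off \<open>w\<close> both superscripts are \<open>1\<close>. At \<open>w\<close>
    the edge appended to the empty path must be the first edge of the other image, and that edge
    determines the superscript of \<open>y\<close>, whether it comes from \<open>q\<close> or is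
    itself appended.\<close>
  have "x = y"
  proof (cases "fst x = w")
    case False
    then show ?thesis
      using verts Nil.prems(3) verts_EO_cases by (metis prod_eqI)
  next
    case True
    then have pre: "prefix [\<epsilon> (snd x)] (map fst q @ forced (path_target EO (y, q)))"
      using Nil.prems by (simp add: forced_def)
    then show ?thesis
    proof (cases q)
      case q: Nil
      then have "\<epsilon> (snd x) = \<epsilon> (snd y)"
        using pre True Nil.prems(3) by (simp add: forced_def)
      moreover have "1 \<le> snd x" "snd x \<le> n" "1 \<le> snd y" "snd y \<le> n"
        using verts True Nil.prems(3) by (metis verts_EO_cases)+
      ultimately show ?thesis
        using Nil.prems(3) \<epsilon>_eq_iff by (simp add: prod_eq_iff)
    next
      case (Cons a q')
      then have "tail EO a = y" "a \<in> arcs EO" "fst a = \<epsilon> (snd x)"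
        using Nil.prems pre by auto
      moreover from this have "tail E (fst a) = fst x"
        using fst_tail_EO[of a] Nil.prems(3) by simp
      moreover from calculation have "tail EO a = x"
        using tail_EO_iff[OF arcs_EO_fst verts(1)] by blast
      ultimately show ?thesis by simp
    qed
  qed
  then show ?case by (simp add: comparable_def path_prefix_def)
next
  case (Cons a p)
  then have a: "a \<in> arcs EO" "tail EO a = x" by auto
  show ?case
  proof (cases q)
    \<comment> \<open>The second path is the vertex \<open>y\<close>, and the edge appended to it is
      the first edge of the other path; here the prefix goes the opposite way.\<close>
    case Nil
    then have y: "fst y = w" "fst a = \<epsilon> (snd y)" "y \<in> verts EO"
      using Cons.prems by (auto simp: forced_def split: if_splits)
    have "tail E (fst a) = fst y"
      using fst_tail_EO[of a] a(2) Cons.prems(3) by simp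
    then have "tail EO a = y"
      using tail_EO_iff[OF arcs_EO_fst[OF a(1)] y(3)] y(2) by blast
    then have "x = y" using a(2) by simp
    then show ?thesis by (simp add: comparable_def path_prefix_def Nil)
  next
    case q: (Cons b q')
    have b: "b \<in> arcs EO" "tail EO b = y" and ab: "fst a = fst b"
      using Cons.prems by (auto simp: q)
    have xy: "x = y"
      using a b tail_EO_cong ab by blast
    have head: "head EO a = (head E (fst a), snd a)" "head EO b = (head E (fst b), snd b)"
      using head_EO by (metis prod.collapse)+
    \<comment> \<open>Only the underlying targets of \<open>a\<close> and \<open>b\<close> are known
      to agree; comparability of the remaining paths gives equal targets in \<open>EO\<close>, hence
      equal superscripts and \<open>a = b\<close>.\<close>
    have "comparable (head EO a, p) (head EO b, q')"
    proof (rule Cons.IH)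
      show "fst (head EO a) = fst (head EO b)" by (simp add: head ab)
    qed (use Cons.prems q in simp_all)
    then have "head EO a = head EO b" "prefix p q' \<or> prefix q' p"
      by (auto simp: comparable_def path_prefix_def)
    moreover from this have "a = b" using head ab by (simp add: prod_eq_iff)
    ultimately show ?thesis using xy by (simp add: q comparable_def path_prefix_def)
  qed
qed

lemma comparable_push_path:
  assumes "\<alpha> \<in> finite_paths EO" "\<beta> \<in> finite_paths EO" "comparable (push_path \<alpha>) (push_path \<beta>)"
  shows "comparable \<alpha> \<beta>"
proof -
  have *: "comparable \<alpha> \<beta>"
    if "\<alpha> \<in> finite_paths EO" "\<beta> \<in> finite_paths EO" "path_prefix (push_path \<alpha>) (push_path \<beta>)" for \<alpha> \<beta>
    using comparable_if_prefix[of "fst \<alpha>" "snd \<alpha>" "fst \<beta>" "snd \<beta>"] that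
    by (simp add: path_prefix_def push_path_def)
  show ?thesis
    using *[of \<alpha> \<beta>] *[of \<beta> \<alpha>] assms by (auto simp: comparable_def)
qed

lemma push_mult:
  assumes "s \<in> graph_inverse_semigroup EO" "t \<in> graph_inverse_semigroup EO"
  shows "push (s \<cdot> t) = push s \<cdot> push t"
proof (cases "s = GZero \<or> t = GZero")
  case True
  then show ?thesis by auto
next
  case False
  then obtain \<alpha> \<beta> \<gamma> \<delta> where st: "s = GPair \<alpha> \<beta>" "t = GPair \<gamma> \<delta>"
    by (metis gis.exhaust)
  have paths: "\<alpha> \<in> finite_paths EO" "\<beta> \<in> finite_paths EO" "\<gamma> \<in> finite_paths EO" "\<delta> \<in> finite_paths EO"
    and targets: "path_target EO \<alpha> = path_target EO \<beta>" "path_target EO \<gamma> = path_target EO \<delta>"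
    using assms by (simp_all add: st EO.GPair_in_gis_iff)
  show ?thesis
  proof (cases rule: gis_mult_cases[of \<gamma> \<beta> \<alpha> \<delta>])
    case (left r)
    then obtain r' where "\<And>\<alpha>. path_target EO \<alpha> = path_target EO \<beta> \<Longrightarrow>
        push_path (path_append \<alpha> r) = path_append (push_path \<alpha>) r'"
      using push_path_append[of "path_target EO \<beta>" r] paths by (auto simp: EO.path_append_in_finite_paths)
    then show ?thesis using left targets by (simp add: st gis_mult_append_left)
  next
    case (right r)
    then obtain r' where "\<And>\<alpha>. path_target EO \<alpha> = path_target EO \<gamma> \<Longrightarrow>
        push_path (path_append \<alpha> r) = path_append (push_path \<alpha>) r'"
      using push_path_append[of "path_target EO \<gamma>" r] paths by (auto simp: EO.path_append_in_finite_paths)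
    then show ?thesis using right targets by (simp add: st gis_mult_append_right)
  next
    case zero
    then have "\<not> comparable (push_path \<beta>) (push_path \<gamma>)"
      using comparable_push_path paths by blast
    then show ?thesis using zero(2) gis_mult_eq_GZero_iff by (metis st push.simps)
  qed
qed

lemma push_hom: "extended_path_hom EO E push"
  unfolding extended_path_hom_def
proof (intro conjI ballI funcsetI)
  fix s assume "s \<in> graph_inverse_semigroup EO"
  then show "push s \<in> graph_inverse_semigroup E"
    by (cases s) (auto simp: EO.GPair_in_gis_iff GPair_in_gis_iff push_path_closed)
qed (simp_all add: push_mult)

lemma push_vertex: "v \<in> verts EO \<Longrightarrow> push (gis_vertex v) = split_phi0 E w n \<epsilon> v"
  by (cases v) (auto simp: verts_EO gis_vertex_def vertex_path_def push_path_def split_phi0_def edge_path_def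
      forced_def split_mult_def \<epsilon>_arc)

lemma push_edge: "x \<in> arcs EO \<Longrightarrow>
    push (GPair (edge_path EO x) (vertex_path (head EO x))) = split_phi1 E w n \<epsilon> x"
  by (cases x) (auto simp: arcs_EO vertex_path_def push_path_def split_phi1_def edge_path_def path_append_def
      forced_def split_mult_def \<epsilon>_arc head_EO fst_tail_EO EO_def[symmetric])

lemma determine_push: "determine EO E (split_phi0 E w n \<epsilon>) (split_phi1 E w n \<epsilon>) push"
  unfolding determine_def
proof (intro conjI allI impI ballI)
  show "extends_generators EO (split_phi0 E w n \<epsilon>) (split_phi1 E w n \<epsilon>) push"
    unfolding extends_generators_def using push_vertex push_edge by blast
  fix \<psi> s
  assume "extended_path_hom EO E \<psi> \<and> extends_generators EO (split_phi0 E w n \<epsilon>) (split_phi1 E w n \<epsilon>) \<psi>"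
    and "s \<in> graph_inverse_semigroup EO"
  then show "\<psi> s = push s"
    unfolding extends_generators_def
    by (intro extended_path_hom_eqI[OF wf_EO push_hom, of \<psi> s]) (simp_all add: push_vertex push_edge del: push.simps)
qed (rule push_hom)

text \<open>An element below an idempotent is of the form \<open>(\<alpha>, \<alpha>)\<close>, here
  with \<open>\<alpha>\<close> extending the path attached to \<open>u\<close>. A suitable arc of
  \<open>EO\<close> is read off \<open>\<alpha>\<close>: the first edge gives the underlying edge,
  the second one the superscript.\<close>

lemma regular_push: "regular_eph EO E push"
  unfolding regular_eph_def
proof (intro ballI impI, elim conjE)
  fix u t
  assume u: "u \<in> reg EO" and t: "t \<in> graph_inverse_semigroup E" "t \<noteq> GZero"
    and le: "gis_le t (push (gis_vertex u))"
  obtain v i where vi: "u = (v, i)" by fastforce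
  have uv: "(v, i) \<in> verts EO" using u by (simp add: reg_def vi)
  obtain \<alpha> \<beta> where t_eq: "t = GPair \<alpha> \<beta>" using t by (cases t) auto
  let ?\<mu> = "(v, forced u)"
  have "GPair \<alpha> \<alpha> \<cdot> GPair ?\<mu> ?\<mu> = GPair \<alpha> \<beta>"
    using le by (simp add: gis_le_def t_eq gis_mult_same gis_vertex_def vertex_path_def push_path_def vi)
  then obtain r where \<alpha>: "\<alpha> = path_append ?\<mu> r" "\<beta> = \<alpha>"
    by (cases rule: gis_mult_cases[of ?\<mu> \<alpha> \<alpha> ?\<mu>]) auto
  have path: "\<alpha> \<in> finite_paths E" using t by (simp add: t_eq GPair_in_gis_iff)
  have "\<exists>x\<in>out_arcs EO u. comparable \<alpha> (push_path (edge_path EO x))"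
  proof (cases "snd \<alpha>")
    case Nil
    obtain x where x: "x \<in> out_arcs EO u" using u unfolding reg_def by blast
    have "path_prefix \<alpha> (push_path (edge_path EO x))"
      using x \<alpha>(1) Nil fst_tail_EO[of x]
      by (auto simp: path_prefix_def push_path_def edge_path_def out_arcs_def vi)
    then show ?thesis using x by (auto simp: comparable_def)
  next
    case (Cons e q)
    have \<alpha>_eq: "\<alpha> = (v, e # q)" using \<alpha>(1) Cons by (simp add: prod_eq_iff)
    then have e: "e \<in> arcs E" "tail E e = v" and q: "(head E e, q) \<in> finite_paths E"
      using path by auto
    have "v = w \<longrightarrow> e = \<epsilon> i"
      using \<alpha>(1) by (auto simp: \<alpha>_eq path_append_def forced_def vi)
    then have tail: "tail EO (e, j) = u" for j
      using tail_EO_iff[of "(e, j)", OF _ uv] e vi by simp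
    \<comment> \<open>If the first edge ends at \<open>w\<close> and \<open>\<alpha>\<close> goes
      on, the next edge is some \<open>\<epsilon> j\<close> and fixes the superscript; otherwise
      \<open>1\<close> is good enough.\<close>
    have "\<exists>j. 1 \<le> j \<and> j \<le> split_mult w n (head E e) \<and> (head E e = w \<longrightarrow> q \<noteq> [] \<longrightarrow> hd q = \<epsilon> j)"
    proof (cases "head E e = w \<and> q \<noteq> []")
      case True
      then have "hd q \<in> arcs E" "tail E (hd q) = w" using q by (cases q; simp)+
      then show ?thesis using \<epsilon>_surj[of "hd q"] True by (auto simp: split_mult_def)
    qed (use n_pos in \<open>auto simp: split_mult_def\<close>)
    then obtain j where j: "1 \<le> j" "j \<le> split_mult w n (head E e)"
      "head E e = w \<Longrightarrow> q \<noteq> [] \<Longrightarrow> hd q = \<epsilon> j" by blast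
    then have "(e, j) \<in> out_arcs EO u" using e(1) tail by (simp add: out_arcs_def arcs_EO)
    moreover have "comparable \<alpha> (push_path (edge_path EO (e, j)))"
      using j(3) tail[of j]
      by (cases q) (auto simp: comparable_def \<alpha>_eq path_prefix_def push_path_def edge_path_def head_EO forced_def vi)
    ultimately show ?thesis by blast
  qed
  then show "\<exists>x\<in>out_arcs EO u. t \<cdot> push (GPair (edge_path EO x) (edge_path EO x)) \<noteq> GZero"
    by (simp add: t_eq gis_mult_eq_GZero_iff \<alpha>(2))
qed

end

section \<open>Cuntz-Krieger families modulo a congruence\<close>

text \<open>
  The relation is only reflexive on the elements it is meant for, so that membership in a
  subalgebra is part of every statement \<open>a \<simeq> b\<close>.
\<close>

locale star_congruence =
  fixes star :: "'a :: ring \<Rightarrow> 'a" and cong :: "'a \<Rightarrow> 'a \<Rightarrow> bool" (infix \<open>\<simeq>\<close> 50)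
  assumes star_add: "star (a + b) = star a + star b"
    and star_mult: "star (a * b) = star b * star a"
    and star_star: "star (star a) = a"
    and cong_sym: "a \<simeq> b \<Longrightarrow> b \<simeq> a"
    and cong_trans [trans]: "a \<simeq> b \<Longrightarrow> b \<simeq> c \<Longrightarrow> a \<simeq> c"
    and cong_zero: "0 \<simeq> 0"
    and cong_add: "a \<simeq> b \<Longrightarrow> c \<simeq> d \<Longrightarrow> a + c \<simeq> b + d"
    and cong_diff: "a \<simeq> b \<Longrightarrow> c \<simeq> d \<Longrightarrow> a - c \<simeq> b - d"
    and cong_mult: "a \<simeq> b \<Longrightarrow> c \<simeq> d \<Longrightarrow> a * c \<simeq> b * d"
    and cong_star: "a \<simeq> b \<Longrightarrow> star a \<simeq> star b"
    and cong_star_mult_zero: "a \<simeq> a \<Longrightarrow> star a * a \<simeq> 0 \<Longrightarrow> a \<simeq> 0"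
begin

lemma eq_cong_trans [trans]: "a = b \<Longrightarrow> b \<simeq> c \<Longrightarrow> a \<simeq> c"
  and cong_eq_trans [trans]: "a \<simeq> b \<Longrightarrow> b = c \<Longrightarrow> a \<simeq> c"
  by simp_all

lemma cong_right: "a \<simeq> b \<Longrightarrow> b \<simeq> b"
  using cong_sym cong_trans by blast+

lemma star_zero: "star 0 = 0"
  using star_add[of 0 0] by simp

lemma star_diff: "star (a - b) = star a - star b"
  using star_add[of "a - b" b] by simp

lemma star_sum: "star (\<Sum>i\<in>I. f i) = (\<Sum>i\<in>I. star (f i))"
  by (induction I rule: infinite_finite_induct) (simp_all add: star_add star_zero)

lemma cong_sum: "(\<And>i. i \<in> I \<Longrightarrow> f i \<simeq> g i) \<Longrightarrow> (\<Sum>i\<in>I. f i) \<simeq> (\<Sum>i\<in>I. g i)"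
  by (induction I rule: infinite_finite_induct) (simp_all add: cong_add cong_zero)

lemma cong_sum_delta:
  assumes "finite I" "i \<in> I" "\<And>j. j \<in> I \<Longrightarrow> f j \<simeq> (if i = j then a else 0)"
  shows "(\<Sum>j\<in>I. f j) \<simeq> a"
proof -
  have "(\<Sum>j\<in>I. f j) \<simeq> (\<Sum>j\<in>I. if i = j then a else 0)"
    using assms(3) by (rule cong_sum)
  also have "\<dots> = a" using assms(1,2) by simp
  finally show ?thesis .
qed

lemma cong_sum_zero: "(\<And>i. i \<in> I \<Longrightarrow> f i \<simeq> 0) \<Longrightarrow> (\<Sum>i\<in>I. f i) \<simeq> 0"
  using cong_sum[of I f "\<lambda>_. 0"] by simp

lemma cong_zero_left: "a \<simeq> 0 \<Longrightarrow> b \<simeq> b \<Longrightarrow> a * b \<simeq> 0"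
  using cong_mult[of a 0 b b] by simp

lemma cong_zero_right: "a \<simeq> a \<Longrightarrow> b \<simeq> 0 \<Longrightarrow> a * b \<simeq> 0"
  using cong_mult[of a a b 0] by simp

text \<open>The relations of \<open>graph_relations\<close>, with arbitrary elements for the
  generators and \<open>\<simeq>\<close> for equality. Because \<open>\<simeq>\<close> is reflexive
  only on the intended elements, the predicate also places every \<open>P v\<close> and
  \<open>T e\<close> among them.\<close>

definition ck_family :: "('v, 'e) pre_digraph \<Rightarrow> ('v \<Rightarrow> 'a) \<Rightarrow> ('e \<Rightarrow> 'a) \<Rightarrow> bool" where
  "ck_family E P T \<longleftrightarrow>
    (\<forall>v\<in>verts E. P v * P v \<simeq> P v) \<and>
    (\<forall>v\<in>verts E. star (P v) \<simeq> P v) \<and>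
    (\<forall>u\<in>verts E. \<forall>v\<in>verts E. u \<noteq> v \<longrightarrow> P u * P v \<simeq> 0) \<and>
    (\<forall>e\<in>arcs E. \<forall>e'\<in>arcs E. star (T e) * T e' \<simeq> (if e = e' then P (head E e) else 0)) \<and>
    (\<forall>e\<in>arcs E. P (tail E e) * T e \<simeq> T e) \<and>
    (\<forall>v\<in>reg E. P v \<simeq> (\<Sum>e\<in>out_arcs E v. T e * star (T e)))"

lemma ck_familyD:
  assumes "ck_family E P T"
  shows "v \<in> verts E \<Longrightarrow> P v * P v \<simeq> P v"
    and "v \<in> verts E \<Longrightarrow> star (P v) \<simeq> P v"
    and "u \<in> verts E \<Longrightarrow> v \<in> verts E \<Longrightarrow> u \<noteq> v \<Longrightarrow> P u * P v \<simeq> 0"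
    and "e \<in> arcs E \<Longrightarrow> star (T e) * T e \<simeq> P (head E e)"
    and "e \<in> arcs E \<Longrightarrow> e' \<in> arcs E \<Longrightarrow> e \<noteq> e' \<Longrightarrow> star (T e) * T e' \<simeq> 0"
    and "e \<in> arcs E \<Longrightarrow> P (tail E e) * T e \<simeq> T e"
    and "v \<in> reg E \<Longrightarrow> P v \<simeq> (\<Sum>e\<in>out_arcs E v. T e * star (T e))"
    and "v \<in> verts E \<Longrightarrow> P v \<simeq> P v"
    and "e \<in> arcs E \<Longrightarrow> T e \<simeq> T e"
    and "e \<in> arcs E \<Longrightarrow> star (T e) \<simeq> star (T e)"
proof -
  note ck = assms[unfolded ck_family_def]
  show P: "P v * P v \<simeq> P v" if "v \<in> verts E" using ck that by blast
  show "star (P v) \<simeq> P v" if "v \<in> verts E" using ck that by blast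
  show "P u * P v \<simeq> 0" if "u \<in> verts E" "v \<in> verts E" "u \<noteq> v" using ck that by blast
  have T: "star (T e) * T e' \<simeq> (if e = e' then P (head E e) else 0)" if "e \<in> arcs E" "e' \<in> arcs E" for e e'
    using ck that by blast
  show "star (T e) * T e \<simeq> P (head E e)" if "e \<in> arcs E" using T[OF that that] by simp
  show "star (T e) * T e' \<simeq> 0" if "e \<in> arcs E" "e' \<in> arcs E" "e \<noteq> e'" using T[OF that(1,2)] that(3) by simp
  show PT: "P (tail E e) * T e \<simeq> T e" if "e \<in> arcs E" using ck that by blast
  show "P v \<simeq> (\<Sum>e\<in>out_arcs E v. T e * star (T e))" if "v \<in> reg E" using ck that by blast
  show "P v \<simeq> P v" if "v \<in> verts E" using P[OF that] by (rule cong_right)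
  show "T e \<simeq> T e" if "e \<in> arcs E" using PT[OF that] by (rule cong_right)
  then show "star (T e) \<simeq> star (T e)" if "e \<in> arcs E" using that by (intro cong_star)
qed

text \<open>The defining relations contain no absorption at the target end. With \<open>P\<close>
  the target projection and \<open>d = T e * P - T e\<close>, the relation
  \<open>star (T e) * T e \<simeq> P\<close> turns \<open>star d * d\<close> into a polynomial in
  \<open>P\<close> that vanishes, and then \<open>cong_star_mult_zero\<close> gives
  \<open>d \<simeq> 0\<close>.\<close>

lemma ck_family_head:
  assumes "wf_digraph E" "ck_family E P T" "e \<in> arcs E"
  shows "T e * P (head E e) \<simeq> T e" "P (head E e) * star (T e) \<simeq> star (T e)"
proof -
  note ck = ck_familyD[OF assms(2)]
  let ?P = "P (head E e)" and ?T = "T e"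
  have v: "head E e \<in> verts E" using assms by (simp add: wf_digraph.head_in_verts)
  have TT: "star ?T * ?T \<simeq> ?P" using ck(4) assms(3) .
  note P = ck(1,2,8)[OF v]
  have d: "?T * ?P - ?T \<simeq> ?T * ?P - ?T"
    by (rule cong_diff[OF cong_mult[OF ck(9) P(3)] ck(9)]) (rule assms(3))+
  have "star (?T * ?P - ?T) * (?T * ?P - ?T) =
      (star ?P * (star ?T * ?T) * ?P - star ?P * (star ?T * ?T)) - (star ?T * ?T * ?P - star ?T * ?T)"
    by (simp add: star_diff star_mult algebra_simps)
  also have "\<dots> \<simeq> (?P * ?P * ?P - ?P * ?P) - (?P * ?P - ?P)"
    by (intro cong_diff cong_mult TT P)
  also have "\<dots> \<simeq> (?P * ?P - ?P) - (?P - ?P)"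
    by (intro cong_diff cong_mult P)
  also have "\<dots> \<simeq> (?P - ?P) - (?P - ?P)"
    by (intro cong_diff P)
  finally have "star (?T * ?P - ?T) * (?T * ?P - ?T) \<simeq> 0" by (simp only: diff_self diff_0_right)
  then have "?T * ?P - ?T \<simeq> 0" by (rule cong_star_mult_zero[OF d])
  then have "(?T * ?P - ?T) + ?T \<simeq> 0 + ?T"
    using ck(9)[OF assms(3)] by (rule cong_add)
  then show *: "?T * ?P \<simeq> ?T" by simp
  have "?P * star ?T \<simeq> star ?P * star ?T"
    by (intro cong_mult cong_sym[OF P(2)] ck(10) assms(3))
  also have "\<dots> = star (?T * ?P)" by (simp add: star_mult)
  also have "\<dots> \<simeq> star ?T" by (rule cong_star[OF *])
  finally show "?P * star ?T \<simeq> star ?T" .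
qed

lemma ck_family_tail:
  assumes "wf_digraph E" "ck_family E P T" "e \<in> arcs E"
  shows "star (T e) * P (tail E e) \<simeq> star (T e)"
proof -
  note ck = ck_familyD[OF assms(2)]
  have v: "tail E e \<in> verts E" using assms by (simp add: wf_digraph.tail_in_verts)
  have "star (T e) * P (tail E e) \<simeq> star (T e) * star (P (tail E e))"
    by (intro cong_mult cong_sym[OF ck(2)] ck(10) assms(3) v)
  also have "\<dots> = star (P (tail E e) * T e)" by (simp add: star_mult)
  also have "\<dots> \<simeq> star (T e)" by (intro cong_star ck(6) assms(3))
  finally show ?thesis .
qed

end

locale out_split_congruence = out_split E w n \<epsilon> + star_congruence star cong
  for E :: "('v, 'e) pre_digraph" and w n \<epsilon>
    and star :: "'a :: ring \<Rightarrow> 'a" and cong (infix \<open>\<simeq>\<close> 50)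
begin

abbreviation mult_of :: "'v \<Rightarrow> nat" where
  "mult_of \<equiv> split_mult w n"

section \<open>Edges leaving the copies of a vertex\<close>

definition exits :: "'v \<Rightarrow> nat \<Rightarrow> 'e set" where
  "exits v i = (if v = w then {\<epsilon> i} else out_arcs E v)"

lemma in_exits_iff:
  assumes "(v, i) \<in> verts EO"
  shows "e \<in> exits v i \<longleftrightarrow> e \<in> arcs E \<and> tail E e = v \<and> (v = w \<longrightarrow> e = \<epsilon> i)"
  using verts_EO_w[OF assms] \<epsilon>_arc by (auto simp: exits_def out_arcs_def)

lemma out_arcs_EO:
  assumes "(v, i) \<in> verts EO"
  shows "out_arcs EO (v, i) = Sigma (exits v i) (\<lambda>e. {1..mult_of (head E e)})"
proof (rule Set.set_eqI)
  fix x :: "'e \<times> nat"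
  obtain e j where x: "x = (e, j)" by fastforce
  show "x \<in> out_arcs EO (v, i) \<longleftrightarrow> x \<in> Sigma (exits v i) (\<lambda>e. {1..mult_of (head E e)})"
    using tail_EO_iff[OF _ assms, of x] by (auto simp: x in_exits_iff[OF assms] out_arcs_def arcs_EO)
qed

lemma finite_exits: "v \<in> reg E \<Longrightarrow> finite (exits v i)"
  by (simp add: exits_def reg_def)

text \<open>Each exit has at least one and only finitely many copies, so finiteness and nonemptiness
  pass between \<open>exits v i\<close> and the arcs leaving the copy. At \<open>w\<close> the exits
  form the singleton of \<open>\<epsilon> i\<close>, so every \<open>w\<^sup>i\<close> is
  regular.\<close>

lemma reg_EO_iff:
  assumes "(v, i) \<in> verts EO"
  shows "(v, i) \<in> reg EO \<longleftrightarrow> v \<in> reg E"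
proof -
  have v: "v \<in> verts E" using assms by (simp add: verts_EO)
  have one: "1 \<in> {1..mult_of (head E e)}" for e using split_mult_pos[of "head E e"] by simp
  have fst: "fst ` out_arcs EO (v, i) = exits v i"
    unfolding out_arcs_EO[OF assms] using one by force
  have "finite (out_arcs EO (v, i)) \<longleftrightarrow> finite (exits v i)"
    using fst finite_imageI[of "out_arcs EO (v, i)" fst]
    by (auto simp: out_arcs_EO[OF assms])
  moreover have "out_arcs EO (v, i) \<noteq> {} \<longleftrightarrow> exits v i \<noteq> {}"
    using fst by (metis image_is_empty)
  ultimately have "(v, i) \<in> reg EO \<longleftrightarrow> finite (exits v i) \<and> exits v i \<noteq> {}"
    using assms by (simp add: reg_def)
  then show ?thesis
    using v w_reg by (cases "v = w") (simp_all add: exits_def reg_def)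
qed

text \<open>Regrouping for the Cuntz-Krieger relation at \<open>v\<close>: the arcs leaving the
  copies of \<open>v\<close> are the copies of the edges leaving \<open>v\<close>, and each arc
  leaves exactly one copy.\<close>

lemma sum_out_arcs_EO:
  fixes F :: "'e \<times> nat \<Rightarrow> 'b :: comm_monoid_add"
  assumes "v \<in> reg E"
  shows "(\<Sum>i=1..mult_of v. \<Sum>x\<in>out_arcs EO (v, i). F x) =
    (\<Sum>e\<in>out_arcs E v. \<Sum>i=1..mult_of (head E e). F (e, i))"
proof -
  have v: "v \<in> verts E" and fin: "finite (out_arcs E v)" using assms by (simp_all add: reg_def)
  have verts: "(v, i) \<in> verts EO" if "i \<in> {1..mult_of v}" for i
    using that v by (simp add: verts_EO)
  have disj: "\<forall>i\<in>{1..mult_of v}. \<forall>j\<in>{1..mult_of v}. i \<noteq> j \<longrightarrow> out_arcs EO (v, i) \<inter> out_arcs EO (v, j) = {}"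
    by (auto simp: out_arcs_def)
  have "finite (out_arcs EO (v, i))" if "i \<in> {1..mult_of v}" for i
    unfolding out_arcs_EO[OF verts[OF that]] using finite_exits[OF assms] by simp
  then have "(\<Sum>i=1..mult_of v. \<Sum>x\<in>out_arcs EO (v, i). F x) = sum F (\<Union>i\<in>{1..mult_of v}. out_arcs EO (v, i))"
    using disj by (simp add: sum.UNION_disjoint)
  also have "(\<Union>i\<in>{1..mult_of v}. out_arcs EO (v, i)) = Sigma (out_arcs E v) (\<lambda>e. {1..mult_of (head E e)})"
  proof (cases "v = w")
    case True
    show ?thesis
    proof (intro equalityI subsetI)
      fix x assume x: "x \<in> Sigma (out_arcs E v) (\<lambda>e. {1..mult_of (head E e)})"
      then have "fst x \<in> arcs E" "tail E (fst x) = w" using True by auto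
      then obtain i where i: "1 \<le> i" "i \<le> n" "fst x = \<epsilon> i" using \<epsilon>_surj by blast
      then have "i \<in> {1..mult_of v}" by (simp add: True split_mult_def)
      moreover have "x \<in> out_arcs EO (v, i)"
        unfolding out_arcs_EO[OF verts[OF calculation]] using x i by (auto simp: exits_def True)
      ultimately show "x \<in> (\<Union>i\<in>{1..mult_of v}. out_arcs EO (v, i))" by blast
    qed (use verts in \<open>auto simp: out_arcs_EO in_exits_iff\<close>)
  next
    case False
    then show ?thesis using out_arcs_EO[OF verts[of 1]] by (simp add: split_mult_def exits_def)
  qed
  also have "sum F \<dots> = (\<Sum>e\<in>out_arcs E v. \<Sum>i=1..mult_of (head E e). F (e, i))"
    using fin by (simp add: sum.Sigma)
  finally show ?thesis .
qed

subsection \<open>Merging and splitting Cuntz-Krieger families\<close>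

text \<open>Merging is the formula of \<open>f\<^sup>*\<close> on generators, and
  \<open>split_vert\<close> and \<open>split_edge\<close> below are the formulas of
  \<open>\<phi>\<^sub>*\<close>. They are stated for arbitrary families so that composites can be
  computed with the same definitions.\<close>

definition merge_vert :: "('v \<times> nat \<Rightarrow> 'a) \<Rightarrow> 'v \<Rightarrow> 'a" where
  "merge_vert P v = (\<Sum>i=1..mult_of v. P (v, i))"

definition merge_edge :: "('e \<times> nat \<Rightarrow> 'a) \<Rightarrow> 'e \<Rightarrow> 'a" where
  "merge_edge T e = (\<Sum>i=1..mult_of (head E e). T (e, i))"

context
  fixes P T
  assumes ck: "ck_family EO P T"
begin

text \<open>Mixed terms vanish because the copies of an edge have different targets: inserting the
  target projections puts two orthogonal projections in the middle.\<close>

lemma merge_edge_star: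
  assumes e: "e \<in> arcs E"
  shows "merge_edge T e * star (merge_edge T e) \<simeq> (\<Sum>i=1..mult_of (head E e). T (e, i) * star (T (e, i)))"
proof -
  let ?I = "{1..mult_of (head E e)}"
  have arc: "(e, i) \<in> arcs EO" if "i \<in> ?I" for i using that e by (simp add: arcs_EO)
  have vert: "(head E e, i) \<in> verts EO" if "i \<in> ?I" for i using that e by (simp add: verts_EO)
  have "merge_edge T e * star (merge_edge T e) = (\<Sum>i\<in>?I. \<Sum>j\<in>?I. T (e, i) * star (T (e, j)))"
    by (simp add: merge_edge_def star_sum sum_product)
  also have "\<dots> \<simeq> (\<Sum>i\<in>?I. T (e, i) * star (T (e, i)))"
  proof (intro cong_sum cong_sum_delta)
    fix i j assume ij: "i \<in> ?I" "j \<in> ?I"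
    note T = ck_familyD(9,10)[OF ck]
    show "T (e, i) * star (T (e, j)) \<simeq> (if i = j then T (e, i) * star (T (e, i)) else 0)"
    proof (cases "i = j")
      case True
      then show ?thesis using T arc ij by (simp add: cong_mult)
    next
      case False
      note head = ck_family_head[OF wf_EO ck arc, unfolded head_EO]
      have "T (e, i) * star (T (e, j)) \<simeq> (T (e, i) * P (head E e, i)) * (P (head E e, j) * star (T (e, j)))"
        by (intro cong_mult cong_sym[OF head(1)] cong_sym[OF head(2)] ij)
      also have "\<dots> = T (e, i) * (P (head E e, i) * P (head E e, j)) * star (T (e, j))"
        by (simp add: mult.assoc)
      also have "\<dots> \<simeq> 0"
        using False by (intro cong_zero_left cong_zero_right ck_familyD(3)[OF ck] T arc vert ij) auto
      finally show ?thesis using False by simp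
    qed
  qed auto
  finally show ?thesis .
qed

lemma merge_ck_family: "ck_family E (merge_vert P) (merge_edge T)"
  unfolding ck_family_def
proof (intro conjI ballI impI)
  note ckD = ck_familyD[OF ck]
  have vert: "(v, i) \<in> verts EO" if "v \<in> verts E" "i \<in> {1..mult_of v}" for v i
    using that by (simp add: verts_EO)
  have arc: "(e, i) \<in> arcs EO" if "e \<in> arcs E" "i \<in> {1..mult_of (head E e)}" for e i
    using that by (simp add: arcs_EO)
  fix v assume v: "v \<in> verts E"
  have "merge_vert P v * merge_vert P v = (\<Sum>i=1..mult_of v. \<Sum>j=1..mult_of v. P (v, i) * P (v, j))"
    by (simp add: merge_vert_def sum_product)
  also have "\<dots> \<simeq> (\<Sum>i=1..mult_of v. P (v, i))"
    by (intro cong_sum cong_sum_delta) (auto simp: ckD vert[OF v])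
  finally show "merge_vert P v * merge_vert P v \<simeq> merge_vert P v"
    by (simp add: merge_vert_def)
  show "star (merge_vert P v) \<simeq> merge_vert P v"
    unfolding merge_vert_def star_sum by (intro cong_sum ckD(2) vert v)
  fix u assume u: "u \<in> verts E" and "v \<noteq> u"
  then show "merge_vert P v * merge_vert P u \<simeq> 0"
    unfolding merge_vert_def sum_product by (intro cong_sum_zero ckD(3) vert u v) auto
next
  note ckD = ck_familyD[OF ck]
  have arc: "(e, i) \<in> arcs EO" if "e \<in> arcs E" "i \<in> {1..mult_of (head E e)}" for e i
    using that by (simp add: arcs_EO)
  fix e assume e: "e \<in> arcs E"
  show "star (merge_edge T e) * merge_edge T e' \<simeq> (if e = e' then merge_vert P (head E e) else 0)"
    if e': "e' \<in> arcs E" for e'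
  proof (cases "e = e'")
    case True
    have "star (merge_edge T e) * merge_edge T e =
        (\<Sum>i=1..mult_of (head E e). \<Sum>j=1..mult_of (head E e). star (T (e, i)) * T (e, j))"
      by (simp add: merge_edge_def star_sum sum_product)
    also have "\<dots> \<simeq> merge_vert P (head E e)"
      unfolding merge_vert_def
    proof (intro cong_sum cong_sum_delta)
      fix i j assume "i \<in> {1..mult_of (head E e)}" "j \<in> {1..mult_of (head E e)}"
      then show "star (T (e, i)) * T (e, j) \<simeq> (if i = j then P (head E e, i) else 0)"
        using ckD(4)[OF arc[OF e], of i] ckD(5)[OF arc[OF e] arc[OF e], of i j]
        by (cases "i = j") (simp_all add: head_EO)
    qed auto
    finally show ?thesis using True by simp
  next
    case False
    have "star (merge_edge T e) * merge_edge T e' \<simeq> 0"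
      unfolding merge_edge_def star_sum sum_product
      using False by (intro cong_sum_zero ckD(5) arc e e') auto
    then show ?thesis using False by simp
  qed
  have tail: "tail EO (e, j) \<in> {(tail E e, i) |i. i \<in> {1..mult_of (tail E e)}}"
    if "j \<in> {1..mult_of (head E e)}" for j
    using tail_EO_in_verts[OF arc[OF e that]] fst_tail_EO[of "(e, j)"]
    by (cases "tail EO (e, j)") (auto simp: verts_EO)
  have "merge_vert P (tail E e) * merge_edge T e =
      (\<Sum>j=1..mult_of (head E e). \<Sum>i=1..mult_of (tail E e). P (tail E e, i) * T (e, j))"
    unfolding merge_vert_def merge_edge_def sum_product by (rule sum.swap)
  also have "\<dots> \<simeq> merge_edge T e"
    unfolding merge_edge_def
  proof (rule cong_sum)
    fix j assume j: "j \<in> {1..mult_of (head E e)}"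
    \<comment> \<open>Only the copy \<open>k\<close> from which \<open>(e, j)\<close> starts
      contributes; for any other copy, inserting \<open>P (tail E e, k)\<close> produces a product
      of orthogonal projections.\<close>
    obtain k where k: "k \<in> {1..mult_of (tail E e)}" "tail EO (e, j) = (tail E e, k)"
      using tail[OF j] by blast
    have PT: "P (tail E e, k) * T (e, j) \<simeq> T (e, j)"
      using ckD(6)[OF arc[OF e j]] k by simp
    show "(\<Sum>i=1..mult_of (tail E e). P (tail E e, i) * T (e, j)) \<simeq> T (e, j)"
    proof (rule cong_sum_delta[OF _ k(1)])
      fix i assume i: "i \<in> {1..mult_of (tail E e)}"
      show "P (tail E e, i) * T (e, j) \<simeq> (if k = i then T (e, j) else 0)"
      proof (cases "k = i")
        case True
        then show ?thesis using PT by simp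
      next
        case False
        have verts: "(tail E e, i) \<in> verts EO" "(tail E e, k) \<in> verts EO"
          using i k e by (simp_all add: verts_EO)
        have "P (tail E e, i) * T (e, j) \<simeq> P (tail E e, i) * (P (tail E e, k) * T (e, j))"
          by (intro cong_mult cong_sym[OF PT] ckD(8) verts)
        also have "\<dots> = (P (tail E e, i) * P (tail E e, k)) * T (e, j)" by (simp add: mult.assoc)
        also have "\<dots> \<simeq> 0"
          using False by (intro cong_zero_left ckD(3) verts ckD(9) arc e j) auto
        finally show ?thesis using False by simp
      qed
    qed simp
  qed
  finally show "merge_vert P (tail E e) * merge_edge T e \<simeq> merge_edge T e" .
next
  fix v assume v: "v \<in> reg E"
  \<comment> \<open>Every copy of a regular vertex is regular, so the relation of \<open>EO\<close>
    applies to each summand; the double sum is then regrouped by underlying edges, and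
    \<open>merge_edge_star\<close> collects the copies of each.\<close>
  have "merge_vert P v \<simeq> (\<Sum>i=1..mult_of v. \<Sum>x\<in>out_arcs EO (v, i). T x * star (T x))"
    unfolding merge_vert_def
    by (intro cong_sum ck_familyD(7)[OF ck]) (use v reg_EO_iff verts_EO in \<open>auto simp: reg_def\<close>)
  also have "\<dots> = (\<Sum>e\<in>out_arcs E v. \<Sum>i=1..mult_of (head E e). T (e, i) * star (T (e, i)))"
    using v by (rule sum_out_arcs_EO)
  also have "\<dots> \<simeq> (\<Sum>e\<in>out_arcs E v. merge_edge T e * star (merge_edge T e))"
    by (intro cong_sum cong_sym[OF merge_edge_star]) (simp add: out_arcs_def)
  finally show "merge_vert P v \<simeq> (\<Sum>e\<in>out_arcs E v. merge_edge T e * star (merge_edge T e))" .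
qed

end

definition split_vert :: "('v \<Rightarrow> 'a) \<Rightarrow> ('e \<Rightarrow> 'a) \<Rightarrow> 'v \<times> nat \<Rightarrow> 'a" where
  "split_vert P T x = (if fst x = w then T (\<epsilon> (snd x)) * star (T (\<epsilon> (snd x))) else P (fst x))"

text \<open>One formula for both cases of \<open>\<phi>\<^sup>1\<close>: away from \<open>w\<close>
  the right factor is \<open>P (head E e)\<close>, which \<open>T e\<close> absorbs up to
  \<open>\<simeq>\<close>; at \<open>w\<^sup>i\<close> it is the range projection of
  \<open>\<epsilon> i\<close>.\<close>

definition split_edge :: "('v \<Rightarrow> 'a) \<Rightarrow> ('e \<Rightarrow> 'a) \<Rightarrow> 'e \<times> nat \<Rightarrow> 'a" where
  "split_edge P T x = T (fst x) * split_vert P T (head EO x)"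

context
  fixes P T
  assumes ck: "ck_family E P T"
begin

text \<open>At \<open>w\<^sup>i\<close> the element is the range projection of
  \<open>\<epsilon> i\<close>. It is idempotent because \<open>star (T e) * T e\<close> is the
  target projection, which \<open>T e\<close> absorbs, and it lies under \<open>P w\<close> because
  \<open>w\<close> is the source of the edge.\<close>

lemma split_vert_idem:
  assumes x: "x \<in> verts EO"
  shows "split_vert P T x * split_vert P T x \<simeq> split_vert P T x"
    and "star (split_vert P T x) \<simeq> split_vert P T x"
    and "split_vert P T x \<simeq> split_vert P T x"
    and "P (fst x) * split_vert P T x \<simeq> split_vert P T x"
    and "split_vert P T x * P (fst x) \<simeq> split_vert P T x"
proof -
  have "split_vert P T x * split_vert P T x \<simeq> split_vert P T x \<and>
    star (split_vert P T x) \<simeq> split_vert P T x \<and>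
    P (fst x) * split_vert P T x \<simeq> split_vert P T x \<and> split_vert P T x * P (fst x) \<simeq> split_vert P T x"
  proof (cases "fst x = w")
    case True
    define e where "e = \<epsilon> (snd x)"
    have e: "e \<in> arcs E" "tail E e = w" using \<epsilon>_arc verts_EO_w[OF x True] by (simp_all add: e_def)
    note T = ck_familyD(9,10)[OF ck, OF e(1)]
    have Q: "split_vert P T x = T e * star (T e)" using True by (simp add: split_vert_def e_def)
    have "T e * star (T e) * (T e * star (T e)) = T e * (star (T e) * T e) * star (T e)"
      by (simp add: mult.assoc)
    also have "\<dots> \<simeq> T e * P (head E e) * star (T e)"
      by (intro cong_mult T ck_familyD(4)[OF ck] e)
    also have "\<dots> \<simeq> T e * star (T e)"
      by (intro cong_mult T ck_family_head[OF wf_digraph_axioms ck] e)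
    finally have 1: "T e * star (T e) * (T e * star (T e)) \<simeq> T e * star (T e)" .
    have 2: "star (T e * star (T e)) \<simeq> T e * star (T e)"
      using cong_mult[OF T] by (simp add: star_mult star_star)
    have 3: "P w * (T e * star (T e)) \<simeq> T e * star (T e)"
      using cong_mult[OF ck_familyD(6)[OF ck, OF e(1)] T(2)] by (simp add: e(2) mult.assoc)
    have 4: "T e * star (T e) * P w \<simeq> T e * star (T e)"
      using cong_mult[OF T(1) ck_family_tail[OF wf_digraph_axioms ck e(1)]] by (simp add: e(2) mult.assoc)
    show ?thesis using 1 2 3 4 by (simp add: Q True)
  next
    case False
    then have "fst x \<in> verts E" using x by (auto elim: verts_EO_cases)
    then show ?thesis using ck_familyD[OF ck] False by (simp add: split_vert_def)
  qed
  then show "split_vert P T x * split_vert P T x \<simeq> split_vert P T x"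
    "star (split_vert P T x) \<simeq> split_vert P T x" "P (fst x) * split_vert P T x \<simeq> split_vert P T x"
    "split_vert P T x * P (fst x) \<simeq> split_vert P T x" "split_vert P T x \<simeq> split_vert P T x"
    using cong_right by blast+
qed

text \<open>Over different vertices of \<open>E\<close> the two elements lie under orthogonal
  projections. Over a single vertex, that vertex must be \<open>w\<close>, where different edges
  have orthogonal ranges.\<close>

lemma split_vert_orthogonal:
  assumes x: "x \<in> verts EO" and y: "y \<in> verts EO" and "x \<noteq> y"
  shows "split_vert P T x * split_vert P T y \<simeq> 0"
proof (cases "fst x = fst y")
  case False
  have v: "fst x \<in> verts E" "fst y \<in> verts E"
    using x y w_vert by (auto elim: verts_EO_cases)
  have "split_vert P T x * split_vert P T y \<simeq> (split_vert P T x * P (fst x)) * (P (fst y) * split_vert P T y)"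
    by (intro cong_mult cong_sym[OF split_vert_idem(4)] cong_sym[OF split_vert_idem(5)] x y)
  also have "\<dots> = split_vert P T x * (P (fst x) * P (fst y)) * split_vert P T y"
    by (simp add: mult.assoc)
  also have "\<dots> \<simeq> 0"
    by (intro cong_zero_left cong_zero_right ck_familyD(3)[OF ck] split_vert_idem(3) x y v False)
  finally show ?thesis .
next
  case True
  have w: "fst x = w"
  proof (rule ccontr)
    assume "fst x \<noteq> w"
    then have "snd x = 1" "snd y = 1" using x y True by (auto elim: verts_EO_cases)
    then show False using True \<open>x \<noteq> y\<close> by (simp add: prod_eq_iff)
  qed
  let ?e = "\<epsilon> (snd x)" and ?f = "\<epsilon> (snd y)"
  have w': "fst y = w" using True w by simp
  note i = verts_EO_w[OF x w] and j = verts_EO_w[OF y w']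
  have "?e \<noteq> ?f"
    using \<epsilon>_eq_iff[OF i j] \<open>x \<noteq> y\<close> True by (simp add: prod_eq_iff)
  note e = \<epsilon>_arc(1)[OF i] and f = \<epsilon>_arc(1)[OF j]
  have "split_vert P T x * split_vert P T y = T ?e * (star (T ?e) * T ?f) * star (T ?f)"
    by (simp add: split_vert_def w w' mult.assoc)
  also have "\<dots> \<simeq> 0"
    by (intro cong_zero_left cong_zero_right ck_familyD(5,9,10)[OF ck] e f \<open>?e \<noteq> ?f\<close>)
  finally show ?thesis .
qed

text \<open>Regularity of \<open>w\<close> enters here: at \<open>w\<close> the claim is the
  Cuntz-Krieger relation, reindexed along \<open>\<epsilon>\<close>.\<close>

lemma merge_split_vert:
  assumes v: "v \<in> verts E"
  shows "merge_vert (split_vert P T) v \<simeq> P v"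
proof (cases "v = w")
  case True
  have "merge_vert (split_vert P T) v = (\<Sum>i\<in>{1..n}. T (\<epsilon> i) * star (T (\<epsilon> i)))"
    using True by (simp add: merge_vert_def split_vert_def split_mult_def)
  also have "\<dots> = (\<Sum>e\<in>out_arcs E w. T e * star (T e))"
    by (rule sum.reindex_bij_betw[OF \<epsilon>_bij])
  also have "\<dots> \<simeq> P v"
    using ck_familyD(7)[OF ck, OF w_reg] True cong_sym by simp
  finally show ?thesis .
next
  case False
  then show ?thesis using ck_familyD(8)[OF ck, OF v] by (simp add: merge_vert_def split_vert_def split_mult_def)
qed

lemma merge_split_edge:
  assumes e: "e \<in> arcs E"
  shows "merge_edge (split_edge P T) e \<simeq> T e"
proof -
  have "merge_edge (split_edge P T) e = T e * merge_vert (split_vert P T) (head E e)"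
    by (simp add: merge_edge_def merge_vert_def split_edge_def head_EO sum_distrib_left)
  also have "\<dots> \<simeq> T e * P (head E e)"
    by (intro cong_mult ck_familyD(9)[OF ck] e merge_split_vert) (simp add: e)
  also have "\<dots> \<simeq> T e"
    by (rule ck_family_head[OF wf_digraph_axioms ck e])
  finally show ?thesis .
qed

lemma split_ck_family: "ck_family EO (split_vert P T) (split_edge P T)"
  unfolding ck_family_def
proof (intro conjI ballI impI)
  let ?Q = "split_vert P T" and ?U = "split_edge P T"
  note head = ck_family_head[OF wf_digraph_axioms ck]
  have head_verts: "head EO x \<in> verts EO" if "x \<in> arcs EO" for x
    using that wf_EO by (simp add: wf_digraph.head_in_verts)
  show "star (?U x) * ?U y \<simeq> (if x = y then ?Q (head EO x) else 0)"
    if x: "x \<in> arcs EO" and y: "y \<in> arcs EO" for x y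
  proof -
    let ?q = "?Q (head EO x)" and ?r = "?Q (head EO y)"
    note e = arcs_EO_fst[OF x] and f = arcs_EO_fst[OF y]
    note q = split_vert_idem[OF head_verts[OF x]] and r = split_vert_idem[OF head_verts[OF y]]
    have eq: "star (?U x) * ?U y = star ?q * (star (T (fst x)) * T (fst y)) * ?r"
      by (simp add: split_edge_def star_mult mult.assoc)
    show ?thesis
    proof (cases "fst x = fst y")
      case False
      have "star (?U x) * ?U y \<simeq> 0"
        unfolding eq by (intro cong_zero_left cong_zero_right ck_familyD(5)[OF ck] e f False r(3) cong_star[OF q(3)])
      then show ?thesis using False by auto
    next
      case True
      have "star (?U x) * ?U y \<simeq> ?q * P (head E (fst x)) * ?r"
        unfolding eq True by (intro cong_mult q r ck_familyD(4)[OF ck] f)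
      also have "\<dots> \<simeq> ?q * ?r"
        using q(5) by (intro cong_mult r(3)) (simp add: fst_head_EO)
      also have "\<dots> \<simeq> (if x = y then ?q else 0)"
      proof (cases "x = y")
        case True
        then show ?thesis using q(1) by simp
      next
        case False
        \<comment> \<open>Different copies of one edge have different targets, so orthogonality of
          the split projections applies.\<close>
        then have "head EO x \<noteq> head EO y"
          using True by (cases x; cases y) (auto simp: head_EO)
        then show ?thesis
          using split_vert_orthogonal[OF head_verts[OF x] head_verts[OF y]] False by simp
      qed
      finally show ?thesis .
    qed
  qed
  show "?Q (tail EO x) * ?U x \<simeq> ?U x" if x: "x \<in> arcs EO" for x
  proof -
    note e = arcs_EO_fst[OF x]
    note q = split_vert_idem[OF head_verts[OF x]]
    have "?Q (tail EO x) * T (fst x) \<simeq> T (fst x)"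
    proof (cases "tail E (fst x) = w")
      case False
      then show ?thesis
        using ck_familyD(6)[OF ck, OF e] by (simp add: split_vert_def fst_tail_EO)
    next
      case True
      then have "fst x = \<epsilon> (snd (tail EO x))"
        using tail_EO_iff[OF e tail_EO_in_verts[OF x]] by (simp add: fst_tail_EO)
      \<comment> \<open>An arc leaving \<open>w\<^sup>i\<close> is a copy of
        \<open>\<epsilon> i\<close>, so the projection at its source is the range projection of that
        very edge.\<close>
      then have "?Q (tail EO x) * T (fst x) = T (fst x) * (star (T (fst x)) * T (fst x))"
        using True by (simp add: split_vert_def fst_tail_EO mult.assoc)
      also have "\<dots> \<simeq> T (fst x) * P (head E (fst x))"
        by (intro cong_mult ck_familyD(9,4)[OF ck] e)
      also have "\<dots> \<simeq> T (fst x)" by (rule head[OF e])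
      finally show ?thesis .
    qed
    then have "?Q (tail EO x) * T (fst x) * ?Q (head EO x) \<simeq> T (fst x) * ?Q (head EO x)"
      using q(3) by (rule cong_mult)
    then show ?thesis by (simp add: split_edge_def mult.assoc)
  qed
  show "?Q x \<simeq> (\<Sum>y\<in>out_arcs EO x. ?U y * star (?U y))" if x: "x \<in> reg EO" for x
  proof -
    obtain v i where vi: "x = (v, i)" by fastforce
    have vi_vert: "(v, i) \<in> verts EO" using x by (simp add: vi reg_def)
    then have v: "v \<in> reg E" using x reg_EO_iff by (simp add: vi)
    let ?A = "exits v i"
    have A: "e \<in> arcs E" if "e \<in> ?A" for e using that in_exits_iff[OF vi_vert] by simp
    \<comment> \<open>Summing over superscripts first restores the full target projection in the
      middle, by \<open>merge_split_vert\<close>. The remaining sum over \<open>exits v i\<close> is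
      a single term at \<open>w\<close> and the relation of \<open>E\<close> elsewhere.\<close>
    have inner: "(\<Sum>j=1..mult_of (head E e). ?U (e, j) * star (?U (e, j))) \<simeq> T e * star (T e)"
      if e: "e \<in> ?A" for e
    proof -
      note T = ck_familyD(9,10)[OF ck, OF A[OF e]]
      let ?J = "{1..mult_of (head E e)}"
      have "(\<Sum>j\<in>?J. ?U (e, j) * star (?U (e, j))) =
          (\<Sum>j\<in>?J. T e * (?Q (head E e, j) * star (?Q (head E e, j))) * star (T e))"
        by (simp add: split_edge_def head_EO star_mult mult.assoc)
      also have "\<dots> \<simeq> (\<Sum>j\<in>?J. T e * (?Q (head E e, j) * ?Q (head E e, j)) * star (T e))"
        using A[OF e] by (intro cong_sum cong_mult T split_vert_idem) (auto simp: verts_EO)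
      also have "\<dots> \<simeq> (\<Sum>j\<in>?J. T e * ?Q (head E e, j) * star (T e))"
        using A[OF e] by (intro cong_sum cong_mult T split_vert_idem) (auto simp: verts_EO)
      also have "\<dots> = T e * merge_vert ?Q (head E e) * star (T e)"
        by (simp add: merge_vert_def sum_distrib_left sum_distrib_right)
      also have "\<dots> \<simeq> T e * P (head E e) * star (T e)"
        using A[OF e] by (intro cong_mult T merge_split_vert) simp
      also have "\<dots> \<simeq> T e * star (T e)"
        by (intro cong_mult T head A e)
      finally show ?thesis .
    qed
    have "(\<Sum>y\<in>out_arcs EO x. ?U y * star (?U y)) =
        (\<Sum>e\<in>?A. \<Sum>j=1..mult_of (head E e). ?U (e, j) * star (?U (e, j)))"
      unfolding vi out_arcs_EO[OF vi_vert] using finite_exits[OF v] by (simp add: sum.Sigma)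
    also have "\<dots> \<simeq> (\<Sum>e\<in>?A. T e * star (T e))"
      by (intro cong_sum inner)
    also have "\<dots> \<simeq> ?Q x"
    proof (cases "v = w")
      case True
      then have "(\<Sum>e\<in>?A. T e * star (T e)) = ?Q x" by (simp add: vi split_vert_def exits_def)
      then show ?thesis using split_vert_idem(3)[OF vi_vert] by (simp add: vi)
    next
      case False
      then show ?thesis using cong_sym[OF ck_familyD(7)[OF ck, OF v]] by (simp add: vi split_vert_def exits_def)
    qed
    finally show ?thesis by (rule cong_sym)
  qed
qed (auto intro: split_vert_idem split_vert_orthogonal)

end

context
  fixes P T
  assumes ck: "ck_family EO P T"
begin

text \<open>At \<open>w\<^sup>i\<close> this is the Cuntz-Krieger relation of \<open>EO\<close>: the
  arcs leaving \<open>w\<^sup>i\<close> are the copies of \<open>\<epsilon> i\<close>, and their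
  ranges add up to the range of the merged edge.\<close>

lemma split_merge_vert:
  assumes x: "x \<in> verts EO"
  shows "split_vert (merge_vert P) (merge_edge T) x \<simeq> P x"
  using x
proof (cases rule: verts_EO_cases)
  case 1
  then have "split_vert (merge_vert P) (merge_edge T) x = P x"
    by (cases x) (simp add: split_vert_def merge_vert_def split_mult_def)
  then show ?thesis using ck_familyD(8)[OF ck x] by simp
next
  case 2
  define i where "i = snd x"
  have xi: "x = (w, i)" using 2 by (simp add: i_def prod_eq_iff)
  have e: "\<epsilon> i \<in> arcs E" "tail E (\<epsilon> i) = w" using 2 \<epsilon>_arc by (simp_all add: i_def)
  have "split_vert (merge_vert P) (merge_edge T) x \<simeq>
      (\<Sum>j=1..mult_of (head E (\<epsilon> i)). T (\<epsilon> i, j) * star (T (\<epsilon> i, j)))"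
    using merge_edge_star[OF ck e(1)] by (simp add: split_vert_def xi)
  also have "\<dots> = (\<Sum>y\<in>out_arcs EO x. T y * star (T y))"
    using sum.Sigma[of "{\<epsilon> i}" "\<lambda>e. {1..mult_of (head E e)}" "\<lambda>e j. T (e, j) * star (T (e, j))"]
    by (simp add: xi out_arcs_EO[OF x[unfolded xi]] exits_def case_prod_beta)
  also have "\<dots> \<simeq> P x"
    using reg_EO_iff[OF x[unfolded xi]] w_reg by (intro cong_sym[OF ck_familyD(7)[OF ck]]) (simp add: xi)
  finally show ?thesis .
qed

text \<open>Multiplying the merged edge by the projection at \<open>(head E e, i)\<close> keeps only
  the copy with superscript \<open>i\<close>.\<close>

lemma split_merge_edge:
  assumes x: "x \<in> arcs EO"
  shows "split_edge (merge_vert P) (merge_edge T) x \<simeq> T x"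
proof -
  obtain e i where ei: "x = (e, i)" by fastforce
  let ?I = "{1..mult_of (head E e)}"
  have e: "e \<in> arcs E" and i: "i \<in> ?I" using x by (simp_all add: ei arcs_EO)
  have arc: "(e, j) \<in> arcs EO" if "j \<in> ?I" for j using that e by (simp add: arcs_EO)
  have vert: "(head E e, j) \<in> verts EO" if "j \<in> ?I" for j using that e by (simp add: verts_EO)
  note head = ck_family_head(1)[OF wf_EO ck arc, unfolded head_EO]
  have "merge_edge T e \<simeq> merge_edge T e"
    unfolding merge_edge_def by (intro cong_sum ck_familyD(9)[OF ck] arc)
  then have "split_edge (merge_vert P) (merge_edge T) x \<simeq> merge_edge T e * P (head E e, i)"
    using split_merge_vert[OF vert[OF i]] by (simp add: split_edge_def ei head_EO cong_mult)
  also have "\<dots> = (\<Sum>j\<in>?I. T (e, j) * P (head E e, i))"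
    by (simp add: merge_edge_def sum_distrib_right)
  also have "\<dots> \<simeq> T x"
  proof (rule cong_sum_delta[OF _ i])
    fix j assume j: "j \<in> ?I"
    show "T (e, j) * P (head E e, i) \<simeq> (if i = j then T x else 0)"
    proof (cases "i = j")
      case True
      then show ?thesis using head[OF i] by (simp add: ei)
    next
      case False
      have "T (e, j) * P (head E e, i) \<simeq> (T (e, j) * P (head E e, j)) * P (head E e, i)"
        by (intro cong_mult cong_sym[OF head] j ck_familyD(8)[OF ck] vert i)
      also have "\<dots> = T (e, j) * (P (head E e, j) * P (head E e, i))" by (simp add: mult.assoc)
      also have "\<dots> \<simeq> 0"
        using False by (intro cong_zero_right ck_familyD(3,9)[OF ck] arc vert i j) auto
      finally show ?thesis using False by simp
    qed
  qed simp
  finally show ?thesis .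
qed

end

end

section \<open>Free star algebras\<close>

text \<open>A type of its own, so that concatenation can be the \<open>+\<close> behind the
  convolution product of finitely supported functions. The empty word is present as the unit;
  \<open>FA\<close> excludes it.\<close>

datatype 'g word = Word (letters: "('g \<times> bool) list")

instantiation word :: (type) monoid_add
begin

definition "0 = Word []"
definition "v + u = Word (letters v @ letters u)"

instance
  by standard (simp_all add: zero_word_def plus_word_def)

end

text \<open>
  Finitely supported functions on words form a type of class \<open>ring_1\<close>; the subset \<open>FA X\<close>
  below is a copy of \<open>free_star_algebra X\<close> inside it.
\<close>

type_synonym 'g fsa = "'g word \<Rightarrow>\<^sub>0 complex"

definition coeffs :: "'g fsa \<Rightarrow> ('g \<times> bool) list \<Rightarrow> complex" where
  "coeffs a u = Poly_Mapping.lookup a (Word u)"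

definition flip :: "('g \<times> bool) list \<Rightarrow> ('g \<times> bool) list" where
  "flip u = rev (map (\<lambda>(x, s). (x, \<not> s)) u)"

definition star :: "'g fsa \<Rightarrow> 'g fsa" where
  "star a = Poly_Mapping.map_key (\<lambda>v. Word (flip (letters v))) (Poly_Mapping.map cnj a)"

definition scal :: "complex \<Rightarrow> 'g fsa \<Rightarrow> 'g fsa" where
  "scal c a = Poly_Mapping.single 0 c * a"

definition gen :: "'g \<Rightarrow> 'g fsa" where
  "gen x = Poly_Mapping.single (Word [(x, False)]) 1"

definition FA :: "'g set \<Rightarrow> 'g fsa set" where
  "FA X = {a. \<forall>u. coeffs a u \<noteq> 0 \<longrightarrow> u \<noteq> [] \<and> fst ` set u \<subseteq> X}"

lemma coeffs_inject: "coeffs a = coeffs b \<longleftrightarrow> a = b"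
proof
  assume *: "coeffs a = coeffs b"
  show "a = b"
  proof (rule poly_mapping_eqI)
    fix k show "Poly_Mapping.lookup a k = Poly_Mapping.lookup b k"
      using fun_cong[OF *, of "letters k"] by (simp add: coeffs_def)
  qed
qed simp

lemma finite_coeffs: "finite {u. coeffs a u \<noteq> 0}"
proof -
  have "{u. coeffs a u \<noteq> 0} = letters ` {k. Poly_Mapping.lookup a k \<noteq> 0}"
    by (force simp: coeffs_def image_iff)
  then show ?thesis by simp
qed

lemma coeffs_surj:
  assumes "finite {u. f u \<noteq> 0}"
  obtains a where "coeffs a = f"
proof -
  have "{k. f (letters k) \<noteq> 0} \<subseteq> Word ` {u. f u \<noteq> 0}"
    by (force simp: image_iff intro: word.collapse[symmetric])
  then have "finite {k. f (letters k) \<noteq> 0}"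
    using assms finite_surj by blast
  then have "coeffs (Abs_poly_mapping (\<lambda>k. f (letters k))) = f"
    by (simp add: coeffs_def fun_eq_iff)
  then show ?thesis using that by blast
qed

lemma flip_flip [simp]: "flip (flip u) = u"
  by (simp add: flip_def rev_map comp_def case_prod_beta)

lemma coeffs_star: "coeffs (star a) u = cnj (coeffs a (flip u))"
proof -
  have "inj (\<lambda>v. Word (flip (letters v)))"
    by (rule inj_on_inverseI[where g = "\<lambda>v. Word (flip (letters v))"]) simp
  show ?thesis
    by (simp add: star_def coeffs_def map_key.rep_eq[OF \<open>inj _\<close>] Poly_Mapping.map.rep_eq when_def)
qed

lemma coeffs_add: "coeffs (a + b) u = coeffs a u + coeffs b u"
  and coeffs_diff: "coeffs (a - b) u = coeffs a u - coeffs b u"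
  and coeffs_zero: "coeffs 0 u = 0"
  and coeffs_gen: "coeffs (gen x) u = (if u = [(x, False)] then 1 else 0)"
  by (auto simp: coeffs_def lookup_add lookup_minus gen_def lookup_single when_def)

lemma coeffs_scal: "coeffs (scal c a) u = c * coeffs a u"
  by (simp add: scal_def coeffs_def mult_map_scale_conv_mult[symmetric] Poly_Mapping.map.rep_eq when_def)

text \<open>Writing \<open>u\<close> as a concatenation amounts to choosing a cut position, so the
  convolution over pairs of words collapses to the cuts used in
  \<open>free_star_algebra\<close>.\<close>

lemma coeffs_mult: "coeffs (a * b) u = (\<Sum>k\<le>length u. coeffs a (take k u) * coeffs b (drop k u))"
proof -
  have inner: "(\<Sum>q. Poly_Mapping.lookup b q when Word u = l + q) =
      (if prefix (letters l) u then coeffs b (drop (length (letters l)) u) else 0)" for l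
  proof -
    have "Word u = l + q \<longleftrightarrow> prefix (letters l) u \<and> q = Word (drop (length (letters l)) u)" for q
      by (cases q) (auto simp: plus_word_def prefix_def)
    then have "(\<Sum>q. Poly_Mapping.lookup b q when Word u = l + q) =
        (\<Sum>q. (Poly_Mapping.lookup b q when prefix (letters l) u) when q = Word (drop (length (letters l)) u))"
      by (intro Sum_any.cong) (simp add: when_def)
    then show ?thesis by (simp add: coeffs_def)
  qed
  let ?K = "(\<lambda>k. Word (take k u)) ` {..length u}"
  have inj: "inj_on (\<lambda>k. Word (take k u)) {..length u}"
    by (rule inj_on_inverseI[where g = "\<lambda>v. length (letters v)"]) simp
  have "coeffs (a * b) u = (\<Sum>l. Poly_Mapping.lookup a l *
      (if prefix (letters l) u then coeffs b (drop (length (letters l)) u) else 0))"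
    unfolding coeffs_def lookup_mult inner[unfolded coeffs_def] by (rule refl)
  also have "\<dots> = (\<Sum>l\<in>?K. Poly_Mapping.lookup a l *
      (if prefix (letters l) u then coeffs b (drop (length (letters l)) u) else 0))"
  proof (rule Sum_any.expand_superset)
    have "l \<in> ?K" if "prefix (letters l) u" for l
      using that by (intro image_eqI[of _ _ "length (letters l)"]) (cases l; auto simp: prefix_def)+
    then show "{l. Poly_Mapping.lookup a l *
        (if prefix (letters l) u then coeffs b (drop (length (letters l)) u) else 0) \<noteq> 0} \<subseteq> ?K"
      by (auto split: if_splits)
  qed simp
  also have "\<dots> = (\<Sum>k\<le>length u. coeffs a (take k u) * coeffs b (drop k u))"
    by (subst sum.reindex[OF inj]) (auto intro!: sum.cong simp: coeffs_def take_is_prefix)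
  finally show ?thesis .
qed

lemma star_add: "star (a + b) = star a + star b"
  and star_diff: "star (a - b) = star a - star b"
  and star_star [simp]: "star (star a) = a"
  and star_zero [simp]: "star 0 = 0"
  and star_scal: "star (scal c a) = scal (cnj c) (star a)"
  by (simp_all add: coeffs_inject[symmetric] fun_eq_iff coeffs_add coeffs_diff coeffs_star coeffs_zero coeffs_scal)

lemma star_mult: "star (a * b) = star b * star a"
proof -
  have "cnj (coeffs (a * b) (flip u)) = (\<Sum>k\<le>length u. cnj (coeffs b (flip (take k u))) * cnj (coeffs a (flip (drop k u))))"
    for u
  proof -
    have 1: "length (flip u) = length u" by (simp add: flip_def)
    have 2: "take (length u - k) (flip u) = flip (drop k u)" "drop (length u - k) (flip u) = flip (take k u)" for k
      by (simp_all add: flip_def take_rev drop_rev take_map drop_map)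
       (cases "k \<le> length u"; simp)+
    show ?thesis
      unfolding coeffs_mult 1 cnj_sum
      \<comment> \<open>Reversal moves the cut after \<open>k\<close> letters to the cut after
        \<open>length u - k\<close> letters.\<close>
      by (rule sum.reindex_bij_witness[of _ "\<lambda>k. length u - k" "\<lambda>k. length u - k"])
        (auto simp: 2[symmetric])
  qed
  then show ?thesis
    by (simp add: coeffs_inject[symmetric] fun_eq_iff coeffs_star) (simp add: coeffs_mult coeffs_star)
qed

lemma star_sum: "star (\<Sum>i\<in>I. f i) = (\<Sum>i\<in>I. star (f i))"
  by (induction I rule: infinite_finite_induct) (simp_all add: star_add)

lemma scal_mult_left: "scal c a * b = scal c (a * b)"
  by (simp add: scal_def mult.assoc)

lemma scal_mult_right: "a * scal c b = scal c (a * b)"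
  by (simp add: coeffs_inject[symmetric] fun_eq_iff coeffs_mult coeffs_scal sum_distrib_left algebra_simps)

lemma scal_add_left: "scal (c + d) a = scal c a + scal d a"
  and scal_diff: "scal c (a - b) = scal c a - scal c b"
  and scal_zero [simp]: "scal c 0 = 0" "scal 0 a = 0"
  and scal_one [simp]: "scal 1 a = a"
  and scal_scal: "scal c (scal d a) = scal (c * d) a"
  and scal_minus_one: "scal (- 1) a = - a"
  by (simp_all add: coeffs_inject[symmetric] fun_eq_iff coeffs_scal coeffs_add coeffs_diff coeffs_zero algebra_simps)
    (simp add: coeffs_def)

lemma FA_zero [simp]: "0 \<in> FA X"
  and FA_gen [simp]: "gen x \<in> FA X \<longleftrightarrow> x \<in> X"
  by (auto simp: FA_def coeffs_zero coeffs_gen)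

lemma FA_add [simp]: "a \<in> FA X \<Longrightarrow> b \<in> FA X \<Longrightarrow> a + b \<in> FA X"
  and FA_diff [simp]: "a \<in> FA X \<Longrightarrow> b \<in> FA X \<Longrightarrow> a - b \<in> FA X"
  unfolding FA_def mem_Collect_eq coeffs_add coeffs_diff by (metis add_0 diff_0_right)+

lemma FA_scal [simp]: "a \<in> FA X \<Longrightarrow> scal c a \<in> FA X"
  by (auto simp: FA_def coeffs_scal)

lemma FA_uminus [simp]: "a \<in> FA X \<Longrightarrow> - a \<in> FA X"
  using FA_scal[of a X "- 1"] by (simp add: scal_minus_one)

lemma FA_star [simp]: "a \<in> FA X \<Longrightarrow> star a \<in> FA X"
proof -
  have "fst ` set (flip u) = fst ` set u" "flip u = [] \<longleftrightarrow> u = []" for u :: "('g \<times> bool) list"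
    by (force simp: flip_def image_iff)+
  then show "a \<in> FA X \<Longrightarrow> star a \<in> FA X"
    unfolding FA_def mem_Collect_eq coeffs_star by (metis complex_cnj_zero)
qed

lemma FA_mult [simp]:
  assumes "a \<in> FA X" "b \<in> FA X"
  shows "a * b \<in> FA X"
  unfolding FA_def mem_Collect_eq
proof (intro allI impI)
  fix u assume "coeffs (a * b) u \<noteq> 0"
  then obtain k where "coeffs a (take k u) * coeffs b (drop k u) \<noteq> 0"
    unfolding coeffs_mult by (rule sum.not_neutral_contains_not_neutral)
  then have "coeffs a (take k u) \<noteq> 0" "coeffs b (drop k u) \<noteq> 0" by simp_all
  then have "take k u \<noteq> []" "fst ` set (take k u) \<subseteq> X" "fst ` set (drop k u) \<subseteq> X"
    using assms unfolding FA_def by blast+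
  moreover have "set u = set (take k u) \<union> set (drop k u)"
    by (metis append_take_drop_id set_append)
  ultimately show "u \<noteq> [] \<and> fst ` set u \<subseteq> X"
    by (auto simp del: set_append)
qed

lemma FA_sum [simp]: "(\<And>i. i \<in> I \<Longrightarrow> f i \<in> FA X) \<Longrightarrow> (\<Sum>i\<in>I. f i) \<in> FA X"
  by (induction I rule: infinite_finite_induct) simp_all

section \<open>Substitution homomorphisms between free *-algebras\<close>

definition letter_value :: "('g \<Rightarrow> 'h fsa) \<Rightarrow> 'g \<times> bool \<Rightarrow> 'h fsa" where
  "letter_value g = (\<lambda>(x, s). if s then star (g x) else g x)"

definition word_value :: "('g \<Rightarrow> 'h fsa) \<Rightarrow> 'g word \<Rightarrow> 'h fsa" where
  "word_value g k = prod_list (map (letter_value g) (letters k))"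

text \<open>The universal property of the free *-algebra, with values in another free *-algebra. It
  is a unital *-homomorphism on the whole type; generating sets matter only in
  \<open>subst_closed\<close>.\<close>

definition subst :: "('g \<Rightarrow> 'h fsa) \<Rightarrow> 'g fsa \<Rightarrow> 'h fsa" where
  "subst g a = (\<Sum>k\<in>Poly_Mapping.keys a. scal (Poly_Mapping.lookup a k) (word_value g k))"

lemma single_expansion: "a = (\<Sum>k\<in>Poly_Mapping.keys a. Poly_Mapping.single k (Poly_Mapping.lookup a k))"
proof (rule poly_mapping_eqI)
  fix k
  show "Poly_Mapping.lookup a k =
      Poly_Mapping.lookup (\<Sum>k\<in>Poly_Mapping.keys a. Poly_Mapping.single k (Poly_Mapping.lookup a k)) k"
    by (simp add: lookup_sum lookup_single when_def in_keys_iff)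
qed

lemma word_value_add: "word_value g (u + v) = word_value g u * word_value g v"
  by (simp add: word_value_def plus_word_def)

lemma star_one [simp]: "star 1 = 1"
  by (metis mult_1 mult_1_right star_mult star_star)

lemma word_value_flip: "word_value g (Word (flip u)) = star (word_value g (Word u))"
proof (induction u)
  case Nil
  then show ?case by (simp add: word_value_def flip_def)
next
  case (Cons l u)
  then show ?case
    by (cases l) (simp add: word_value_def flip_def star_mult letter_value_def)
qed

lemma subst_superset:
  assumes "finite K" "Poly_Mapping.keys a \<subseteq> K"
  shows "subst g a = (\<Sum>k\<in>K. scal (Poly_Mapping.lookup a k) (word_value g k))"
  unfolding subst_def
  by (rule sum.mono_neutral_left) (use assms in \<open>auto simp: in_keys_iff\<close>)

lemma subst_zero [simp]: "subst g 0 = 0"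
  by (simp add: subst_def)

lemma subst_add: "subst g (a + b) = subst g a + subst g b"
proof -
  let ?K = "Poly_Mapping.keys a \<union> Poly_Mapping.keys b"
  show ?thesis
    using keys_add[of a b] by (simp add: subst_superset[of ?K] lookup_add sum.distrib scal_add_left)
qed

lemma subst_diff: "subst g (a - b) = subst g a - subst g b"
  using subst_add[of g "a - b" b] by simp

lemma subst_sum: "subst g (\<Sum>i\<in>I. f i) = (\<Sum>i\<in>I. subst g (f i))"
  by (induction I rule: infinite_finite_induct) (simp_all add: subst_add)

lemma subst_single: "subst g (Poly_Mapping.single k c) = scal c (word_value g k)"
  by (simp add: subst_def)

lemma subst_mult: "subst g (a * b) = subst g a * subst g b"
proof -
  let ?s = "\<lambda>a k. Poly_Mapping.single k (Poly_Mapping.lookup a k)"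
  let ?A = "Poly_Mapping.keys a" and ?B = "Poly_Mapping.keys b"
  have "a * b = (\<Sum>k\<in>?A. ?s a k) * (\<Sum>l\<in>?B. ?s b l)"
    using single_expansion[of a] single_expansion[of b] by simp
  also have "\<dots> = (\<Sum>k\<in>?A. \<Sum>l\<in>?B. ?s a k * ?s b l)"
    by (simp add: sum_product)
  finally have "subst g (a * b) = (\<Sum>k\<in>?A. \<Sum>l\<in>?B.
      scal (Poly_Mapping.lookup a k * Poly_Mapping.lookup b l) (word_value g k * word_value g l))"
    by (simp add: subst_sum mult_single subst_single word_value_add)
  also have "\<dots> = subst g a * subst g b"
    by (simp add: subst_def sum_product scal_mult_left scal_mult_right scal_scal mult.commute)
  finally show ?thesis .
qed

lemma subst_scal: "subst g (scal c a) = scal c (subst g a)"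
proof -
  have "word_value g 0 = 1" by (simp add: word_value_def zero_word_def)
  then show ?thesis by (simp add: scal_def subst_mult subst_single)
qed

lemma subst_gen [simp]: "subst g (gen x) = g x"
  by (simp add: gen_def subst_single word_value_def letter_value_def)

lemma star_single: "star (Poly_Mapping.single k c) = Poly_Mapping.single (Word (flip (letters k))) (cnj c)"
  by (simp add: coeffs_inject[symmetric] fun_eq_iff coeffs_star)
    (auto simp: coeffs_def lookup_single when_def word.expand)

lemma subst_star: "subst g (star a) = star (subst g a)"
proof -
  let ?s = "\<lambda>k. Poly_Mapping.single k (Poly_Mapping.lookup a k)"
  have "subst g (star (\<Sum>k\<in>Poly_Mapping.keys a. ?s k)) = star (subst g (\<Sum>k\<in>Poly_Mapping.keys a. ?s k))"
    by (simp add: star_sum subst_sum star_single subst_single word_value_flip star_scal)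
  then show ?thesis using single_expansion[of a] by simp
qed

text \<open>Allows later proofs to argue by algebra operations instead of words: a letter is a
  generator or the adjoint of one, and a nonempty word is a product of letters.\<close>

lemma FA_induct [consumes 1, case_names gen zero add scal mult star]:
  assumes a: "a \<in> FA X"
    and P_gen: "\<And>x. x \<in> X \<Longrightarrow> P (gen x)"
    and P_zero: "P 0"
    and P_add: "\<And>a b. a \<in> FA X \<Longrightarrow> b \<in> FA X \<Longrightarrow> P a \<Longrightarrow> P b \<Longrightarrow> P (a + b)"
    and P_scal: "\<And>c a. a \<in> FA X \<Longrightarrow> P a \<Longrightarrow> P (scal c a)"
    and P_mult: "\<And>a b. a \<in> FA X \<Longrightarrow> b \<in> FA X \<Longrightarrow> P a \<Longrightarrow> P b \<Longrightarrow> P (a * b)"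
    and P_star: "\<And>a. a \<in> FA X \<Longrightarrow> P a \<Longrightarrow> P (star a)"
  shows "P a"
proof -
  let ?Q = "\<lambda>a. a \<in> FA X \<and> P a"
  have letter: "?Q (Poly_Mapping.single (Word [l]) 1)" if "fst l \<in> X" for l
  proof (cases "snd l")
    case True
    have "Poly_Mapping.single (Word [l]) 1 = star (gen (fst l))"
      using True by (cases l) (simp add: gen_def star_single flip_def)
    then show ?thesis using that P_gen P_star by simp
  next
    case False
    have "Poly_Mapping.single (Word [l]) 1 = gen (fst l)"
      using False by (cases l) (simp add: gen_def)
    then show ?thesis using that P_gen by simp
  qed
  have word: "?Q (Poly_Mapping.single (Word u) 1)" if "u \<noteq> []" "fst ` set u \<subseteq> X" for u
    using that
  proof (induction u rule: list_nonempty_induct)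
    case (single l)
    then show ?case using letter by simp
  next
    case (cons l u)
    have "Poly_Mapping.single (Word (l # u)) 1 =
        Poly_Mapping.single (Word [l]) 1 * Poly_Mapping.single (Word u) (1 :: complex)"
      by (simp add: mult_single plus_word_def)
    then show ?case using cons letter[of l] P_mult by simp
  qed
  have summand: "?Q (Poly_Mapping.single k (Poly_Mapping.lookup a k))" if "k \<in> Poly_Mapping.keys a" for k
  proof -
    have eq: "Poly_Mapping.single k (Poly_Mapping.lookup a k) = scal (Poly_Mapping.lookup a k) (Poly_Mapping.single k 1)"
      by (simp add: scal_def mult_single)
    have "letters k \<noteq> [] \<and> fst ` set (letters k) \<subseteq> X"
      using a that by (auto simp: FA_def coeffs_def in_keys_iff dest!: spec[of _ "letters k"])
    then have "?Q (Poly_Mapping.single k 1)"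
      using word[of "letters k"] by simp
    then show ?thesis unfolding eq using P_scal by simp
  qed
  have "?Q (\<Sum>k\<in>K. Poly_Mapping.single k (Poly_Mapping.lookup a k))"
    if "finite K" "K \<subseteq> Poly_Mapping.keys a" for K
    using that by (induction K rule: finite_induct) (simp_all add: P_zero P_add summand)
  then show ?thesis
    using single_expansion[of a] by (metis finite_keys order_refl)
qed

lemma subst_closed:
  assumes "\<And>x. x \<in> X \<Longrightarrow> g x \<in> FA Y" "a \<in> FA X"
  shows "subst g a \<in> FA Y"
  using assms(2) by (induction rule: FA_induct) (simp_all add: assms(1) subst_add subst_mult subst_scal subst_star)

section \<open>Transfer between \<open>FA X\<close> and \<open>free_star_algebra X\<close>\<close>

lemma free_star_algebra_simps [simp]:
  "\<zero>\<^bsub>free_star_algebra X\<^esub> = coeffs 0"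
  "coeffs a \<oplus>\<^bsub>free_star_algebra X\<^esub> coeffs b = coeffs (a + b)"
  "coeffs a \<otimes>\<^bsub>free_star_algebra X\<^esub> coeffs b = coeffs (a * b)"
  "c \<odot>\<^bsub>free_star_algebra X\<^esub> coeffs a = coeffs (scal c a)"
  "adj (free_star_algebra X) (coeffs a) = coeffs (star a)"
  by (simp_all add: free_star_algebra_def fun_eq_iff coeffs_zero coeffs_add coeffs_mult coeffs_scal coeffs_star flip_def)

lemma carrier_free_star_algebra: "carrier (free_star_algebra X) = coeffs ` FA X"
proof -
  have "coeffs a \<in> carrier (free_star_algebra X) \<longleftrightarrow> a \<in> FA X" for a
    by (simp add: free_star_algebra_def FA_def finite_coeffs)
  moreover have "\<exists>a. f = coeffs a" if "f \<in> carrier (free_star_algebra X)" for f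
    using that coeffs_surj[of f] by (auto simp: free_star_algebra_def)
  ultimately show ?thesis by blast
qed

lemma free_gen_eq: "free_gen x = coeffs (gen x)"
  by (simp add: free_gen_def coeffs_gen fun_eq_iff)

lemma abelian_group_free_star_algebra: "abelian_group (free_star_algebra X)"
proof (rule abelian_groupI)
  fix x assume "x \<in> carrier (free_star_algebra X)"
  then obtain a where a: "x = coeffs a" "a \<in> FA X" by (auto simp: carrier_free_star_algebra)
  have "scal (- 1) a \<in> FA X" "scal (- 1) a + a = 0"
    using a by (simp, simp add: scal_minus_one)
  then show "\<exists>y\<in>carrier (free_star_algebra X). y \<oplus>\<^bsub>free_star_algebra X\<^esub> x = \<zero>\<^bsub>free_star_algebra X\<^esub>"
    using a(1) by (intro bexI[of _ "coeffs (scal (- 1) a)"]) (simp_all add: carrier_free_star_algebra)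
qed (auto simp: carrier_free_star_algebra add_ac)

text \<open>The operation \<open>\<ominus>\<close> is defined through a description of the additive
  inverse; uniqueness of inverses identifies it with the pointwise difference.\<close>

lemma free_star_algebra_diff [simp]:
  assumes "a \<in> FA X" "b \<in> FA X"
  shows "coeffs a \<ominus>\<^bsub>free_star_algebra X\<^esub> coeffs b = coeffs (a - b)"
proof -
  interpret abelian_group "free_star_algebra X" by (rule abelian_group_free_star_algebra)
  have c: "coeffs c \<in> carrier (free_star_algebra X)" if "c \<in> FA X" for c
    using that by (simp add: carrier_free_star_algebra)
  have "- b \<in> FA X" using FA_scal[OF assms(2), of "- 1"] by (simp add: scal_minus_one)
  then have "\<ominus>\<^bsub>free_star_algebra X\<^esub> coeffs b = coeffs (- b)"
    using c assms by (intro minus_equality) auto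
  then show ?thesis by (simp add: a_minus_def)
qed

lemma free_star_algebra_finsum:
  assumes "\<And>i. i \<in> I \<Longrightarrow> f i \<in> FA X"
  shows "(\<Oplus>\<^bsub>free_star_algebra X\<^esub>i\<in>I. coeffs (f i)) = coeffs (\<Sum>i\<in>I. f i)"
proof -
  interpret abelian_group "free_star_algebra X" by (rule abelian_group_free_star_algebra)
  show ?thesis
    using assms
    by (induction I rule: infinite_finite_induct)
      (simp_all add: finsum_infinite Pi_def carrier_free_star_algebra)
qed

section \<open>Completions of free star algebras\<close>

locale free_cstar_seminorm =
  fixes X :: "'g set" and p :: "(('g \<times> bool) list \<Rightarrow> complex) \<Rightarrow> real"
  assumes seminorm: "cstar_seminorm (free_star_algebra X) p"
begin

abbreviation nm :: "'g fsa \<Rightarrow> real" where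
  "nm a \<equiv> p (coeffs a)"

lemma nm_nonneg: "a \<in> FA X \<Longrightarrow> 0 \<le> nm a"
  and nm_triangle: "a \<in> FA X \<Longrightarrow> b \<in> FA X \<Longrightarrow> nm (a + b) \<le> nm a + nm b"
  and nm_scal: "a \<in> FA X \<Longrightarrow> nm (scal c a) = cmod c * nm a"
  and nm_mult: "a \<in> FA X \<Longrightarrow> b \<in> FA X \<Longrightarrow> nm (a * b) \<le> nm a * nm b"
  and nm_star_mult: "a \<in> FA X \<Longrightarrow> nm (star a * a) = (nm a)\<^sup>2"
  using seminorm unfolding cstar_seminorm_def carrier_free_star_algebra by simp_all

lemma nm_zero [simp]: "nm 0 = 0"
  using nm_scal[OF FA_zero, of 0] by simp

lemma nm_diff_commute:
  assumes "a \<in> FA X" "b \<in> FA X"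
  shows "nm (a - b) = nm (b - a)"
proof -
  have "scal (- 1) (b - a) = a - b" by (simp add: scal_minus_one)
  then show ?thesis using nm_scal[of "b - a" "- 1"] assms by simp
qed

text \<open>Submultiplicativity and the C*-identity bound \<open>(nm b)\<^sup>2\<close> by
  \<open>nm (star b) * nm b\<close>, which gives one inequality; the other one is the same for the
  adjoint.\<close>

lemma nm_star:
  assumes "a \<in> FA X"
  shows "nm (star a) = nm a"
proof -
  have *: "nm b \<le> nm (star b)" if b: "b \<in> FA X" for b
  proof (cases "nm b = 0")
    case False
    then have "0 < nm b" using nm_nonneg[OF b] by simp
    moreover have "nm b * nm b \<le> nm (star b) * nm b"
      using nm_star_mult[OF b] nm_mult[of "star b" b] b by (simp add: power2_eq_square)
    ultimately show ?thesis by simp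
  qed (simp add: nm_nonneg b)
  show ?thesis using *[of a] *[of "star a"] assms by simp
qed

lemma nm_diff_triangle:
  assumes "a \<in> FA X" "b \<in> FA X" "c \<in> FA X"
  shows "nm (a - c) \<le> nm (a - b) + nm (b - c)"
  using nm_triangle[of "a - b" "b - c"] assms by simp

lemma nm_le_diff:
  assumes "a \<in> FA X" "b \<in> FA X"
  shows "nm a \<le> nm (a - b) + nm b"
  using nm_triangle[of "a - b" b] assms by simp

lemma nm_abs_diff:
  assumes "a \<in> FA X" "b \<in> FA X"
  shows "\<bar>nm a - nm b\<bar> \<le> nm (a - b)"
  using nm_le_diff[of a b] nm_le_diff[of b a] nm_diff_commute[of a b] assms by linarith

section \<open>Cauchy sequences and the operations on their classes\<close>

definition Cauchies :: "(nat \<Rightarrow> 'g fsa) set" where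
  "Cauchies = {Y. (\<forall>n. Y n \<in> FA X) \<and> (\<forall>\<epsilon>>0. \<exists>N. \<forall>m\<ge>N. \<forall>n\<ge>N. nm (Y m - Y n) < \<epsilon>)}"

definition cls :: "(nat \<Rightarrow> 'g fsa) \<Rightarrow> (nat \<Rightarrow> ('g \<times> bool) list \<Rightarrow> complex) set" where
  "cls Y = seq_class (free_star_algebra X) p (\<lambda>n. coeffs (Y n))"

abbreviation completion where
  "completion \<equiv> star_completion (free_star_algebra X) p"

lemma CauchiesD: "Y \<in> Cauchies \<Longrightarrow> Y n \<in> FA X"
  and Cauchies_bound: "Y \<in> Cauchies \<Longrightarrow> 0 < \<epsilon> \<Longrightarrow> \<exists>N. \<forall>m\<ge>N. \<forall>n\<ge>N. nm (Y m - Y n) < \<epsilon>"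
  by (simp_all add: Cauchies_def)

lemma cauchy_seqs_iff:
  "(\<lambda>n. coeffs (Y n)) \<in> cauchy_seqs (free_star_algebra X) p \<longleftrightarrow> Y \<in> Cauchies"
proof -
  have "coeffs (Y n) \<in> carrier (free_star_algebra X) \<longleftrightarrow> Y n \<in> FA X" for n
    by (auto simp: carrier_free_star_algebra coeffs_inject)
  then show ?thesis
    by (auto simp: cauchy_seqs_def Cauchies_def image_subset_iff)
qed

lemma cauchy_seqsE:
  assumes "f \<in> cauchy_seqs (free_star_algebra X) p"
  obtains Y where "Y \<in> Cauchies" "f = (\<lambda>n. coeffs (Y n))"
proof -
  have "\<forall>n. \<exists>a. f n = coeffs a"
    using assms by (auto simp: cauchy_seqs_def image_subset_iff carrier_free_star_algebra)
  then obtain Y where "f = (\<lambda>n. coeffs (Y n))" by metis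
  then show ?thesis using that assms cauchy_seqs_iff by blast
qed

lemma null_rel_iff:
  "((\<lambda>n. coeffs (Y n)), (\<lambda>n. coeffs (Z n))) \<in> null_rel (free_star_algebra X) p \<longleftrightarrow>
    Y \<in> Cauchies \<and> Z \<in> Cauchies \<and> (\<lambda>n. nm (Y n - Z n)) \<longlonglongrightarrow> 0"
  unfolding null_rel_def mem_Collect_eq case_prod_conv cauchy_seqs_iff
  using CauchiesD by auto

lemma null_sym:
  assumes "Y \<in> Cauchies" "Z \<in> Cauchies" "(\<lambda>n. nm (Y n - Z n)) \<longlonglongrightarrow> 0"
  shows "(\<lambda>n. nm (Z n - Y n)) \<longlonglongrightarrow> 0"
  using assms(3) nm_diff_commute[OF CauchiesD[OF assms(1)] CauchiesD[OF assms(2)]] by simp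

lemma null_trans:
  assumes "U \<in> Cauchies" "Y \<in> Cauchies" "Z \<in> Cauchies"
    and "(\<lambda>n. nm (U n - Y n)) \<longlonglongrightarrow> 0" "(\<lambda>n. nm (Y n - Z n)) \<longlonglongrightarrow> 0"
  shows "(\<lambda>n. nm (U n - Z n)) \<longlonglongrightarrow> 0"
proof (rule real_tendsto_sandwich[OF _ _ tendsto_const tendsto_add_zero[OF assms(4,5)]])
  show "\<forall>\<^sub>F n in sequentially. 0 \<le> nm (U n - Z n)"
    using assms CauchiesD[of U] CauchiesD[of Z] nm_nonneg by (intro always_eventually) simp
  show "\<forall>\<^sub>F n in sequentially. nm (U n - Z n) \<le> nm (U n - Y n) + nm (Y n - Z n)"
    using assms CauchiesD[of U] CauchiesD[of Y] CauchiesD[of Z] nm_diff_triangle by (intro always_eventually) simp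
qed

lemma equiv_null_rel: "equiv (cauchy_seqs (free_star_algebra X) p) (null_rel (free_star_algebra X) p)"
proof (rule equivI)
  show "null_rel (free_star_algebra X) p
      \<subseteq> cauchy_seqs (free_star_algebra X) p \<times> cauchy_seqs (free_star_algebra X) p"
    by (auto simp: null_rel_def)
  show "refl_on (cauchy_seqs (free_star_algebra X) p) (null_rel (free_star_algebra X) p)"
  proof (rule refl_onI)
    fix f assume "f \<in> cauchy_seqs (free_star_algebra X) p"
    then show "(f, f) \<in> null_rel (free_star_algebra X) p"
      by (elim cauchy_seqsE) (simp add: null_rel_iff)
  qed
  have cauchy: "f \<in> cauchy_seqs (free_star_algebra X) p" "g \<in> cauchy_seqs (free_star_algebra X) p"
    if "(f, g) \<in> null_rel (free_star_algebra X) p" for f g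
    using that by (auto simp: null_rel_def)
  show "sym (null_rel (free_star_algebra X) p)"
  proof (rule symI)
    fix f g assume fg: "(f, g) \<in> null_rel (free_star_algebra X) p"
    obtain Y Z where "Y \<in> Cauchies" "f = (\<lambda>n. coeffs (Y n))" "Z \<in> Cauchies" "g = (\<lambda>n. coeffs (Z n))"
      using cauchy[OF fg] cauchy_seqsE by metis
    then show "(g, f) \<in> null_rel (free_star_algebra X) p"
      using fg null_sym[of Y Z] by (simp add: null_rel_iff)
  qed
  show "trans (null_rel (free_star_algebra X) p)"
  proof (rule transI)
    fix f g h
    assume fg: "(f, g) \<in> null_rel (free_star_algebra X) p" and gh: "(g, h) \<in> null_rel (free_star_algebra X) p"
    obtain U where "U \<in> Cauchies" "f = (\<lambda>n. coeffs (U n))" using cauchy(1)[OF fg] cauchy_seqsE by metis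
    moreover obtain Y where "Y \<in> Cauchies" "g = (\<lambda>n. coeffs (Y n))" using cauchy(2)[OF fg] cauchy_seqsE by metis
    moreover obtain Z where "Z \<in> Cauchies" "h = (\<lambda>n. coeffs (Z n))" using cauchy(2)[OF gh] cauchy_seqsE by metis
    ultimately show "(f, h) \<in> null_rel (free_star_algebra X) p"
      using fg gh null_trans[of U Y Z] by (simp add: null_rel_iff)
  qed
qed

lemma cls_eq_iff:
  assumes "Y \<in> Cauchies" "Z \<in> Cauchies"
  shows "cls Y = cls Z \<longleftrightarrow> (\<lambda>n. nm (Y n - Z n)) \<longlonglongrightarrow> 0"
  using eq_equiv_class_iff[OF equiv_null_rel] assms
  by (simp add: cls_def seq_class_def cauchy_seqs_iff null_rel_iff)

lemma in_cls_iff: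
  assumes "Y \<in> Cauchies"
  shows "f \<in> cls Y \<longleftrightarrow> (\<exists>Z\<in>Cauchies. f = (\<lambda>n. coeffs (Z n)) \<and> cls Z = cls Y)"
proof
  assume f: "f \<in> cls Y"
  then have "f \<in> cauchy_seqs (free_star_algebra X) p"
    by (auto simp: cls_def seq_class_def null_rel_def)
  then obtain Z where Z: "Z \<in> Cauchies" "f = (\<lambda>n. coeffs (Z n))" by (rule cauchy_seqsE)
  then have "(\<lambda>n. nm (Y n - Z n)) \<longlonglongrightarrow> 0"
    using f by (simp add: cls_def seq_class_def null_rel_iff)
  then have "cls Y = cls Z" using Z(1) assms cls_eq_iff by blast
  then show "\<exists>Z\<in>Cauchies. f = (\<lambda>n. coeffs (Z n)) \<and> cls Z = cls Y"
    using Z by auto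
next
  assume "\<exists>Z\<in>Cauchies. f = (\<lambda>n. coeffs (Z n)) \<and> cls Z = cls Y"
  then obtain Z where Z: "Z \<in> Cauchies" "f = (\<lambda>n. coeffs (Z n))" "cls Y = cls Z" by metis
  then have "(\<lambda>n. nm (Y n - Z n)) \<longlonglongrightarrow> 0" using assms cls_eq_iff by blast
  then show "f \<in> cls Y"
    using Z assms by (simp add: cls_def seq_class_def null_rel_iff)
qed

lemma carrier_completion: "carrier completion = cls ` Cauchies"
proof -
  have "cauchy_seqs (free_star_algebra X) p = (\<lambda>Y n. coeffs (Y n)) ` Cauchies"
    using cauchy_seqs_iff by (auto elim: cauchy_seqsE)
  then show ?thesis
    by (auto simp: star_completion_def quotient_def cls_def seq_class_def)
qed

text \<open>The operations of the completion are unions over all representatives; once every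
  representative gives the same value, the union is that value. Nesting the rule treats two
  arguments.\<close>

lemma UN_cls:
  assumes "Y \<in> Cauchies" "\<And>Z. Z \<in> Cauchies \<Longrightarrow> cls Z = cls Y \<Longrightarrow> F (\<lambda>n. coeffs (Z n)) = T"
  shows "(\<Union>f\<in>cls Y. F f) = T"
proof -
  have "F f = T" if "f \<in> cls Y" for f
    using that assms by (auto simp: in_cls_iff)
  moreover have "(\<lambda>n. coeffs (Y n)) \<in> cls Y"
    using assms(1) by (auto simp: in_cls_iff)
  ultimately show ?thesis by blast
qed

lemma nm_convergent:
  assumes "Y \<in> Cauchies"
  shows "convergent (\<lambda>n. nm (Y n))"
proof -
  have "Cauchy (\<lambda>n. nm (Y n))"
  proof (rule metric_CauchyI)
    fix \<epsilon> :: real assume "0 < \<epsilon>"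
    then obtain N where "\<forall>m\<ge>N. \<forall>n\<ge>N. nm (Y m - Y n) < \<epsilon>" using Cauchies_bound[OF assms] by blast
    then have "\<forall>m\<ge>N. \<forall>n\<ge>N. \<bar>nm (Y m) - nm (Y n)\<bar> < \<epsilon>"
      using nm_abs_diff[OF CauchiesD[OF assms] CauchiesD[OF assms]] by (meson order_le_less_trans)
    then show "\<exists>N. \<forall>m\<ge>N. \<forall>n\<ge>N. dist (nm (Y m)) (nm (Y n)) < \<epsilon>"
      by (auto simp: dist_real_def)
  qed
  then show ?thesis by (simp add: Cauchy_convergent_iff)
qed

text \<open>The norm is defined through a representative picked by \<open>SOME\<close>; any other
  one has the same limit, since the difference is null.\<close>

lemma nrm_cls:
  assumes "Y \<in> Cauchies"
  shows "(\<lambda>n. nm (Y n)) \<longlonglongrightarrow> nrm completion (cls Y)"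
proof -
  have "(\<lambda>n. coeffs (Y n)) \<in> cls Y" using assms in_cls_iff by blast
  then have "\<exists>f. f \<in> cls Y" by blast
  then have "(SOME f. f \<in> cls Y) \<in> cls Y" by (rule someI_ex)
  then obtain Z where Z: "Z \<in> Cauchies" "(SOME f. f \<in> cls Y) = (\<lambda>n. coeffs (Z n))" "cls Z = cls Y"
    using assms in_cls_iff by blast
  have null: "(\<lambda>n. nm (Y n - Z n)) \<longlonglongrightarrow> 0"
    using cls_eq_iff[OF assms Z(1)] Z(3) by simp
  have "(\<lambda>n. nm (Y n) - nm (Z n)) \<longlonglongrightarrow> 0"
  proof (rule tendsto_0_le[OF null])
    have "norm (nm (Y n) - nm (Z n)) \<le> norm (nm (Y n - Z n)) * 1" for n
      using nm_abs_diff[OF CauchiesD[OF assms, of n] CauchiesD[OF Z(1), of n]] by simp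
    then show "\<forall>\<^sub>F n in sequentially. norm (nm (Y n) - nm (Z n)) \<le> norm (nm (Y n - Z n)) * 1"
      by simp
  qed
  moreover have "(\<lambda>n. nm (Z n)) \<longlonglongrightarrow> nrm completion (cls Y)"
    using nm_convergent[OF Z(1)] by (simp add: star_completion_def Z(2) convergent_LIMSEQ_iff)
  ultimately show ?thesis
    using tendsto_add[of "\<lambda>n. nm (Y n) - nm (Z n)" 0 sequentially "\<lambda>n. nm (Z n)"] by simp
qed

lemma Cauchies_const: "a \<in> FA X \<Longrightarrow> (\<lambda>n. a) \<in> Cauchies"
  by (simp add: Cauchies_def)

text \<open>One criterion for all operations: two input sequences cover sums and products, and unary
  operations take \<open>Y = Z\<close>.\<close>

lemma Cauchies_lipschitz:
  assumes Y: "Y \<in> Cauchies" and Z: "Z \<in> Cauchies" and K: "0 < K"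
    and U: "\<And>n. U n \<in> FA X"
    and le: "\<And>m n. nm (U m - U n) \<le> K * (nm (Y m - Y n) + nm (Z m - Z n))"
  shows "U \<in> Cauchies"
  unfolding Cauchies_def mem_Collect_eq
proof (intro conjI allI impI)
  fix \<epsilon> :: real assume "0 < \<epsilon>"
  then have \<epsilon>: "0 < \<epsilon> / (2 * K)" using K by simp
  obtain N1 where N1: "\<And>m n. N1 \<le> m \<Longrightarrow> N1 \<le> n \<Longrightarrow> nm (Y m - Y n) < \<epsilon> / (2 * K)"
    using Cauchies_bound[OF Y \<epsilon>] by blast
  obtain N2 where N2: "\<And>m n. N2 \<le> m \<Longrightarrow> N2 \<le> n \<Longrightarrow> nm (Z m - Z n) < \<epsilon> / (2 * K)"
    using Cauchies_bound[OF Z \<epsilon>] by blast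
  have "nm (U m - U n) < \<epsilon>" if "max N1 N2 \<le> m" "max N1 N2 \<le> n" for m n
  proof -
    have "nm (U m - U n) \<le> K * (nm (Y m - Y n) + nm (Z m - Z n))" by (rule le)
    also have "\<dots> < K * (\<epsilon> / (2 * K) + \<epsilon> / (2 * K))"
      using N1[of m n] N2[of m n] that K by (intro mult_strict_left_mono add_strict_mono) auto
    also have "\<dots> = \<epsilon>" using K by (simp add: field_simps)
    finally show ?thesis .
  qed
  then show "\<exists>N. \<forall>m\<ge>N. \<forall>n\<ge>N. nm (U m - U n) < \<epsilon>" by blast
qed (rule U)

lemma nm_add_diff:
  assumes "a \<in> FA X" "b \<in> FA X" "c \<in> FA X" "d \<in> FA X"
  shows "nm ((a + b) - (c + d)) \<le> nm (a - c) + nm (b - d)"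
  using nm_triangle[of "a - c" "b - d"] assms by (simp add: algebra_simps)

lemma nm_mult_diff:
  assumes "a \<in> FA X" "b \<in> FA X" "c \<in> FA X" "d \<in> FA X"
  shows "nm (a * b - c * d) \<le> nm (a - c) * nm b + nm c * nm (b - d)"
proof -
  have "a * b - c * d = (a - c) * b + c * (b - d)" by (simp add: algebra_simps)
  then have "nm (a * b - c * d) \<le> nm ((a - c) * b) + nm (c * (b - d))"
    using nm_triangle[of "(a - c) * b" "c * (b - d)"] assms by simp
  also have "\<dots> \<le> nm (a - c) * nm b + nm c * nm (b - d)"
    using assms by (intro add_mono nm_mult) simp_all
  finally show ?thesis .
qed

lemma nm_scal_diff: "a \<in> FA X \<Longrightarrow> b \<in> FA X \<Longrightarrow> nm (scal c a - scal c b) = cmod c * nm (a - b)"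
  by (simp add: scal_diff[symmetric] nm_scal)

lemma nm_star_diff: "a \<in> FA X \<Longrightarrow> b \<in> FA X \<Longrightarrow> nm (star a - star b) = nm (a - b)"
  by (simp add: star_diff[symmetric] nm_star)

lemma Cauchies_bounded:
  assumes "Y \<in> Cauchies"
  obtains B where "0 < B" "\<forall>n. nm (Y n) \<le> B"
proof -
  have "Bseq (\<lambda>n. nm (Y n))" using nm_convergent[OF assms] by (rule convergent_imp_Bseq)
  then obtain B where B: "0 < B" "\<forall>n. norm (nm (Y n)) \<le> B" by (auto simp: Bseq_def)
  then have "\<forall>n. nm (Y n) \<le> B" by (simp add: abs_le_iff)
  then show ?thesis using that B(1) by blast
qed

lemma Cauchies_add: "Y \<in> Cauchies \<Longrightarrow> Z \<in> Cauchies \<Longrightarrow> (\<lambda>n. Y n + Z n) \<in> Cauchies"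
  by (rule Cauchies_lipschitz[of Y Z 1]) (auto simp: CauchiesD[of Y] CauchiesD[of Z] intro!: nm_add_diff)

lemma Cauchies_scal: "Y \<in> Cauchies \<Longrightarrow> (\<lambda>n. scal c (Y n)) \<in> Cauchies"
\<comment> \<open>The summand \<open>1\<close> keeps the constant positive when
  \<open>c = 0\<close>.\<close>
proof (rule Cauchies_lipschitz[of Y Y "cmod c + 1"])
  fix m n assume "Y \<in> Cauchies"
  then have "0 \<le> nm (Y m - Y n)" using CauchiesD[of Y] nm_nonneg by simp
  then show "nm (scal c (Y m) - scal c (Y n)) \<le> (cmod c + 1) * (nm (Y m - Y n) + nm (Y m - Y n))"
    using \<open>Y \<in> Cauchies\<close> by (simp add: nm_scal_diff CauchiesD[of Y] algebra_simps)
qed (auto simp: CauchiesD[of Y] add_nonneg_pos)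

lemma Cauchies_star: "Y \<in> Cauchies \<Longrightarrow> (\<lambda>n. star (Y n)) \<in> Cauchies"
  by (rule Cauchies_lipschitz[of Y Y 1]) (auto simp: CauchiesD[of Y] nm_star_diff nm_nonneg)

lemma Cauchies_diff: "Y \<in> Cauchies \<Longrightarrow> Z \<in> Cauchies \<Longrightarrow> (\<lambda>n. Y n - Z n) \<in> Cauchies"
  using Cauchies_add[of Y "\<lambda>n. scal (- 1) (Z n)"] Cauchies_scal[of Z "- 1"] by (simp add: scal_minus_one)

lemma Cauchies_mult:
  assumes "Y \<in> Cauchies" "Z \<in> Cauchies"
  shows "(\<lambda>n. Y n * Z n) \<in> Cauchies"
proof -
  obtain B where B: "0 < B" "\<forall>n. nm (Y n) \<le> B" using Cauchies_bounded[OF assms(1)] by blast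
  obtain B' where B': "0 < B'" "\<forall>n. nm (Z n) \<le> B'" using Cauchies_bounded[OF assms(2)] by blast
  \<comment> \<open>The constant \<open>B + B'\<close> dominates both coefficients in
    \<open>nm_mult_diff\<close>, which are norms of terms of \<open>Z\<close> and of
    \<open>Y\<close>.\<close>
  have "nm (Y m * Z m - Y n * Z n) \<le> (B + B') * (nm (Y m - Y n) + nm (Z m - Z n))" for m n
  proof -
    have nonneg: "0 \<le> nm (Y m - Y n)" "0 \<le> nm (Z m - Z n)"
      using assms CauchiesD[of Y] CauchiesD[of Z] nm_nonneg by simp_all
    have "nm (Y m * Z m - Y n * Z n) \<le> nm (Y m - Y n) * nm (Z m) + nm (Y n) * nm (Z m - Z n)"
      using assms CauchiesD[of Y] CauchiesD[of Z] nm_mult_diff by simp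
    also have "\<dots> \<le> nm (Y m - Y n) * B' + B * nm (Z m - Z n)"
      using nonneg B B' by (intro add_mono mult_left_mono mult_right_mono) simp_all
    also have "\<dots> \<le> (B + B') * (nm (Y m - Y n) + nm (Z m - Z n))"
      using nonneg B(1) B'(1) by (simp add: algebra_simps)
    finally show ?thesis .
  qed
  then show ?thesis
    using assms B(1) B'(1)
    by (intro Cauchies_lipschitz[OF assms, of "B + B'"]) (simp_all add: CauchiesD[of Y] CauchiesD[of Z])
qed

lemma null_bound:
  assumes "\<And>n. U n \<in> FA X" "\<And>n. nm (U n) \<le> f n" "f \<longlonglongrightarrow> 0"
  shows "(\<lambda>n. nm (U n)) \<longlonglongrightarrow> 0"
  by (rule real_tendsto_sandwich[OF _ _ tendsto_const assms(3)]) (use assms nm_nonneg in auto)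

lemma cls_add:
  assumes "Y \<in> Cauchies" "Z \<in> Cauchies"
  shows "cls Y \<oplus>\<^bsub>completion\<^esub> cls Z = cls (\<lambda>n. Y n + Z n)"
proof -
  have "cls (\<lambda>n. Y' n + Z' n) = cls (\<lambda>n. Y n + Z n)"
    if "Y' \<in> Cauchies" "cls Y' = cls Y" "Z' \<in> Cauchies" "cls Z' = cls Z" for Y' Z'
  proof -
    have "(\<lambda>n. nm (Y' n - Y n)) \<longlonglongrightarrow> 0" "(\<lambda>n. nm (Z' n - Z n)) \<longlonglongrightarrow> 0"
      using cls_eq_iff[OF that(1) assms(1)] cls_eq_iff[OF that(3) assms(2)] that(2,4) by simp_all
    then have "(\<lambda>n. nm (Y' n - Y n) + nm (Z' n - Z n)) \<longlonglongrightarrow> 0" by (rule tendsto_add_zero)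
    then have "(\<lambda>n. nm ((Y' n + Z' n) - (Y n + Z n))) \<longlonglongrightarrow> 0"
      by (rule null_bound[rotated 2]) (use that assms CauchiesD[of Y] CauchiesD[of Z] CauchiesD[of Y'] CauchiesD[of Z'] nm_add_diff in simp_all)
    then show ?thesis using that assms by (simp add: cls_eq_iff Cauchies_add)
  qed
  then have "(\<Union>f\<in>cls Y. \<Union>g\<in>cls Z. seq_class (free_star_algebra X) p
      (\<lambda>n. f n \<oplus>\<^bsub>free_star_algebra X\<^esub> g n)) = cls (\<lambda>n. Y n + Z n)"
    by (intro UN_cls assms) (simp flip: cls_def)
  then show ?thesis by (simp add: star_completion_def)
qed

lemma cls_mult:
  assumes "Y \<in> Cauchies" "Z \<in> Cauchies"
  shows "cls Y \<otimes>\<^bsub>completion\<^esub> cls Z = cls (\<lambda>n. Y n * Z n)"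
proof -
  have "cls (\<lambda>n. Y' n * Z' n) = cls (\<lambda>n. Y n * Z n)"
    if "Y' \<in> Cauchies" "cls Y' = cls Y" "Z' \<in> Cauchies" "cls Z' = cls Z" for Y' Z'
  proof -
    have null: "(\<lambda>n. nm (Y' n - Y n)) \<longlonglongrightarrow> 0" "(\<lambda>n. nm (Z' n - Z n)) \<longlonglongrightarrow> 0"
      using cls_eq_iff[OF that(1) assms(1)] cls_eq_iff[OF that(3) assms(2)] that(2,4) by simp_all
    have "(\<lambda>n. nm (Y' n - Y n) * nm (Z' n) + nm (Y n) * nm (Z' n - Z n)) \<longlonglongrightarrow>
        0 * nrm completion (cls Z') + nrm completion (cls Y) * 0"
      by (intro tendsto_intros null nrm_cls that assms)
    then have lim: "(\<lambda>n. nm (Y' n - Y n) * nm (Z' n) + nm (Y n) * nm (Z' n - Z n)) \<longlonglongrightarrow> 0" by simp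
    have "(\<lambda>n. nm (Y' n * Z' n - Y n * Z n)) \<longlonglongrightarrow> 0"
      by (rule null_bound[OF _ _ lim]) (use that assms CauchiesD[of Y] CauchiesD[of Z] CauchiesD[of Y'] CauchiesD[of Z'] nm_mult_diff in simp_all)
    then show ?thesis using that assms by (simp add: cls_eq_iff Cauchies_mult)
  qed
  then have "(\<Union>f\<in>cls Y. \<Union>g\<in>cls Z. seq_class (free_star_algebra X) p
      (\<lambda>n. f n \<otimes>\<^bsub>free_star_algebra X\<^esub> g n)) = cls (\<lambda>n. Y n * Z n)"
    by (intro UN_cls assms) (simp flip: cls_def)
  then show ?thesis by (simp add: star_completion_def)
qed

lemma cls_scal:
  assumes "Y \<in> Cauchies"
  shows "c \<odot>\<^bsub>completion\<^esub> cls Y = cls (\<lambda>n. scal c (Y n))"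
proof -
  have "cls (\<lambda>n. scal c (Y' n)) = cls (\<lambda>n. scal c (Y n))" if "Y' \<in> Cauchies" "cls Y' = cls Y" for Y'
  proof -
    have "(\<lambda>n. nm (Y' n - Y n)) \<longlonglongrightarrow> 0" using cls_eq_iff[OF that(1) assms] that(2) by simp
    then have "(\<lambda>n. nm (scal c (Y' n) - scal c (Y n))) \<longlonglongrightarrow> 0"
      using that assms by (simp add: nm_scal_diff CauchiesD[of Y] CauchiesD[of Y'] tendsto_mult_right_zero)
    then show ?thesis using that assms by (simp add: cls_eq_iff Cauchies_scal)
  qed
  then have "(\<Union>f\<in>cls Y. seq_class (free_star_algebra X) p (\<lambda>n. c \<odot>\<^bsub>free_star_algebra X\<^esub> f n)) = cls (\<lambda>n. scal c (Y n))"
    by (intro UN_cls assms) (simp flip: cls_def)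
  then show ?thesis by (simp add: star_completion_def)
qed

lemma cls_star:
  assumes "Y \<in> Cauchies"
  shows "adj completion (cls Y) = cls (\<lambda>n. star (Y n))"
proof -
  have "cls (\<lambda>n. star (Y' n)) = cls (\<lambda>n. star (Y n))" if "Y' \<in> Cauchies" "cls Y' = cls Y" for Y'
  proof -
    have "(\<lambda>n. nm (Y' n - Y n)) \<longlonglongrightarrow> 0" using cls_eq_iff[OF that(1) assms] that(2) by simp
    then have "(\<lambda>n. nm (star (Y' n) - star (Y n))) \<longlonglongrightarrow> 0"
      using that assms by (simp add: nm_star_diff CauchiesD[of Y] CauchiesD[of Y'])
    then show ?thesis using that assms by (simp add: cls_eq_iff Cauchies_star)
  qed
  then have "(\<Union>f\<in>cls Y. seq_class (free_star_algebra X) p (\<lambda>n. adj (free_star_algebra X) (f n))) = cls (\<lambda>n. star (Y n))"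
    by (intro UN_cls assms) (simp flip: cls_def)
  then show ?thesis by (simp add: star_completion_def)
qed

lemma zero_completion: "\<zero>\<^bsub>completion\<^esub> = cls (\<lambda>n. 0)"
  by (simp add: star_completion_def cls_def)

lemma abelian_monoid_completion: "abelian_monoid completion"
  by (rule abelian_monoidI)
    (auto simp: carrier_completion cls_add Cauchies_add zero_completion Cauchies_const add_ac)

text \<open>The canonical map into the completion. It identifies exactly the elements whose
  difference has seminorm \<open>0\<close>, so congruences in the free algebra become
  equations.\<close>

definition cst :: "'g fsa \<Rightarrow> (nat \<Rightarrow> ('g \<times> bool) list \<Rightarrow> complex) set" where
  "cst a = cls (\<lambda>n. a)"

lemma cst_closed: "a \<in> FA X \<Longrightarrow> cst a \<in> carrier completion"
  by (auto simp: cst_def carrier_completion Cauchies_const)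

lemma cst_eq_iff: "a \<in> FA X \<Longrightarrow> b \<in> FA X \<Longrightarrow> cst a = cst b \<longleftrightarrow> nm (a - b) = 0"
  unfolding cst_def by (simp add: cls_eq_iff Cauchies_const LIMSEQ_const_iff)

lemma cst_add: "a \<in> FA X \<Longrightarrow> b \<in> FA X \<Longrightarrow> cst a \<oplus>\<^bsub>completion\<^esub> cst b = cst (a + b)"
  and cst_mult: "a \<in> FA X \<Longrightarrow> b \<in> FA X \<Longrightarrow> cst a \<otimes>\<^bsub>completion\<^esub> cst b = cst (a * b)"
  and cst_scal: "a \<in> FA X \<Longrightarrow> c \<odot>\<^bsub>completion\<^esub> cst a = cst (scal c a)"
  and cst_star: "a \<in> FA X \<Longrightarrow> adj completion (cst a) = cst (star a)"
  and cst_zero: "cst 0 = \<zero>\<^bsub>completion\<^esub>"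
  by (simp_all add: cst_def cls_add cls_mult cls_scal cls_star zero_completion Cauchies_const)

lemma cst_sum:
  assumes "\<And>i. i \<in> I \<Longrightarrow> f i \<in> FA X"
  shows "(\<Oplus>\<^bsub>completion\<^esub>i\<in>I. cst (f i)) = cst (\<Sum>i\<in>I. f i)"
proof -
  interpret abelian_monoid completion by (rule abelian_monoid_completion)
  show ?thesis
    using assms
    by (induction I rule: infinite_finite_induct)
      (simp_all add: finsum_infinite cst_zero cst_closed cst_add Pi_def)
qed

end

lemma star_homD:
  assumes "star_hom A B h" "x \<in> carrier A"
  shows "h x \<in> carrier B"
    and "y \<in> carrier A \<Longrightarrow> h (x \<oplus>\<^bsub>A\<^esub> y) = h x \<oplus>\<^bsub>B\<^esub> h y"
    and "y \<in> carrier A \<Longrightarrow> h (x \<otimes>\<^bsub>A\<^esub> y) = h x \<otimes>\<^bsub>B\<^esub> h y"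
    and "h (c \<odot>\<^bsub>A\<^esub> x) = c \<odot>\<^bsub>B\<^esub> h x"
    and "h (adj A x) = adj B (h x)"
    and "nrm B (h x) \<le> nrm A x"
  using assms unfolding star_hom_def by auto

lemma star_hom_id: "star_hom A A (\<lambda>x. x)"
  by (simp add: star_hom_def)

lemma star_hom_comp:
  assumes h: "star_hom A B h" and k: "star_hom B D k"
  shows "star_hom A D (\<lambda>x. k (h x))"
  unfolding star_hom_def
proof (intro conjI ballI allI funcsetI)
  fix x assume x: "x \<in> carrier A"
  note hx = star_homD[OF h x] and khx = star_homD[OF k star_homD(1)[OF h x]]
  show "k (h x) \<in> carrier D" by (rule khx)
  show "k (h (c \<odot>\<^bsub>A\<^esub> x)) = c \<odot>\<^bsub>D\<^esub> k (h x)" for c by (simp only: hx(4) khx(4))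
  show "k (h (adj A x)) = adj D (k (h x))" by (simp only: hx(5) khx(5))
  show "nrm D (k (h x)) \<le> nrm A x" using hx(6) khx(6) by (rule order_trans[rotated])
  fix y assume y: "y \<in> carrier A"
  note hy = star_homD(1)[OF h y]
  show "k (h (x \<oplus>\<^bsub>A\<^esub> y)) = k (h x) \<oplus>\<^bsub>D\<^esub> k (h y)" by (simp only: hx(2)[OF y] khx(2)[OF hy])
  show "k (h (x \<otimes>\<^bsub>A\<^esub> y)) = k (h x) \<otimes>\<^bsub>D\<^esub> k (h y)" by (simp only: hx(3)[OF y] khx(3)[OF hy])
qed

section \<open>Contractive *-homomorphisms between completions\<close>

locale free_cstar_seminorm_pair =
  A: free_cstar_seminorm X p + B: free_cstar_seminorm Y q
  for X :: "'g set" and p and Y :: "'h set" and q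
begin

text \<open>The extension applies \<open>subst g\<close> termwise to a chosen representative. The
  bound \<open>le\<close> makes the image sequence Cauchy, its class independent of the choice and
  the result contractive; the algebraic identities already hold term by term.\<close>

lemma star_hom_extension:
  assumes closed: "\<And>x. x \<in> X \<Longrightarrow> g x \<in> FA Y"
    and le: "\<And>a. a \<in> FA X \<Longrightarrow> B.nm (subst g a) \<le> A.nm a"
  obtains h where "h \<in> extensional (carrier A.completion)"
    and "star_hom A.completion B.completion h"
    and "\<And>a. a \<in> FA X \<Longrightarrow> h (A.cst a) = B.cst (subst g a)"
proof -
  let ?\<theta> = "\<lambda>Z n. subst g (Z n)"
  define rep where "rep P = (SOME Z. Z \<in> A.Cauchies \<and> A.cls Z = P)" for P
  define h where "h = restrict (\<lambda>P. B.cls (?\<theta> (rep P))) (carrier A.completion)"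
  have \<theta>_FA: "subst g a \<in> FA Y" if "a \<in> FA X" for a
    using subst_closed[of X g Y] closed that by blast
  have \<theta>: "?\<theta> Z \<in> B.Cauchies" if Z: "Z \<in> A.Cauchies" for Z
    unfolding B.Cauchies_def mem_Collect_eq
  proof (intro conjI allI impI)
    show "subst g (Z n) \<in> FA Y" for n using \<theta>_FA A.CauchiesD[OF Z] .
    fix \<epsilon> :: real assume "0 < \<epsilon>"
    then obtain N where N: "\<forall>m\<ge>N. \<forall>n\<ge>N. A.nm (Z m - Z n) < \<epsilon>" using A.Cauchies_bound[OF Z] by blast
    have "B.nm (subst g (Z m) - subst g (Z n)) \<le> A.nm (Z m - Z n)" for m n
      using le[of "Z m - Z n"] A.CauchiesD[OF Z] by (simp add: subst_diff)
    then show "\<exists>N. \<forall>m\<ge>N. \<forall>n\<ge>N. B.nm (subst g (Z m) - subst g (Z n)) < \<epsilon>"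
      using N order_le_less_trans by meson
  qed
  have h_cls: "h (A.cls Z) = B.cls (?\<theta> Z)" if Z: "Z \<in> A.Cauchies" for Z
  proof -
    have "\<exists>W. W \<in> A.Cauchies \<and> A.cls W = A.cls Z" using Z by blast
    then have rep: "rep (A.cls Z) \<in> A.Cauchies" "A.cls (rep (A.cls Z)) = A.cls Z"
      unfolding rep_def by (metis (mono_tags, lifting) someI_ex)+
    then have "(\<lambda>n. A.nm (rep (A.cls Z) n - Z n)) \<longlonglongrightarrow> 0"
      using A.cls_eq_iff[OF rep(1) Z] by simp
    then have "(\<lambda>n. B.nm (?\<theta> (rep (A.cls Z)) n - ?\<theta> Z n)) \<longlonglongrightarrow> 0"
    proof (rule B.null_bound[rotated 2])
      fix n
      note in_FA = A.CauchiesD[OF rep(1), of n] A.CauchiesD[OF Z, of n]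
      show "?\<theta> (rep (A.cls Z)) n - ?\<theta> Z n \<in> FA Y"
        using in_FA \<theta>_FA by simp
      show "B.nm (?\<theta> (rep (A.cls Z)) n - ?\<theta> Z n) \<le> A.nm (rep (A.cls Z) n - Z n)"
        using le[of "rep (A.cls Z) n - Z n"] in_FA by (simp add: subst_diff)
    qed
    then show ?thesis
      using Z B.cls_eq_iff[OF \<theta>[OF rep(1)] \<theta>[OF Z]] by (simp add: h_def A.carrier_completion)
  qed
  have "star_hom A.completion B.completion h"
    unfolding star_hom_def
  proof (intro conjI ballI allI funcsetI)
    fix P assume "P \<in> carrier A.completion"
    then obtain Z where Z: "Z \<in> A.Cauchies" "P = A.cls Z" by (auto simp: A.carrier_completion)
    show "h P \<in> carrier B.completion"
      using Z \<theta> by (simp add: h_cls B.carrier_completion)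
    show "h (c \<odot>\<^bsub>A.completion\<^esub> P) = c \<odot>\<^bsub>B.completion\<^esub> h P" for c
      using Z \<theta> by (simp add: A.cls_scal h_cls B.cls_scal A.Cauchies_scal subst_scal)
    show "h (adj A.completion P) = adj B.completion (h P)"
      using Z \<theta> by (simp add: A.cls_star h_cls B.cls_star A.Cauchies_star subst_star)
    show "nrm B.completion (h P) \<le> nrm A.completion P"
      using B.nrm_cls[OF \<theta>[OF Z(1)]] A.nrm_cls[OF Z(1)] le A.CauchiesD[OF Z(1)]
      by (simp add: Z h_cls LIMSEQ_le)
    fix Q assume "Q \<in> carrier A.completion"
    then obtain W where W: "W \<in> A.Cauchies" "Q = A.cls W" by (auto simp: A.carrier_completion)
    show "h (P \<oplus>\<^bsub>A.completion\<^esub> Q) = h P \<oplus>\<^bsub>B.completion\<^esub> h Q"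
      using Z W \<theta> by (simp add: A.cls_add h_cls B.cls_add A.Cauchies_add subst_add)
    show "h (P \<otimes>\<^bsub>A.completion\<^esub> Q) = h P \<otimes>\<^bsub>B.completion\<^esub> h Q"
      using Z W \<theta> by (simp add: A.cls_mult h_cls B.cls_mult A.Cauchies_mult subst_mult)
  qed
  moreover have "h \<in> extensional (carrier A.completion)" by (simp add: h_def)
  moreover have "h (A.cst a) = B.cst (subst g a)" if "a \<in> FA X" for a
    using h_cls[OF A.Cauchies_const[OF that]] by (simp add: A.cst_def B.cst_def)
  ultimately show ?thesis using that by blast
qed

lemma star_hom_eq_on_cst:
  assumes h: "star_hom A.completion B.completion h" and k: "star_hom A.completion B.completion k"
    and gens: "\<And>x. x \<in> X \<Longrightarrow> h (A.cst (gen x)) = k (A.cst (gen x))"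
    and a: "a \<in> FA X"
  shows "h (A.cst a) = k (A.cst a)"
  using a
proof (induction rule: FA_induct)
  case zero
  \<comment> \<open>Zero is not among the clauses of \<open>star_hom\<close>; compatibility with the
    scalar \<open>0\<close> supplies it.\<close>
  have "f (A.cst 0) = B.cls (\<lambda>n. 0)" if f: "star_hom A.completion B.completion f" for f
  proof -
    have "f (A.cst 0) \<in> carrier B.completion"
      using f A.cst_closed[OF FA_zero] by (rule star_homD)
    then obtain Z where Z: "Z \<in> B.Cauchies" "f (A.cst 0) = B.cls Z" by (auto simp: B.carrier_completion)
    have "f (0 \<odot>\<^bsub>A.completion\<^esub> A.cst 0) = 0 \<odot>\<^bsub>B.completion\<^esub> f (A.cst 0)"
      using f A.cst_closed[OF FA_zero] by (rule star_homD)
    then show ?thesis using Z by (simp add: A.cst_scal B.cls_scal)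
  qed
  then show ?case using h k by metis
next
  case (add a b)
  then show ?case
    using star_homD(2)[OF h A.cst_closed A.cst_closed] star_homD(2)[OF k A.cst_closed A.cst_closed]
    by (simp flip: A.cst_add)
next
  case (scal c a)
  then show ?case
    using star_homD(4)[OF h A.cst_closed] star_homD(4)[OF k A.cst_closed] by (simp flip: A.cst_scal)
next
  case (mult a b)
  then show ?case
    using star_homD(3)[OF h A.cst_closed A.cst_closed] star_homD(3)[OF k A.cst_closed A.cst_closed]
    by (simp flip: A.cst_mult)
next
  case (star a)
  then show ?case
    using star_homD(5)[OF h A.cst_closed] star_homD(5)[OF k A.cst_closed] by (simp flip: A.cst_star)
qed (rule gens)

text \<open>Density: \<open>P\<close> is within \<open>\<epsilon>\<close> of some constant class,
  where \<open>h\<close> and \<open>k\<close> agree, and both are contractive, so the two images of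
  \<open>P\<close> differ by at most \<open>2\<epsilon>\<close>. The estimate is carried out on
  representing sequences.\<close>

lemma star_hom_eqI:
  assumes h: "star_hom A.completion B.completion h" and k: "star_hom A.completion B.completion k"
    and gens: "\<And>x. x \<in> X \<Longrightarrow> h (A.cst (gen x)) = k (A.cst (gen x))"
    and P: "P \<in> carrier A.completion"
  shows "h P = k P"
proof -
  obtain Z where Z: "Z \<in> A.Cauchies" "P = A.cls Z" using P by (auto simp: A.carrier_completion)
  have rep: "\<exists>W\<in>B.Cauchies. f Q = B.cls W"
    if "star_hom A.completion B.completion f" "Q \<in> carrier A.completion" for f Q
  proof -
    have "f Q \<in> carrier B.completion" using that by (rule star_homD)
    then show ?thesis by (auto simp: B.carrier_completion)
  qed
  obtain U where U: "U \<in> B.Cauchies" "h P = B.cls U" using rep[OF h P] by blast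
  obtain V where V: "V \<in> B.Cauchies" "k P = B.cls V" using rep[OF k P] by blast
  have UV: "(\<lambda>n. U n - V n) \<in> B.Cauchies" using U V by (simp add: B.Cauchies_diff)
  define L where "L = nrm B.completion (B.cls (\<lambda>n. U n - V n))"
  have L: "(\<lambda>n. B.nm (U n - V n)) \<longlonglongrightarrow> L"
    unfolding L_def using UV by (rule B.nrm_cls)
  have L_le: "L \<le> \<epsilon> + \<epsilon>" if \<epsilon>: "0 < \<epsilon>" for \<epsilon>
  proof -
    obtain N where N: "\<forall>m\<ge>N. \<forall>n\<ge>N. A.nm (Z m - Z n) < \<epsilon>"
      using A.Cauchies_bound[OF Z(1) \<epsilon>] by blast
    let ?D = "\<lambda>n. Z n - Z N"
    have ZN: "Z N \<in> FA X" using A.CauchiesD[OF Z(1)] .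
    have D: "?D \<in> A.Cauchies" using Z(1) A.Cauchies_const[OF ZN] by (rule A.Cauchies_diff)
    then have D_carrier: "A.cls ?D \<in> carrier A.completion" by (simp add: A.carrier_completion)
    have small: "nrm A.completion (A.cls ?D) \<le> \<epsilon>"
      by (rule LIMSEQ_le_const2[OF A.nrm_cls[OF D]]) (use N in \<open>blast intro: less_imp_le\<close>)
    have P_eq: "P = A.cls ?D \<oplus>\<^bsub>A.completion\<^esub> A.cst (Z N)"
      using D A.Cauchies_const[OF ZN] by (simp add: Z A.cst_def A.cls_add)
    obtain K where K: "K \<in> B.Cauchies" "h (A.cst (Z N)) = B.cls K" "k (A.cst (Z N)) = B.cls K"
      using rep[OF h A.cst_closed[OF ZN]] star_hom_eq_on_cst[OF h k gens ZN] by auto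
    \<comment> \<open>Here \<open>S\<close> represents the image of the small remainder
      \<open>?D\<close>, and \<open>K\<close> the common image of the constant class; up to a null
      sequence, \<open>W\<close> is their sum.\<close>
    have split: "\<exists>S\<in>B.Cauchies. (\<lambda>n. B.nm (S n)) \<longlonglongrightarrow> nrm B.completion (B.cls S) \<and>
        nrm B.completion (B.cls S) \<le> \<epsilon> \<and> (\<lambda>n. B.nm (W n - (S n + K n))) \<longlonglongrightarrow> 0"
      if f: "star_hom A.completion B.completion f" and fK: "f (A.cst (Z N)) = B.cls K"
        and W: "W \<in> B.Cauchies" "f P = B.cls W" for f W
    proof -
      obtain S where S: "S \<in> B.Cauchies" "f (A.cls ?D) = B.cls S" using rep[OF f D_carrier] by blast
      have "f P = B.cls S \<oplus>\<^bsub>B.completion\<^esub> B.cls K"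
        using star_homD(2)[OF f D_carrier A.cst_closed[OF ZN]] by (simp add: P_eq S(2) fK)
      then have "B.cls W = B.cls (\<lambda>n. S n + K n)" using S K(1) W(2) by (simp add: B.cls_add)
      then have "(\<lambda>n. B.nm (W n - (S n + K n))) \<longlonglongrightarrow> 0"
        using B.cls_eq_iff[OF W(1) B.Cauchies_add[OF S(1) K(1)]] by simp
      moreover have "nrm B.completion (B.cls S) \<le> \<epsilon>"
        using star_homD(6)[OF f D_carrier] S(2) small by simp
      ultimately show ?thesis using S(1) B.nrm_cls by blast
    qed
    obtain S where S: "S \<in> B.Cauchies" "(\<lambda>n. B.nm (S n)) \<longlonglongrightarrow> nrm B.completion (B.cls S)"
      "nrm B.completion (B.cls S) \<le> \<epsilon>" "(\<lambda>n. B.nm (U n - (S n + K n))) \<longlonglongrightarrow> 0"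
      using split[OF h K(2) U] by (elim bexE conjE)
    obtain T where T: "T \<in> B.Cauchies" "(\<lambda>n. B.nm (T n)) \<longlonglongrightarrow> nrm B.completion (B.cls T)"
      "nrm B.completion (B.cls T) \<le> \<epsilon>" "(\<lambda>n. B.nm (V n - (T n + K n))) \<longlonglongrightarrow> 0"
      using split[OF k K(3) V] by (elim bexE conjE)
    have le: "B.nm (U n - V n) \<le> (B.nm (U n - (S n + K n)) + B.nm (S n)) + (B.nm (V n - (T n + K n)) + B.nm (T n))"
      for n
    proof -
      note FA = B.CauchiesD[OF U(1), of n] B.CauchiesD[OF V(1), of n] B.CauchiesD[OF S(1), of n]
        B.CauchiesD[OF T(1), of n] B.CauchiesD[OF K(1), of n]
      have "B.nm (U n - K n) \<le> B.nm (U n - (S n + K n)) + B.nm (S n)"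
        using B.nm_triangle[of "U n - (S n + K n)" "S n"] FA by (simp add: algebra_simps)
      moreover have "B.nm (V n - K n) \<le> B.nm (V n - (T n + K n)) + B.nm (T n)"
        using B.nm_triangle[of "V n - (T n + K n)" "T n"] FA by (simp add: algebra_simps)
      moreover have "B.nm (U n - V n) \<le> B.nm (U n - K n) + B.nm (V n - K n)"
        using B.nm_diff_triangle[of "U n" "K n" "V n"] B.nm_diff_commute[of "K n" "V n"] FA by simp
      ultimately show ?thesis by simp
    qed
    have "(\<lambda>n. (B.nm (U n - (S n + K n)) + B.nm (S n)) + (B.nm (V n - (T n + K n)) + B.nm (T n)))
        \<longlonglongrightarrow> (0 + nrm B.completion (B.cls S)) + (0 + nrm B.completion (B.cls T))"
      using S T by (intro tendsto_add)
    then have "L \<le> (0 + nrm B.completion (B.cls S)) + (0 + nrm B.completion (B.cls T))"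
      by (rule LIMSEQ_le[OF L]) (use le in blast)
    then show ?thesis using S(3) T(3) by simp
  qed
  have "L \<le> 0"
  proof (rule field_le_epsilon)
    show "L \<le> 0 + \<epsilon>" if "0 < \<epsilon>" for \<epsilon> using L_le[of "\<epsilon> / 2"] that by simp
  qed
  moreover have "0 \<le> L"
    by (rule LIMSEQ_le_const[OF L]) (use B.CauchiesD[OF UV] B.nm_nonneg in auto)
  ultimately have "L = 0" by simp
  then show ?thesis using U V L by (simp add: B.cls_eq_iff)
qed

end

section \<open>The universal seminorm of a graph\<close>

text \<open>Membership is part of the relation because the laws of the seminorm hold only on
  \<open>FA X\<close>.\<close>

definition (in free_cstar_seminorm) eqv :: "'g fsa \<Rightarrow> 'g fsa \<Rightarrow> bool" where
  "eqv a b \<longleftrightarrow> a \<in> FA X \<and> b \<in> FA X \<and> nm (a - b) = 0"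

context free_cstar_seminorm
begin

lemma eqvD: "eqv a b \<Longrightarrow> a \<in> FA X" "eqv a b \<Longrightarrow> b \<in> FA X" "eqv a b \<Longrightarrow> nm (a - b) = 0"
  by (simp_all add: eqv_def)

lemma eqv_refl_iff: "eqv a a \<longleftrightarrow> a \<in> FA X"
  by (simp add: eqv_def)

lemma eqv_nm_eq: "eqv a b \<Longrightarrow> nm a = nm b"
  using nm_abs_diff[of a b] by (simp add: eqv_def)

lemma eqvI:
  assumes "a \<in> FA X" "b \<in> FA X" "nm (a - b) \<le> 0"
  shows "eqv a b"
  using assms nm_nonneg[of "a - b"] by (simp add: eqv_def)

lemma star_congruence_eqv: "star_congruence star eqv"
proof
  fix a b c d :: "'g fsa"
  show "star (a + b) = star a + star b" "star (a * b) = star b * star a" "star (star a) = a"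
    by (simp_all add: star_add star_mult)
  show "eqv 0 0" by (simp add: eqv_def)
  show "eqv b a" if "eqv a b" using that nm_diff_commute[of a b] by (simp add: eqv_def)
  show "eqv a c" if "eqv a b" "eqv b c"
    using that nm_diff_triangle[of a b c] by (intro eqvI) (simp_all add: eqv_def)
  show "eqv (star a) (star b)" if "eqv a b"
    using that by (simp add: eqv_def nm_star_diff)
  \<comment> \<open>By the C*-identity, \<open>(nm a)\<^sup>2 = nm (star a * a)\<close>, and the
    right side is \<open>0\<close>.\<close>
  show "eqv a 0" if "eqv a a" "eqv (star a * a) 0"
    using that nm_star_mult[of a] by (simp add: eqv_def)
  assume ab: "eqv a b" and cd: "eqv c d"
  note FA = eqvD(1,2)[OF ab] eqvD(1,2)[OF cd] and null = eqvD(3)[OF ab] eqvD(3)[OF cd]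
  show "eqv (a + c) (b + d)"
    using nm_add_diff[of a c b d] FA null by (intro eqvI) simp_all
  show "eqv (a - c) (b - d)"
    using nm_add_diff[of a "scal (- 1) c" b "scal (- 1) d"] nm_diff_commute[of c d] FA null
    by (intro eqvI) (simp_all add: scal_minus_one)
  show "eqv (a * c) (b * d)"
    using nm_mult_diff[of a c b d] FA null by (intro eqvI) simp_all
qed

end

sublocale free_cstar_seminorm \<subseteq> cong: star_congruence star eqv
  by (rule star_congruence_eqv)

abbreviation graph_gens :: "('v, 'e) pre_digraph \<Rightarrow> ('v + 'e) set" where
  "graph_gens E \<equiv> verts E <+> arcs E"

abbreviation gen_vert :: "'v \<Rightarrow> ('v + 'e) fsa" where
  "gen_vert v \<equiv> gen (Inl v)"

abbreviation gen_edge :: "'e \<Rightarrow> ('v + 'e) fsa" where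
  "gen_edge e \<equiv> gen (Inr e)"

lemma Inl_in_Plus [simp]: "Inl a \<in> A <+> B \<longleftrightarrow> a \<in> A"
  and Inr_in_Plus [simp]: "Inr b \<in> A <+> B \<longleftrightarrow> b \<in> B"
  by auto

definition admissible :: "('v, 'e) pre_digraph \<Rightarrow> ((('v, 'e) free_elem) \<Rightarrow> real) set" where
  "admissible E = {p. cstar_seminorm (graph_free E) p \<and> (\<forall>(a, b)\<in>graph_relations E. p (a \<ominus>\<^bsub>graph_free E\<^esub> b) = 0)}"

lemma graph_seminorm_eq: "graph_seminorm E x = (SUP p\<in>admissible E. p x)"
  by (simp add: graph_seminorm_def universal_seminorm_def admissible_def)

lemma (in wf_digraph) graph_relations_eq:
  "graph_relations G =
    (\<lambda>(a, b). (coeffs a, coeffs b)) `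
     ({(gen_vert v * gen_vert v, gen_vert v) | v. v \<in> verts G} \<union>
      {(star (gen_vert v), gen_vert v) | v. v \<in> verts G} \<union>
      {(gen_vert u * gen_vert v, 0) | u v. u \<in> verts G \<and> v \<in> verts G \<and> u \<noteq> v} \<union>
      {(star (gen_edge e) * gen_edge e', if e = e' then gen_vert (head G e) else 0)
        | e e'. e \<in> arcs G \<and> e' \<in> arcs G} \<union>
      {(gen_vert (tail G e) * gen_edge e, gen_edge e) | e. e \<in> arcs G} \<union>
      {(gen_vert v, \<Sum>e\<in>out_arcs G v. gen_edge e * star (gen_edge e)) | v. v \<in> reg G})"
proof -
  have sum: "(\<Oplus>\<^bsub>graph_free G\<^esub>e\<in>out_arcs G v. coeffs (gen_edge e * star (gen_edge e))) =
      coeffs (\<Sum>e\<in>out_arcs G v. gen_edge e * star (gen_edge e))" for v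
    unfolding graph_free_def by (rule free_star_algebra_finsum) (auto simp: out_arcs_def)
  have simps: "coeffs a \<otimes>\<^bsub>graph_free G\<^esub> coeffs b = coeffs (a * b)"
    "adj (graph_free G) (coeffs a) = coeffs (star a)" "\<zero>\<^bsub>graph_free G\<^esub> = coeffs 0" for a b
    by (simp_all add: graph_free_def)
  show ?thesis
    unfolding graph_relations_def Let_def free_gen_eq simps sum image_Un setcompr_eq_image
    unfolding image_image image_Collect[symmetric]
    by (intro arg_cong2[where f = "(\<union>)"]) (force simp: image_iff)+
qed

locale graph_free_seminorm = wf_digraph G + free_cstar_seminorm "graph_gens G" p
  for G :: "('v, 'e) pre_digraph" and p
begin

lemma kills_relations_iff:
  "(\<forall>(a, b)\<in>graph_relations G. p (a \<ominus>\<^bsub>graph_free G\<^esub> b) = 0) \<longleftrightarrow> cong.ck_family G gen_vert gen_edge"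
proof -
  have eqv: "p (coeffs a \<ominus>\<^bsub>graph_free G\<^esub> coeffs b) = 0 \<longleftrightarrow> eqv a b"
    if "a \<in> FA (graph_gens G)" "b \<in> FA (graph_gens G)" for a b
    using that by (simp add: graph_free_def eqv_def)
  have ball1: "(\<forall>x\<in>{f v |v. P v}. Q x) \<longleftrightarrow> (\<forall>v. P v \<longrightarrow> Q (f v))" for f :: "'c \<Rightarrow> 'd" and P Q
    by auto
  have ball2: "(\<forall>x\<in>{f u v |u v. P u v}. Q x) \<longleftrightarrow> (\<forall>u v. P u v \<longrightarrow> Q (f u v))" for f :: "'c \<Rightarrow> 'c \<Rightarrow> 'd" and P Q
    by auto
  have sum: "(\<Sum>e\<in>out_arcs G v. gen_edge e * star (gen_edge e)) \<in> FA (graph_gens G)" for v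
    by (rule FA_sum) (auto simp: out_arcs_def)
  show ?thesis
    unfolding graph_relations_eq cong.ck_family_def ball_simps(9) case_prod_conv ball_Un ball1 ball2
    by (simp add: eqv sum reg_def Ball_def cong: conj_cong imp_cong) blast
qed

end

text \<open>Generators have norm at most one, since projections do and \<open>\<parallel>T e\<parallel>\<^sup>2 = \<parallel>T e\<^sup>* T e\<parallel>\<close>.\<close>

lemma (in graph_free_seminorm) nm_gen_le:
  assumes ck: "cong.ck_family G gen_vert gen_edge" and x: "x \<in> graph_gens G"
  shows "nm (gen x) \<le> 1"
proof -
  have vert: "nm (gen_vert v) \<le> 1" if v: "v \<in> verts G" for v
  proof -
    have "eqv (star (gen_vert v) * gen_vert v) (gen_vert v * gen_vert v)"
      using cong.ck_familyD(2,8)[OF ck v] by (rule cong.cong_mult)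
    also have "eqv (gen_vert v * gen_vert v) (gen_vert v)"
      using cong.ck_familyD(1)[OF ck v] .
    finally have "nm (star (gen_vert v) * gen_vert v) = nm (gen_vert v)"
      by (rule eqv_nm_eq)
    then have "nm (gen_vert v) * nm (gen_vert v) = nm (gen_vert v)"
      using v by (simp add: nm_star_mult power2_eq_square)
    then show ?thesis by auto
  qed
  show ?thesis
  proof (cases x)
    case (Inl v)
    then show ?thesis using x vert by simp
  next
    case (Inr e)
    then have e: "e \<in> arcs G" using x by simp
    have "(nm (gen_edge e))\<^sup>2 = nm (star (gen_edge e) * gen_edge e)"
      using e by (simp add: nm_star_mult)
    also have "\<dots> = nm (gen_vert (head G e))"
      by (rule eqv_nm_eq[OF cong.ck_familyD(4)[OF ck e]])
    also have "\<dots> \<le> 1" using e by (intro vert) simp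
    finally have "nm (gen_edge e) \<le> 1"
      using power2_le_imp_le[of "nm (gen_edge e)" 1] by simp
    then show ?thesis using Inr by simp
  qed
qed

context wf_digraph
begin

lemma admissible_iff:
  "p \<in> admissible G \<longleftrightarrow> graph_free_seminorm G p \<and>
    star_congruence.ck_family star (free_cstar_seminorm.eqv (graph_gens G) p) G gen_vert gen_edge"
proof -
  have "cstar_seminorm (graph_free G) p \<longleftrightarrow> graph_free_seminorm G p"
    using wf_digraph_axioms
    by (simp add: graph_free_seminorm_def free_cstar_seminorm_def graph_free_def)
  then show ?thesis
    using graph_free_seminorm.kills_relations_iff[of G p] by (auto simp: admissible_def)
qed

text \<open>The bound on generators propagates through the algebra operations. This makes the
  supremum in \<open>graph_seminorm\<close> a genuine least upper bound of reals.\<close>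

lemma admissible_bounded:
  assumes "a \<in> FA (graph_gens G)"
  shows "\<exists>C. \<forall>p\<in>admissible G. p (coeffs a) \<le> C"
  using assms
proof (induction rule: FA_induct)
  case (gen x)
  have "p (coeffs (gen x)) \<le> 1" if "p \<in> admissible G" for p
    using graph_free_seminorm.nm_gen_le[of G p x] that \<open>x \<in> _\<close> by (simp add: admissible_iff)
  then show ?case by blast
next
  case zero
  have "p (coeffs 0) \<le> 0" if "p \<in> admissible G" for p
  proof -
    interpret graph_free_seminorm G p using that by (simp add: admissible_iff)
    show ?thesis by simp
  qed
  then show ?case by blast
next
  case (add a b)
  then obtain C D where C: "\<forall>p\<in>admissible G. p (coeffs a) \<le> C" "\<forall>p\<in>admissible G. p (coeffs b) \<le> D"
    by blast
  have "p (coeffs (a + b)) \<le> C + D" if p: "p \<in> admissible G" for p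
  proof -
    interpret graph_free_seminorm G p using p by (simp add: admissible_iff)
    show ?thesis using nm_triangle[OF add.hyps] C p by fastforce
  qed
  then show ?case by blast
next
  case (scal c a)
  then obtain C where C: "\<forall>p\<in>admissible G. p (coeffs a) \<le> C" by blast
  have "p (coeffs (scal c a)) \<le> cmod c * C" if p: "p \<in> admissible G" for p
  proof -
    interpret graph_free_seminorm G p using p by (simp add: admissible_iff)
    show ?thesis using nm_scal[OF scal.hyps] C p by (simp add: mult_left_mono)
  qed
  then show ?case by blast
next
  case (mult a b)
  then obtain C D where C: "\<forall>p\<in>admissible G. p (coeffs a) \<le> C" "\<forall>p\<in>admissible G. p (coeffs b) \<le> D"
    by blast
  have "p (coeffs (a * b)) \<le> C * D" if p: "p \<in> admissible G" for p
  proof -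
    interpret graph_free_seminorm G p using p by (simp add: admissible_iff)
    have "nm a * nm b \<le> C * D"
      using C p nm_nonneg mult.hyps by (intro mult_mono) (auto intro: order_trans)
    then show ?thesis using nm_mult[OF mult.hyps] by simp
  qed
  then show ?case by blast
next
  case (star a)
  then obtain C where C: "\<forall>p\<in>admissible G. p (coeffs a) \<le> C" by blast
  have "p (coeffs (star a)) \<le> C" if p: "p \<in> admissible G" for p
  proof -
    interpret graph_free_seminorm G p using p by (simp add: admissible_iff)
    show ?thesis using nm_star[OF star.hyps] C p by simp
  qed
  then show ?case by blast
qed

text \<open>Makes the set of admissible seminorms nonempty, as suprema over it require, and yields
  nonnegativity of the universal seminorm.\<close>

lemma zero_admissible: "(\<lambda>x. 0) \<in> admissible G"
  by (auto simp: admissible_def cstar_seminorm_def)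

lemma graph_seminorm_upper:
  assumes "p \<in> admissible G" "a \<in> FA (graph_gens G)"
  shows "p (coeffs a) \<le> graph_seminorm G (coeffs a)"
  unfolding graph_seminorm_eq
  using assms(1) admissible_bounded[OF assms(2)] by (intro cSUP_upper) (auto simp: bdd_above_def)

lemma graph_seminorm_least:
  assumes "\<And>p. p \<in> admissible G \<Longrightarrow> p (coeffs a) \<le> C"
  shows "graph_seminorm G (coeffs a) \<le> C"
  unfolding graph_seminorm_eq
  using assms zero_admissible by (intro cSUP_least) auto

lemma cstar_seminorm_graph_seminorm: "cstar_seminorm (free_star_algebra (graph_gens G)) (graph_seminorm G)"
proof -
  let ?S = "\<lambda>a. graph_seminorm G (coeffs a)" and ?F = "FA (graph_gens G)"
  note upper = graph_seminorm_upper
  have nonneg: "0 \<le> ?S a" if "a \<in> ?F" for a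
    using upper[OF zero_admissible that] .
  have add: "?S (a + b) \<le> ?S a + ?S b" if ab: "a \<in> ?F" "b \<in> ?F" for a b
  proof (rule graph_seminorm_least)
    fix p assume p: "p \<in> admissible G"
    interpret graph_free_seminorm G p using p by (simp add: admissible_iff)
    show "p (coeffs (a + b)) \<le> ?S a + ?S b"
      using nm_triangle[OF ab] upper[OF p ab(1)] upper[OF p ab(2)] by simp
  qed
  have scal_le: "?S (scal c a) \<le> cmod c * ?S a" if a: "a \<in> ?F" for c a
  proof (rule graph_seminorm_least)
    fix p assume p: "p \<in> admissible G"
    interpret graph_free_seminorm G p using p by (simp add: admissible_iff)
    show "p (coeffs (scal c a)) \<le> cmod c * ?S a"
      using nm_scal[OF a] upper[OF p a] by (simp add: mult_left_mono)
  qed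
  have scal: "?S (scal c a) = cmod c * ?S a" if a: "a \<in> ?F" for c a
  proof (cases "c = 0")
    case True
    then show ?thesis using scal_le[OF a, of 0] nonneg[OF FA_zero] by simp
  next
    case False
    \<comment> \<open>The reverse inequality is the one already shown, applied to
      \<open>inverse c\<close>.\<close>
    have "?S a \<le> cmod (inverse c) * ?S (scal c a)"
      using scal_le[of "scal c a" "inverse c"] a False by (simp add: scal_scal)
    then have "cmod c * ?S a \<le> ?S (scal c a)"
      using False by (simp add: norm_divide field_simps)
    then show ?thesis using scal_le[OF a, of c] by simp
  qed
  have mult: "?S (a * b) \<le> ?S a * ?S b" if ab: "a \<in> ?F" "b \<in> ?F" for a b
  proof (rule graph_seminorm_least)
    fix p assume p: "p \<in> admissible G"
    interpret graph_free_seminorm G p using p by (simp add: admissible_iff)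
    have "nm a * nm b \<le> ?S a * ?S b"
      using upper[OF p ab(1)] upper[OF p ab(2)] nm_nonneg[OF ab(2)] nonneg[OF ab(1)] by (intro mult_mono)
    then show "p (coeffs (a * b)) \<le> ?S a * ?S b"
      using nm_mult[OF ab] by simp
  qed
  have cstar: "?S (star a * a) = (?S a)\<^sup>2" if a: "a \<in> ?F" for a
  proof (rule antisym)
    show "?S (star a * a) \<le> (?S a)\<^sup>2"
    proof (rule graph_seminorm_least)
      fix p assume p: "p \<in> admissible G"
      interpret graph_free_seminorm G p using p by (simp add: admissible_iff)
      show "p (coeffs (star a * a)) \<le> (?S a)\<^sup>2"
        unfolding nm_star_mult[OF a] using upper[OF p a] nm_nonneg[OF a] by (rule power_mono)
    qed
    \<comment> \<open>The square root turns the bound on squares into one on each admissible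
      \<open>p\<close> itself, so that it passes to the supremum.\<close>
    have "?S a \<le> sqrt (?S (star a * a))"
    proof (rule graph_seminorm_least)
      fix p assume p: "p \<in> admissible G"
      interpret graph_free_seminorm G p using p by (simp add: admissible_iff)
      have "(nm a)\<^sup>2 \<le> ?S (star a * a)"
        using upper[OF p, of "star a * a"] a by (simp add: nm_star_mult[OF a])
      then show "p (coeffs a) \<le> sqrt (?S (star a * a))" by (rule real_le_rsqrt)
    qed
    then show "(?S a)\<^sup>2 \<le> ?S (star a * a)"
      using nonneg[OF a] nonneg[of "star a * a"] a
      by (metis FA_mult FA_star power_mono real_sqrt_pow2)
  qed
  show ?thesis
    unfolding cstar_seminorm_def carrier_free_star_algebra
    by (simp add: nonneg add scal mult cstar)
qed

end

text \<open>From here on every well-formed graph carries its own universal seminorm, so that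
  \<open>eqv\<close> and \<open>completion\<close> refer to the graph algebra of the context at
  hand.\<close>

sublocale wf_digraph \<subseteq> graph_free_seminorm G "graph_seminorm G"
  by unfold_locales (rule cstar_seminorm_graph_seminorm)

context wf_digraph
begin

lemma ck_family_generators: "cong.ck_family G gen_vert gen_edge"
proof -
  have "graph_seminorm G (a \<ominus>\<^bsub>graph_free G\<^esub> b) = 0" if "(a, b) \<in> graph_relations G" for a b
  proof -
    have "(SUP p\<in>admissible G. p (a \<ominus>\<^bsub>graph_free G\<^esub> b)) = (SUP p\<in>admissible G. 0)"
      using that by (intro SUP_cong) (auto simp: admissible_def)
    also have "\<dots> = 0" using zero_admissible by (intro cSUP_const) blast
    finally show ?thesis by (simp add: graph_seminorm_eq)
  qed
  then show ?thesis using kills_relations_iff by blast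
qed

text \<open>
  A Cuntz-Krieger family in the target algebra pulls its universal seminorm back to an
  admissible one.
\<close>

lemma nm_subst_le:
  assumes q: "cstar_seminorm (free_star_algebra Y) q"
    and ck: "star_congruence.ck_family star (free_cstar_seminorm.eqv Y q) G (g \<circ> Inl) (g \<circ> Inr)"
    and a: "a \<in> FA (graph_gens G)"
  shows "q (coeffs (subst g a)) \<le> graph_seminorm G (coeffs a)"
proof -
  interpret q: free_cstar_seminorm Y q using q by unfold_locales
  have g: "g x \<in> FA Y" if "x \<in> graph_gens G" for x
    using that q.cong.ck_familyD(8,9)[OF ck] by (auto simp: q.eqv_refl_iff)
  have closed: "subst g b \<in> FA Y" if "b \<in> FA (graph_gens G)" for b
    using g that by (rule subst_closed)
  \<comment> \<open>Seminorms live on coefficient functions while \<open>subst\<close> acts on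
    \<open>fsa\<close>, hence the detour through the inverse of \<open>coeffs\<close>.\<close>
  define p where "p f = q (coeffs (subst g (inv_into UNIV coeffs f)))" for f
  have p: "p (coeffs b) = q (coeffs (subst g b))" for b
  proof -
    have "inv_into UNIV coeffs (coeffs b) = b"
      by (rule inv_f_f) (simp add: inj_def coeffs_inject)
    then show ?thesis by (simp add: p_def)
  qed
  have "cstar_seminorm (free_star_algebra (graph_gens G)) p"
    unfolding cstar_seminorm_def carrier_free_star_algebra
    by (simp add: p closed subst_add subst_scal subst_mult subst_star q.nm_nonneg q.nm_triangle
        q.nm_scal q.nm_mult q.nm_star_mult)
  then interpret p: graph_free_seminorm G p
    by unfold_locales
  \<comment> \<open>Under this equivalence the relations for the generators modulo \<open>p\<close>
    become those for the family \<open>g\<close> modulo \<open>q\<close>, which hold by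
    assumption.\<close>
  have eqv: "p.eqv b c \<longleftrightarrow> q.eqv (subst g b) (subst g c)"
    if "b \<in> FA (graph_gens G)" "c \<in> FA (graph_gens G)" for b c
    using that closed by (simp add: p.eqv_def q.eqv_def p subst_diff)
  have sum: "(\<Sum>e\<in>out_arcs G v. gen_edge e * star (gen_edge e)) \<in> FA (graph_gens G)" for v
    by (rule FA_sum) (auto simp: out_arcs_def)
  have eqv_if: "p.eqv (star (gen_edge e) * gen_edge e') (if e = e' then gen_vert (head G e) else 0) \<longleftrightarrow>
      q.eqv (star (g (Inr e)) * g (Inr e')) (if e = e' then (g \<circ> Inl) (head G e) else 0)"
    if "e \<in> arcs G" "e' \<in> arcs G" for e e'
    using that by (simp add: eqv subst_mult subst_star)
  have "p.cong.ck_family G gen_vert gen_edge"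
    using ck unfolding p.cong.ck_family_def q.cong.ck_family_def
    by (simp add: eqv eqv_if sum subst_mult subst_star subst_sum reg_def split del: if_split)
  then have "p \<in> admissible G"
    using p.graph_free_seminorm_axioms by (simp add: admissible_iff)
  then show ?thesis using graph_seminorm_upper[of p a] a by (simp add: p)
qed

end

section \<open>Induced homomorphisms of a maximal out-split\<close>

context wf_digraph
begin

lemma graph_cstar_eq: "graph_cstar G = completion"
  by (simp add: graph_cstar_def graph_free_def)

lemma S_vert_eq: "S_vert G v = cst (gen_vert v)"
  and S_edge_eq: "S_edge G e = cst (gen_edge e)"
  by (simp_all add: S_vert_def S_edge_def cst_def cls_def graph_free_def free_gen_eq)

lemma cst_eqI: "eqv a b \<Longrightarrow> cst a = cst b"
  by (simp add: cst_eq_iff eqv_def)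

end

locale out_split_algebras = out_split E w n \<epsilon>
  for E :: "('v, 'e) pre_digraph" and w n \<epsilon>
begin

sublocale EO: wf_digraph EO
  by (rule wf_EO)

text \<open>\<open>C\<close> computes in the algebra of \<open>E\<close>, \<open>CO\<close> in that
  of \<open>EO\<close>. Merging generators takes place in \<open>CO\<close> and splitting them in
  \<open>C\<close>, but each composite needs both constructions in one algebra.\<close>

sublocale C: out_split_congruence E w n \<epsilon> star eqv
  by unfold_locales

sublocale CO: out_split_congruence E w n \<epsilon> star EO.eqv
  by unfold_locales

sublocale to_EO: free_cstar_seminorm_pair "graph_gens E" "graph_seminorm E" "graph_gens EO" "graph_seminorm EO"
  by unfold_locales

sublocale to_E: free_cstar_seminorm_pair "graph_gens EO" "graph_seminorm EO" "graph_gens E" "graph_seminorm E"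
  by unfold_locales

definition f_gen :: "'v + 'e \<Rightarrow> ('v \<times> nat + 'e \<times> nat) fsa" where
  "f_gen = case_sum (CO.merge_vert gen_vert) (CO.merge_edge gen_edge)"

definition \<phi>_gen :: "'v \<times> nat + 'e \<times> nat \<Rightarrow> ('v + 'e) fsa" where
  "\<phi>_gen = case_sum (C.split_vert gen_vert gen_edge) (C.split_edge gen_vert gen_edge)"

lemma f_gen_ck: "EO.cong.ck_family E (f_gen \<circ> Inl) (f_gen \<circ> Inr)"
  using CO.merge_ck_family[OF EO.ck_family_generators] by (simp add: f_gen_def comp_def)

lemma \<phi>_gen_ck: "cong.ck_family EO (\<phi>_gen \<circ> Inl) (\<phi>_gen \<circ> Inr)"
  using C.split_ck_family[OF ck_family_generators] by (simp add: \<phi>_gen_def comp_def)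

lemma f_gen_closed: "x \<in> graph_gens E \<Longrightarrow> f_gen x \<in> FA (graph_gens EO)"
  using EO.cong.ck_familyD(8,9)[OF f_gen_ck] by (auto simp: EO.eqv_refl_iff)

lemma \<phi>_gen_closed: "x \<in> graph_gens EO \<Longrightarrow> \<phi>_gen x \<in> FA (graph_gens E)"
  using cong.ck_familyD(8,9)[OF \<phi>_gen_ck] by (auto simp: eqv_refl_iff)

text \<open>Since \<open>subst\<close> respects sums, it carries a merged generator of
  \<open>EO\<close> to the merged split family in the algebra of \<open>E\<close>, where merging
  undoes splitting.\<close>

lemma subst_\<phi>_f_gen:
  assumes "x \<in> graph_gens E"
  shows "eqv (subst \<phi>_gen (f_gen x)) (gen x)"
  using assms C.merge_split_vert[OF ck_family_generators] C.merge_split_edge[OF ck_family_generators]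
  by (auto simp: f_gen_def \<phi>_gen_def CO.merge_vert_def C.merge_vert_def CO.merge_edge_def C.merge_edge_def subst_sum)

lemma subst_f_\<phi>_gen:
  assumes "x \<in> graph_gens EO"
  shows "EO.eqv (subst f_gen (\<phi>_gen x)) (gen x)"
proof -
  have vert: "subst f_gen (C.split_vert gen_vert gen_edge y) =
      CO.split_vert (CO.merge_vert gen_vert) (CO.merge_edge gen_edge) y" for y
    by (simp add: C.split_vert_def CO.split_vert_def subst_mult subst_star f_gen_def)
  have edge: "subst f_gen (C.split_edge gen_vert gen_edge y) =
      CO.split_edge (CO.merge_vert gen_vert) (CO.merge_edge gen_edge) y" for y
    by (simp add: C.split_edge_def CO.split_edge_def subst_mult vert) (simp add: f_gen_def)
  show ?thesis
    using assms CO.split_merge_vert[OF EO.ck_family_generators] CO.split_merge_edge[OF EO.ck_family_generators]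
    by (auto simp: \<phi>_gen_def vert edge)
qed

text \<open>The fibre of the graph homomorphism over a vertex or an edge is the set of its copies,
  so the finite sums in the definition are classes of merged generators.\<close>

lemma contravariantly_induced_iff:
  "contravariantly_induced EO E multi_out_split_hom g \<longleftrightarrow>
    g \<in> extensional (carrier completion) \<and> star_hom completion EO.completion g \<and>
    (\<forall>x\<in>graph_gens E. g (cst (gen x)) = EO.cst (f_gen x))"
proof -
  have vert: "(\<Oplus>\<^bsub>graph_cstar EO\<^esub>u\<in>{u \<in> verts EO. fst multi_out_split_hom u = v}. S_vert EO u) = EO.cst (f_gen (Inl v))"
    if v: "v \<in> verts E" for v
  proof -
    have eq: "{u \<in> verts EO. fst multi_out_split_hom u = v} = Pair v ` {1..split_mult w n v}"
      using v by (auto simp: multi_out_split_hom_def verts_EO image_iff)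
    have "(\<Oplus>\<^bsub>EO.completion\<^esub>u\<in>Pair v ` {1..split_mult w n v}. EO.cst (gen_vert u)) =
        EO.cst (\<Sum>u\<in>Pair v ` {1..split_mult w n v}. gen_vert u)"
      using v by (intro EO.cst_sum) (auto simp: verts_EO)
    then show ?thesis
      unfolding EO.graph_cstar_eq EO.S_vert_eq eq
      by (simp add: f_gen_def CO.merge_vert_def sum.reindex inj_on_def)
  qed
  have edge: "(\<Oplus>\<^bsub>graph_cstar EO\<^esub>x\<in>{x \<in> arcs EO. snd multi_out_split_hom x = e}. S_edge EO x) = EO.cst (f_gen (Inr e))"
    if e: "e \<in> arcs E" for e
  proof -
    have eq: "{x \<in> arcs EO. snd multi_out_split_hom x = e} = Pair e ` {1..split_mult w n (head E e)}"
      using e by (auto simp: multi_out_split_hom_def arcs_EO image_iff)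
    have "(\<Oplus>\<^bsub>EO.completion\<^esub>x\<in>Pair e ` {1..split_mult w n (head E e)}. EO.cst (gen_edge x)) =
        EO.cst (\<Sum>x\<in>Pair e ` {1..split_mult w n (head E e)}. gen_edge x)"
      using e by (intro EO.cst_sum) (auto simp: arcs_EO)
    then show ?thesis
      unfolding EO.graph_cstar_eq EO.S_edge_eq eq
      by (simp add: f_gen_def CO.merge_edge_def sum.reindex inj_on_def)
  qed
  have "contravariantly_induced EO E multi_out_split_hom g \<longleftrightarrow>
    g \<in> extensional (carrier completion) \<and> star_hom completion EO.completion g \<and>
    (\<forall>v\<in>verts E. g (cst (gen_vert v)) = EO.cst (f_gen (Inl v))) \<and>
    (\<forall>e\<in>arcs E. g (cst (gen_edge e)) = EO.cst (f_gen (Inr e)))"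
    unfolding contravariantly_induced_def
    by (simp only: vert edge S_vert_eq S_edge_eq cong: ball_cong) (simp only: graph_cstar_eq EO.graph_cstar_eq)
  then show ?thesis by auto
qed

text \<open>A vertex pair \<open>(v, v)\<close> gives \<open>S\<^sub>v S\<^sub>v\<^sup>*\<close>,
  which agrees with \<open>S\<^sub>v\<close> by the projection relations; at
  \<open>w\<^sup>i\<close> both sides come from the same element of the free algebra.\<close>

lemma S_gis_push_vertex:
  assumes "x \<in> verts EO"
  shows "S_gis E (push (gis_vertex x)) = cst (\<phi>_gen (Inl x))"
proof (cases "fst x = w")
  case True
  have \<epsilon>: "\<epsilon> (snd x) \<in> arcs E" using verts_EO_w[OF assms True] \<epsilon>_arc by simp
  then have "S_gis E (split_phi0 E w n \<epsilon> x) = cst (gen_edge (\<epsilon> (snd x)) * star (gen_edge (\<epsilon> (snd x))))"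
    using verts_EO_w[OF assms True] True
    by (cases x) (simp add: split_phi0_def edge_path_def S_path_def S_edge_eq graph_cstar_eq cst_star cst_mult)
  then show ?thesis
    using True by (simp add: push_vertex[OF assms] \<phi>_gen_def C.split_vert_def)
next
  case False
  have v: "fst x \<in> verts E" using assms by (cases x) (simp add: verts_EO)
  have "S_gis E (split_phi0 E w n \<epsilon> x) = cst (gen_vert (fst x) * star (gen_vert (fst x)))"
    using v False by (cases x) (simp add: split_phi0_def vertex_path_def S_path_def S_vert_eq graph_cstar_eq cst_star cst_mult)
  also have "\<dots> = cst (gen_vert (fst x))"
  proof (rule cst_eqI)
    note ck = cong.ck_familyD(1,2,8)[OF ck_family_generators v]
    show "eqv (gen_vert (fst x) * star (gen_vert (fst x))) (gen_vert (fst x))"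
      by (rule cong.cong_trans[OF cong.cong_mult[OF ck(3,2)] ck(1)])
  qed
  finally show ?thesis
    using False by (simp add: push_vertex[OF assms] \<phi>_gen_def C.split_vert_def)
qed

text \<open>At \<open>w\<close> the two formulas differ only by associativity. Elsewhere
  \<open>S_gis\<close> ends in the adjoint of the target generator and \<open>\<phi>_gen\<close> in
  the generator itself; these agree because vertex generators are self-adjoint up to seminorm
  \<open>0\<close>.\<close>

lemma S_gis_push_edge:
  assumes "x \<in> arcs EO"
  shows "S_gis E (push (GPair (edge_path EO x) (vertex_path (head EO x)))) = cst (\<phi>_gen (Inr x))"
proof -
  obtain e i where x: "x = (e, i)" by fastforce
  have e: "e \<in> arcs E" and i: "1 \<le> i" "i \<le> split_mult w n (head E e)"
    using assms by (simp_all add: x arcs_EO)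
  have head: "head (max_out_split E w n \<epsilon>) (e, i) = (head E e, i)" using head_EO by (simp add: EO_def)
  show ?thesis
  proof (cases "head E e = w")
    case True
    then have \<epsilon>: "\<epsilon> i \<in> arcs E" and i': "i \<le> n" using i \<epsilon>_arc by (simp_all add: split_mult_def)
    have "S_gis E (split_phi1 E w n \<epsilon> x) = cst (gen_edge e * gen_edge (\<epsilon> i) * star (gen_edge (\<epsilon> i)))"
      using e \<epsilon> i i' True
      by (simp add: x split_phi1_def head edge_path_def S_path_def S_edge_eq graph_cstar_eq cst_star cst_mult)
    then show ?thesis
      unfolding push_edge[OF assms]
      using True by (simp add: \<phi>_gen_def C.split_edge_def C.split_vert_def x head_EO mult.assoc)
  next
    case False
    have v: "head E e \<in> verts E" using e by simp
    have "S_gis E (split_phi1 E w n \<epsilon> x) = cst (gen_edge e * star (gen_vert (head E e)))"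
      using e v False
      by (simp add: x split_phi1_def head edge_path_def vertex_path_def S_path_def S_edge_eq S_vert_eq
          graph_cstar_eq cst_star cst_mult)
    also have "\<dots> = cst (gen_edge e * gen_vert (head E e))"
      using cong.ck_familyD(2)[OF ck_family_generators v] cong.ck_familyD(9)[OF ck_family_generators e]
      by (intro cst_eqI cong.cong_mult)
    finally show ?thesis
      unfolding push_edge[OF assms]
      using False by (simp add: \<phi>_gen_def C.split_edge_def C.split_vert_def x head_EO)
  qed
qed

lemma covariantly_induced_iff:
  "covariantly_induced EO E push h \<longleftrightarrow>
    h \<in> extensional (carrier EO.completion) \<and> star_hom EO.completion completion h \<and>
    (\<forall>x\<in>graph_gens EO. h (EO.cst (gen x)) = cst (\<phi>_gen x))"
proof -
  have "covariantly_induced EO E push h \<longleftrightarrow>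
    h \<in> extensional (carrier EO.completion) \<and> star_hom EO.completion completion h \<and>
    (\<forall>v\<in>verts EO. h (EO.cst (gen_vert v)) = cst (\<phi>_gen (Inl v))) \<and>
    (\<forall>e\<in>arcs EO. h (EO.cst (gen_edge e)) = cst (\<phi>_gen (Inr e)))"
    unfolding covariantly_induced_def
    by (simp only: S_gis_push_vertex S_gis_push_edge EO.S_vert_eq EO.S_edge_eq graph_cstar_eq EO.graph_cstar_eq
        cong: ball_cong)
  then show ?thesis by auto
qed

section \<open>Existence, uniqueness and inversion of the induced maps\<close>

lemma contravariantly_induced_ex:
  obtains g where "contravariantly_induced EO E multi_out_split_hom g"
    "\<And>a. a \<in> FA (graph_gens E) \<Longrightarrow> g (cst a) = EO.cst (subst f_gen a)"
proof -
  obtain g where g: "g \<in> extensional (carrier completion)" "star_hom completion EO.completion g"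
    "\<And>a. a \<in> FA (graph_gens E) \<Longrightarrow> g (cst a) = EO.cst (subst f_gen a)"
    using to_EO.star_hom_extension[of f_gen] f_gen_closed
      nm_subst_le[OF EO.cstar_seminorm_graph_seminorm f_gen_ck] by blast
  then show ?thesis using that[of g] by (simp add: contravariantly_induced_iff)
qed

lemma covariantly_induced_ex:
  obtains h where "covariantly_induced EO E push h"
    "\<And>a. a \<in> FA (graph_gens EO) \<Longrightarrow> h (EO.cst a) = cst (subst \<phi>_gen a)"
proof -
  obtain h where h: "h \<in> extensional (carrier EO.completion)" "star_hom EO.completion completion h"
    "\<And>a. a \<in> FA (graph_gens EO) \<Longrightarrow> h (EO.cst a) = cst (subst \<phi>_gen a)"
    using to_E.star_hom_extension[of \<phi>_gen] \<phi>_gen_closed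
      EO.nm_subst_le[OF cstar_seminorm_graph_seminorm \<phi>_gen_ck] by blast
  then show ?thesis using that[of h] by (simp add: covariantly_induced_iff)
qed

lemma contravariantly_induced_unique:
  assumes "contravariantly_induced EO E multi_out_split_hom g" "contravariantly_induced EO E multi_out_split_hom g'"
  shows "g = g'"
proof (rule extensionalityI[of _ "carrier completion"])
  show "g P = g' P" if "P \<in> carrier completion" for P
    using assms that by (intro to_EO.star_hom_eqI[of g g' P]) (simp_all add: contravariantly_induced_iff)
qed (use assms in \<open>simp_all add: contravariantly_induced_iff\<close>)

lemma covariantly_induced_unique:
  assumes "covariantly_induced EO E push h" "covariantly_induced EO E push h'"
  shows "h = h'"
proof (rule extensionalityI[of _ "carrier EO.completion"])
  show "h P = h' P" if "P \<in> carrier EO.completion" for P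
    using assms that by (intro to_E.star_hom_eqI[of h h' P]) (simp_all add: covariantly_induced_iff)
qed (use assms in \<open>simp_all add: covariantly_induced_iff\<close>)

lemma induced_inverse:
  assumes g: "contravariantly_induced EO E multi_out_split_hom g" and h: "covariantly_induced EO E push h"
  shows "P \<in> carrier completion \<Longrightarrow> h (g P) = P" "Q \<in> carrier EO.completion \<Longrightarrow> g (h Q) = Q"
proof -
  interpret to_self: free_cstar_seminorm_pair "graph_gens E" "graph_seminorm E" "graph_gens E" "graph_seminorm E"
    by unfold_locales
  interpret to_self_EO: free_cstar_seminorm_pair "graph_gens EO" "graph_seminorm EO" "graph_gens EO" "graph_seminorm EO"
    by unfold_locales
  have g_hom: "star_hom completion EO.completion g" using g by (simp add: contravariantly_induced_iff)
  have h_hom: "star_hom EO.completion completion h" using h by (simp add: covariantly_induced_iff)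
  \<comment> \<open>By definition \<open>g\<close> is prescribed on generators only; uniqueness
    identifies it with the constructed map, whose values on all constant classes are explicit. The
    same is done for \<open>h\<close> below.\<close>
  obtain g' where "contravariantly_induced EO E multi_out_split_hom g'"
    "\<And>a. a \<in> FA (graph_gens E) \<Longrightarrow> g' (cst a) = EO.cst (subst f_gen a)"
    using contravariantly_induced_ex by blast
  then have g_cst: "g (cst a) = EO.cst (subst f_gen a)" if "a \<in> FA (graph_gens E)" for a
    using contravariantly_induced_unique[OF g] that by blast
  obtain h' where "covariantly_induced EO E push h'"
    "\<And>a. a \<in> FA (graph_gens EO) \<Longrightarrow> h' (EO.cst a) = cst (subst \<phi>_gen a)"
    using covariantly_induced_ex by blast
  then have h_cst: "h (EO.cst a) = cst (subst \<phi>_gen a)" if "a \<in> FA (graph_gens EO)" for a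
    using covariantly_induced_unique[OF h] that by blast
  show "h (g P) = P" if "P \<in> carrier completion"
  proof (rule to_self.star_hom_eqI[OF star_hom_comp[OF g_hom h_hom] star_hom_id _ that])
    fix x assume x: "x \<in> graph_gens E"
    then show "h (g (cst (gen x))) = cst (gen x)"
      using f_gen_closed subst_\<phi>_f_gen by (simp add: g_cst h_cst cst_eqI)
  qed
  show "g (h Q) = Q" if "Q \<in> carrier EO.completion"
  proof (rule to_self_EO.star_hom_eqI[OF star_hom_comp[OF h_hom g_hom] star_hom_id _ that])
    fix x assume x: "x \<in> graph_gens EO"
    then show "g (h (EO.cst (gen x))) = EO.cst (gen x)"
      using \<phi>_gen_closed subst_f_\<phi>_gen by (simp add: g_cst h_cst EO.cst_eqI)
  qed
qed

text \<open>The \<open>restrict\<close> matches the convention that induced maps are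
  \<open>undefined\<close> off the carrier, so the equality holds between functions and not merely
  on the carrier.\<close>

lemma induced_bij:
  assumes g: "contravariantly_induced EO E multi_out_split_hom g" and h: "covariantly_induced EO E push h"
  shows "bij_betw g (carrier (graph_cstar E)) (carrier (graph_cstar EO))"
    and "h = restrict (inv_into (carrier (graph_cstar E)) g) (carrier (graph_cstar EO))"
proof -
  note inverse = induced_inverse[OF g h]
  have g_hom: "star_hom completion EO.completion g" using g by (simp add: contravariantly_induced_iff)
  have h_hom: "star_hom EO.completion completion h" and ext: "h \<in> extensional (carrier EO.completion)"
    using h by (simp_all add: covariantly_induced_iff)
  show bij: "bij_betw g (carrier (graph_cstar E)) (carrier (graph_cstar EO))"
    unfolding graph_cstar_eq EO.graph_cstar_eq
    by (rule bij_betw_byWitness[of _ h]) (use inverse star_homD(1)[OF g_hom] star_homD(1)[OF h_hom] in auto)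
  show "h = restrict (inv_into (carrier (graph_cstar E)) g) (carrier (graph_cstar EO))"
  proof (rule extensionalityI[of _ "carrier EO.completion"])
    fix Q assume Q: "Q \<in> carrier EO.completion"
    have "inv_into (carrier completion) g Q = h Q"
      using bij inverse(2)[OF Q] star_homD(1)[OF h_hom Q]
      by (intro inv_into_f_eq) (auto simp: bij_betw_def graph_cstar_eq)
    then show "h Q = restrict (inv_into (carrier (graph_cstar E)) g) (carrier (graph_cstar EO)) Q"
      using Q by (simp add: graph_cstar_eq EO.graph_cstar_eq)
  qed (simp_all add: ext EO.graph_cstar_eq)
qed

end

theorem theorem5p9:
  fixes E :: "('v, 'e) pre_digraph" and w :: 'v and n :: nat and \<epsilon> :: "nat \<Rightarrow> 'e"
  assumes "wf_digraph E"
    and "w \<in> reg E"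
    and "bij_betw \<epsilon> {1..n} (out_arcs E w)"
  defines "EO \<equiv> max_out_split E w n \<epsilon>"
  shows "\<exists>\<phi>. determine EO E (split_phi0 E w n \<epsilon>) (split_phi1 E w n \<epsilon>) \<phi> \<and>
    regular_eph EO E \<phi> \<and>
    (\<exists>!g. contravariantly_induced EO E multi_out_split_hom g) \<and>
    (\<exists>!h. covariantly_induced EO E \<phi> h) \<and>
    (\<forall>g h. contravariantly_induced EO E multi_out_split_hom g \<and> covariantly_induced EO E \<phi> h \<longrightarrow>
      bij_betw g (carrier (graph_cstar E)) (carrier (graph_cstar EO)) \<and>
      h = restrict (inv_into (carrier (graph_cstar E)) g) (carrier (graph_cstar EO)))"
proof -
  interpret S: out_split_algebras E w n \<epsilon>
    using assms(1-3) by (simp add: out_split_algebras_def out_split_def out_split_axioms_def)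
  have EO: "EO = S.EO" by (simp add: EO_def S.EO_def)
  show ?thesis
    unfolding EO
  proof (intro exI[of _ S.push] conjI allI impI)
    show "\<exists>!g. contravariantly_induced S.EO E multi_out_split_hom g"
      using S.contravariantly_induced_ex S.contravariantly_induced_unique by metis
    show "\<exists>!h. covariantly_induced S.EO E S.push h"
      using S.covariantly_induced_ex S.covariantly_induced_unique by metis
  qed (use S.determine_push S.regular_push S.induced_bij in auto)
qed

end
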